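(* Let $p\geq 5$ be a prime, $\delta=\tfrac12(1-(\tfrac{-3}{p}))$, $\varepsilon=\tfrac12(1-(\tfrac{-1}{p}))$. Then \[ ss_{p}^{(2)}(X) = \sum_{n=0}^{(p-1 + 2\varepsilon )/4 } \binom{2 n}{n} \binom{4 n}{2 n} X^{(p-1 + 2\varepsilon )/4 -n} \pmod{p}, \] \[ ss_{p}^{(3)}(X) = \sum_{n=0}^{(p-1 +2\delta )/3} \binom{2 n}{n} \binom{3 n}{n} X^{(p-1 +2\delta )/3 -n} \pmod{p}. \]
   Context: $(\tfrac{\cdot}{p})$ is the Legendre symbol. $ss^{(2)}_p(X)=\prod_{y\in S_2}(X-y)\in\mathbb{F}_p[X]$ and $ss^{(3)}_p(X)=\prod_{y\in S_3}(X-y)\in\mathbb{F}_p[X]$, where $S_2=\{y\in\overline{\mathbb{F}}_p : y\neq 64,\ (y+192)^3/(y-64)^2 \text{ is a supersingular } j\text{-invariant}\}$ and $S_3=\{y\in\overline{\mathbb{F}}_p: y\ne 27,\ y(y+216)^3/(y-27)^3 \text{ is a supersingular } j\text{-invariant}\}$. It is known (Tsutsumi) that $ss^{(2)}_p(X)=X^{m+\varepsilon}{}_2F_1(-m,\tfrac34-\tfrac{\varepsilon}{2};1;\tfrac{64}{X}) \bmod p$ with $m=[p/4]$ and $ss^{(3)}_p(X)=X^{m+\delta}{}_2F_1(-m,\tfrac23-\tfrac{\delta}{3};1;\tfrac{27}{X})\bmod p$ with $m=[p/3]$, where ${}_2F_1(-m,\beta;1;x)=\sum_{n=0}^m\frac{(-m)_n(\beta)_n}{(n!)^2}x^n$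 with Pochhammer symbols $(a)_n=a(a+1)\cdots(a+n-1)$. *)

theory Defs
  imports
    "HOL-Algebra.Algebraic_Closure_Type"
    "HOL-Number_Theory.Residues"
    "Berlekamp_Zassenhaus.Finite_Field"
begin

(* Elliptic curves are given by short Weierstrass equations y^2 = x^3 + a x + b; this covers all
   elliptic curves up to isomorphism only when the characteristic is not 2 or 3. *)

datatype 'a ec_point = Infinity | Point 'a 'a

definition ec_nonsingular :: "'a::field \<Rightarrow> 'a \<Rightarrow> bool" where
  "ec_nonsingular a b \<longleftrightarrow> 4 * a ^ 3 + 27 * b ^ 2 \<noteq> 0"

definition ec_j :: "'a::field \<Rightarrow> 'a \<Rightarrow> 'a" where
  "ec_j a b = 1728 * (4 * a ^ 3) / (4 * a ^ 3 + 27 * b ^ 2)"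

definition ec_points :: "'a::field \<Rightarrow> 'a \<Rightarrow> 'a ec_point set" where
  "ec_points a b = insert Infinity {Point x y | x y. y ^ 2 = x ^ 3 + a * x + b}"

fun ec_add :: "'a::field \<Rightarrow> 'a ec_point \<Rightarrow> 'a ec_point \<Rightarrow> 'a ec_point" where
  "ec_add a Infinity Q = Q"
| "ec_add a P Infinity = P"
| "ec_add a (Point x\<^sub>1 y\<^sub>1) (Point x\<^sub>2 y\<^sub>2) =
     (if x\<^sub>1 = x\<^sub>2 \<and> y\<^sub>1 = - y\<^sub>2 then Infinity
      else let l = (if x\<^sub>1 = x\<^sub>2 then (3 * x\<^sub>1 ^ 2 + a) / (2 * y\<^sub>1) else (y\<^sub>2 - y\<^sub>1) / (x\<^sub>2 - x\<^sub>1));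
               x\<^sub>3 = l ^ 2 - x\<^sub>1 - x\<^sub>2
           in Point x\<^sub>3 (l * (x\<^sub>1 - x\<^sub>3) - y\<^sub>1))"

definition ec_group :: "'a::field \<Rightarrow> 'a \<Rightarrow> 'a ec_point monoid" where
  "ec_group a b = \<lparr>carrier = ec_points a b, monoid.mult = ec_add a, one = Infinity\<rparr>"

(* No nontrivial p-torsion over the algebraically closed field 'a of characteristic p
   (the group is written multiplicatively, so the power is multiplication by p). *)
definition ec_supersingular :: "'a::alg_closed_field \<Rightarrow> 'a \<Rightarrow> bool" where
  "ec_supersingular a b \<longleftrightarrow>
     (\<forall>P \<in> carrier (ec_group a b).
        P [^]\<^bsub>ec_group a b\<^esub> CHAR('a) = \<one>\<^bsub>ec_group a b\<^esub> \<longrightarrow> P = \<one>\<^bsub>ec_group a b\<^esub>)"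

definition supersingular_j :: "'a::alg_closed_field \<Rightarrow> bool" where
  "supersingular_j j \<longleftrightarrow>
     (\<exists>a b. ec_nonsingular a b \<and> ec_supersingular a b \<and> ec_j a b = j)"

(* With p = CARD('p), 'p mod_ring is the prime field with p elements and 'p mod_ring alg_closure
   its algebraic closure. *)

definition S2 :: "'p::prime_card mod_ring alg_closure set" where
  "S2 = {y. y \<noteq> 64 \<and> supersingular_j ((y + 192) ^ 3 / (y - 64) ^ 2)}"

definition S3 :: "'p::prime_card mod_ring alg_closure set" where
  "S3 = {y. y \<noteq> 27 \<and> supersingular_j (y * (y + 216) ^ 3 / (y - 27) ^ 3)}"

(* The coefficients lie in the prime field, but this is not part of the definition. *)

definition ss2 :: "'p::prime_card mod_ring alg_closure poly" where
  "ss2 = (\<Prod>y\<in>S2. [:- y, 1:])"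

definition ss3 :: "'p::prime_card mod_ring alg_closure poly" where
  "ss3 = (\<Prod>y\<in>S3. [:- y, 1:])"

end

theory Submission
  imports
    Defs
    "HOL-Algebra.Ideal_Product"
    "HOL-Algebra.Sylow"
    "HOL-Number_Theory.Euler_Criterion"
begin

text \<open>
  Let \<open>p\<close> be the characteristic and \<open>f = x^3 + a x + b\<close>. Over a finite field with \<open>q\<close> elements
  containing \<open>a\<close> and \<open>b\<close>, the number of points of \<open>y^2 = f(x)\<close> is congruent modulo \<open>p\<close> to
  \<open>1 - A_q\<close>, where \<open>A_q\<close> is the coefficient of \<open>x^(q-1)\<close> in \<open>f^((q-1)/2)\<close>, and \<open>A_q\<close> is a power
  of \<open>A_p\<close>. By the theorems of Lagrange and Cauchy there is no point of order \<open>p\<close> over the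
  algebraic closure if and only if \<open>A_p = 0\<close>. This needs the group law, whose associativity is
  obtained by sending a point to the class of its maximal ideal in the coordinate ring.

  For the two families of \<open>j\<close>-invariants there are explicit curves \<open>y^2 = x (x^2 - 2 w x + (Y - 64))\<close>
  with \<open>w^2 = Y\<close> and \<open>y^2 = x^3 + (3 w x + 4 (Y - 27))^2\<close> with \<open>w^3 = Y\<close>. Their \<open>A_p\<close> is, up to
  elementary factors, \<open>Y^M F(1 - c/Y)\<close> with \<open>c = 64\<close> or \<open>c = 27\<close>, where \<open>F\<close> is the hypergeometric
  series \<open>2F1(1/4, 3/4; 1; z)\<close> or \<open>2F1(1/3, 2/3; 1; z)\<close> modulo \<open>p\<close>, a polynomial of degree
  \<open>M < p\<close>. The hypergeometric equation is invariant under \<open>z \<mapsto> 1 - z\<close> and has, up to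
  scaling, only one polynomial solution of degree below \<open>p\<close>; hence \<open>F(1 - z)\<close> is proportional to
  \<open>F(z)\<close>, and \<open>F\<close> has simple roots, all different from \<open>0\<close> and \<open>1\<close>.
\<close>

section \<open>The group law via ideal classes\<close>

definition ec_cubic :: "'a::field \<Rightarrow> 'a \<Rightarrow> 'a poly" where
  "ec_cubic a b = [:b, a, 0, 1:]"

text \<open>The pair \<open>(A, B)\<close> stands for \<open>A + B y\<close> in \<open>K[x, y] / (y^2 - x^3 - a x - b)\<close>.\<close>

definition ec_ring :: "'a::field \<Rightarrow> 'a \<Rightarrow> ('a poly \<times> 'a poly) ring" where
  "ec_ring a b = \<lparr>carrier = UNIV,
     monoid.mult = (\<lambda>f g. (fst f * fst g + snd f * snd g * ec_cubic a b, fst f * snd g + snd f * fst g)),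
     one = (1, 0), ring.zero = (0, 0), add = (\<lambda>f g. (fst f + fst g, snd f + snd g))\<rparr>"

lemma ec_ring_simps [simp]:
  "carrier (ec_ring a b) = UNIV"
  "(A, B) \<otimes>\<^bsub>ec_ring a b\<^esub> (C, D) = (A * C + B * D * ec_cubic a b, A * D + B * C)"
  "\<one>\<^bsub>ec_ring a b\<^esub> = (1, 0)"
  "\<zero>\<^bsub>ec_ring a b\<^esub> = (0, 0)"
  "(A, B) \<oplus>\<^bsub>ec_ring a b\<^esub> (C, D) = (A + C, B + D)"
  by (simp_all add: ec_ring_def)

text \<open>The norm down to \<open>K[x]\<close>: the product of \<open>A + B y\<close> with its
  conjugate \<open>A - B y\<close>.\<close>

definition ec_norm :: "'a::field \<Rightarrow> 'a \<Rightarrow> 'a poly \<times> 'a poly \<Rightarrow> 'a poly" where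
  "ec_norm a b f = (fst f)\<^sup>2 - (snd f)\<^sup>2 * ec_cubic a b"

lemma ec_norm_mult:
  "ec_norm a b (f \<otimes>\<^bsub>ec_ring a b\<^esub> g) = ec_norm a b f * ec_norm a b g"
  by (cases f; cases g) (simp add: ec_norm_def algebra_simps power2_eq_square)

lemma degree_ec_cubic [simp]: "degree (ec_cubic a b) = 3" "ec_cubic a b \<noteq> 0"
  by (simp_all add: ec_cubic_def)

text \<open>Nonvanishing makes the ring a domain. The absence of degree 1 will show that the ideal
  of an affine point is not principal.\<close>

lemma ec_norm_nonzero_degree:
  assumes "f \<noteq> (0, 0)"
  shows "ec_norm a b f \<noteq> 0" "degree (ec_norm a b f) \<noteq> 1"
    "degree (ec_norm a b f) = 0 \<Longrightarrow> snd f = 0"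
proof -
  obtain A B where f: "f = (A, B)" by (cases f)
  have A: "degree (A\<^sup>2) = 2 * degree A" by (simp add: degree_power_eq power2_eq_square degree_mult_eq_0 flip: mult_2) (metis degree_0 degree_mult_eq mult_2 mult_zero_right)
  have *: "ec_norm a b f \<noteq> 0 \<and> degree (ec_norm a b f) \<noteq> 1 \<and> (degree (ec_norm a b f) = 0 \<longrightarrow> snd f = 0)"
  proof (cases "B = 0")
    case True
    then show ?thesis using assms A by (simp add: f ec_norm_def)
  next
    case False
    then have B: "degree (- (B\<^sup>2 * ec_cubic a b)) = 2 * degree B + 3"
      by (simp add: degree_mult_eq power2_eq_square)
    \<comment> \<open>The two degrees have different parity, so the leading terms cannot cancel.\<close>
    have "degree (A\<^sup>2) \<noteq> degree (- (B\<^sup>2 * ec_cubic a b))"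
      unfolding A B by presburger
    then consider "degree (A\<^sup>2) < degree (- (B\<^sup>2 * ec_cubic a b))" | "degree (- (B\<^sup>2 * ec_cubic a b)) < degree (A\<^sup>2)"
      by linarith
    then have "degree (A\<^sup>2 + (- (B\<^sup>2 * ec_cubic a b))) \<ge> 2 * degree B + 3"
      unfolding B[symmetric] by cases (simp_all only: degree_add_eq_right degree_add_eq_left less_imp_le order_refl)
    then show ?thesis by (auto simp: f ec_norm_def)
  qed
  then show "ec_norm a b f \<noteq> 0" "degree (ec_norm a b f) \<noteq> 1"
    "degree (ec_norm a b f) = 0 \<Longrightarrow> snd f = 0" by auto
qed

lemma ec_ring_domain: "domain (ec_ring a b)"
proof (intro domainI cringI abelian_groupI comm_monoidI)
  fix f g assume "f \<otimes>\<^bsub>ec_ring a b\<^esub> g = \<zero>\<^bsub>ec_ring a b\<^esub>"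
  then have "ec_norm a b f * ec_norm a b g = 0"
    by (metis ec_norm_mult ec_ring_simps(4) ec_norm_def fst_conv snd_conv diff_zero mult_zero_left power_zero_numeral)
  then show "f = \<zero>\<^bsub>ec_ring a b\<^esub> \<or> g = \<zero>\<^bsub>ec_ring a b\<^esub>"
    using ec_norm_nonzero_degree(1)[of f a b] ec_norm_nonzero_degree(1)[of g a b] by auto
next
  fix f :: "'a poly \<times> 'a poly"
  have "(- fst f, - snd f) \<oplus>\<^bsub>ec_ring a b\<^esub> f = \<zero>\<^bsub>ec_ring a b\<^esub>" by (cases f) simp
  then show "\<exists>g \<in> carrier (ec_ring a b). g \<oplus>\<^bsub>ec_ring a b\<^esub> f = \<zero>\<^bsub>ec_ring a b\<^esub>"
    by (metis UNIV_I ec_ring_simps(1))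
qed (auto simp: ec_ring_def algebra_simps)

text \<open>Equality of ideal classes; multiplying both sides by principal ideals takes the place of
  fractional ideals.\<close>

definition (in ring) ideal_class_eq :: "'a set \<Rightarrow> 'a set \<Rightarrow> bool" where
  "ideal_class_eq I J \<longleftrightarrow> (\<exists>f \<in> carrier R - {\<zero>}. \<exists>g \<in> carrier R - {\<zero>}. (PIdl f) \<cdot> I = (PIdl g) \<cdot> J)"

context cring begin

lemma cgenideal_prod:
  assumes "f \<in> carrier R" "g \<in> carrier R"
  shows "(PIdl f) \<cdot> (PIdl g) = PIdl (f \<otimes> g)"
proof
  have "(PIdl f) \<cdot> (PIdl g) \<subseteq> PIdl (f \<otimes> g)"
  proof
    fix s assume "s \<in> (PIdl f) \<cdot> (PIdl g)"
    then show "s \<in> PIdl (f \<otimes> g)"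
    proof (induct s rule: ideal_prod.induct)
      case (prod i j)
      then obtain u v where "u \<in> carrier R" "v \<in> carrier R" "i = u \<otimes> f" "j = v \<otimes> g"
        by (auto simp: cgenideal_def)
      then have "i \<otimes> j = (u \<otimes> v) \<otimes> (f \<otimes> g)" "u \<otimes> v \<in> carrier R"
        using assms by (simp_all add: m_ac)
      then show ?case by (auto simp: cgenideal_def)
    next
      case (sum s1 s2)
      then show ?case
        using assms by (meson additive_subgroup.a_closed cgenideal_ideal ideal.axioms(1) m_closed)
    qed
  qed
  then show "(PIdl f) \<cdot> (PIdl g) \<subseteq> PIdl (f \<otimes> g)" .
  have "f \<otimes> g \<in> (PIdl f) \<cdot> (PIdl g)"
    using assms by (intro ideal_prod.prod cgenideal_self)
  then show "PIdl (f \<otimes> g) \<subseteq> (PIdl f) \<cdot> (PIdl g)"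
    using assms by (intro cgenideal_minimal ideal_prod_is_ideal cgenideal_ideal)
qed

lemma ideal_prod_left_commute:
  assumes "ideal I R" "ideal J R" "ideal K R"
  shows "I \<cdot> (J \<cdot> K) = J \<cdot> (I \<cdot> K)"
  using assms by (metis ideal_prod_assoc ideal_prod_commute)

lemmas ideal_prod_ac = ideal_prod_assoc ideal_prod_commute ideal_prod_left_commute

end

context domain begin

lemma ideal_class_eq_refl: "ideal I R \<Longrightarrow> ideal_class_eq I I"
  unfolding ideal_class_eq_def using one_closed one_not_zero by blast

lemma ideal_class_eq_sym: "ideal_class_eq I J \<Longrightarrow> ideal_class_eq J I"
  unfolding ideal_class_eq_def by metis

lemma ideal_class_eq_trans:
  assumes "ideal_class_eq I J" "ideal_class_eq J K" and id: "ideal I R" "ideal J R" "ideal K R"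
  shows "ideal_class_eq I K"
proof -
  from assms obtain f g h k where fg: "f \<in> carrier R - {\<zero>}" "g \<in> carrier R - {\<zero>}" "(PIdl f) \<cdot> I = (PIdl g) \<cdot> J"
    "h \<in> carrier R - {\<zero>}" "k \<in> carrier R - {\<zero>}" "(PIdl h) \<cdot> J = (PIdl k) \<cdot> K"
    unfolding ideal_class_eq_def by blast
  have P: "ideal (PIdl f) R" "ideal (PIdl g) R" "ideal (PIdl h) R" "ideal (PIdl k) R"
    using fg by (auto intro: cgenideal_ideal)
  have "(PIdl (f \<otimes> h)) \<cdot> I = (PIdl h) \<cdot> ((PIdl f) \<cdot> I)"
    using fg(1,4) id P by (simp flip: cgenideal_prod add: ideal_prod_ac)
  also have "\<dots> = (PIdl g) \<cdot> ((PIdl h) \<cdot> J)"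
    unfolding fg(3) using id P by (intro ideal_prod_left_commute)
  also have "\<dots> = (PIdl (g \<otimes> k)) \<cdot> K"
    unfolding fg(6) using fg(2,5) id P by (simp flip: cgenideal_prod add: ideal_prod_assoc)
  finally have "(PIdl (f \<otimes> h)) \<cdot> I = (PIdl (g \<otimes> k)) \<cdot> K" .
  moreover have "f \<otimes> h \<in> carrier R - {\<zero>}" "g \<otimes> k \<in> carrier R - {\<zero>}"
    using fg integral by auto
  ultimately show ?thesis unfolding ideal_class_eq_def by blast
qed

lemma ideal_class_eq_mult:
  assumes "ideal_class_eq I J" and id: "ideal I R" "ideal J R" "ideal K R"
  shows "ideal_class_eq (I \<cdot> K) (J \<cdot> K)"
proof -
  from assms obtain f g where fg: "f \<in> carrier R - {\<zero>}" "g \<in> carrier R - {\<zero>}" "(PIdl f) \<cdot> I = (PIdl g) \<cdot> J"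
    unfolding ideal_class_eq_def by blast
  then have "(PIdl f) \<cdot> (I \<cdot> K) = (PIdl g) \<cdot> (J \<cdot> K)"
    using id by (metis DiffD1 cgenideal_ideal ideal_prod_assoc)
  then show ?thesis using fg unfolding ideal_class_eq_def by blast
qed

text \<open>Every element of \<open>(f) I\<close> has the form \<open>f i\<close> with
  \<open>i\<close> in \<open>I\<close>. The generator \<open>g\<close> of \<open>(f) I\<close> is
  therefore some \<open>f h\<close>, and cancelling \<open>f\<close> shows that \<open>h\<close>
  generates \<open>I\<close>.\<close>

lemma ideal_class_eq_carrier:
  assumes "ideal_class_eq I (carrier R)" "ideal I R"
  shows "\<exists>g \<in> carrier R. I = PIdl g"
proof -
  from assms obtain f g where fg: "f \<in> carrier R - {\<zero>}" "g \<in> carrier R - {\<zero>}" "(PIdl f) \<cdot> I = (PIdl g) \<cdot> carrier R"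
    unfolding ideal_class_eq_def by blast
  have eq: "(PIdl f) \<cdot> I = PIdl g"
    using fg by (simp add: ideal_prod_one cgenideal_ideal)
  have mult: "\<exists>i \<in> I. s = f \<otimes> i" if "s \<in> (PIdl f) \<cdot> I" for s
    using that
  proof (induct s rule: ideal_prod.induct)
    case (prod u j)
    then obtain v where "v \<in> carrier R" "u = v \<otimes> f" by (auto simp: cgenideal_def)
    then have "u \<otimes> j = f \<otimes> (v \<otimes> j)" "v \<otimes> j \<in> I"
      using fg prod assms(2) by (auto simp: m_ac ideal.Icarr intro: ideal.I_r_closed)
    then show ?case by blast
  next
    case (sum s1 s2)
    then obtain i j where "i \<in> I" "j \<in> I" "s1 = f \<otimes> i" "s2 = f \<otimes> j" by blast
    then show ?case
      using fg assms(2) 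
      by (intro bexI[of _ "i \<oplus> j"]) (auto simp: r_distr ideal.Icarr additive_subgroup.a_closed ideal.axioms(1))
  qed
  obtain h where h: "h \<in> I" "g = f \<otimes> h"
    using mult[of g] eq fg cgenideal_self by auto
  have hc: "h \<in> carrier R" using h assms(2) ideal.Icarr by metis
  have "I \<subseteq> PIdl h"
  proof
    fix i assume i: "i \<in> I"
    then have "f \<otimes> i \<in> PIdl g"
      unfolding eq[symmetric] using fg by (intro ideal_prod.prod cgenideal_self) auto
    then obtain u where u: "u \<in> carrier R" "f \<otimes> i = u \<otimes> g" by (auto simp: cgenideal_def)
    have ic: "i \<in> carrier R" using i assms(2) ideal.Icarr by metis
    have "f \<otimes> i = f \<otimes> (u \<otimes> h)" using u h hc fg by (simp add: m_ac)
    then have "i = u \<otimes> h" using fg ic u hc m_lcancel[of f i "u \<otimes> h"] by auto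
    then show "i \<in> PIdl h" using u by (auto simp: cgenideal_def)
  qed
  moreover have "PIdl h \<subseteq> I" using h assms(2) by (rule_tac cgenideal_minimal)
  ultimately show ?thesis using hc by blast
qed

end

lemma (in ring) ideal_prod_subset:
  assumes "ideal L R" "\<And>i j. i \<in> I \<Longrightarrow> j \<in> J \<Longrightarrow> i \<otimes> j \<in> L"
  shows "I \<cdot> J \<subseteq> L"
proof
  fix s assume "s \<in> I \<cdot> J"
  then show "s \<in> L"
    using assms by (induct s rule: ideal_prod.induct) (auto simp: additive_subgroup.a_closed ideal.axioms(1))
qed

lemma (in ring) ideal_prod_subset3:
  assumes L: "ideal L R" and id: "ideal I R" "ideal J R" "ideal K R"
    and *: "\<And>i j k. i \<in> I \<Longrightarrow> j \<in> J \<Longrightarrow> k \<in> K \<Longrightarrow> i \<otimes> (j \<otimes> k) \<in> L"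
  shows "I \<cdot> (J \<cdot> K) \<subseteq> L"
proof (rule ideal_prod_subset[OF L])
  fix i s assume i: "i \<in> I" and "s \<in> J \<cdot> K"
  from this(2) show "i \<otimes> s \<in> L"
  proof (induct s rule: ideal_prod.induct)
    case (prod j k)
    then show ?case using i * by blast
  next
    case (sum s1 s2)
    then have "s1 \<in> carrier R" "s2 \<in> carrier R" "i \<in> carrier R"
      using ideal_prod_in_carrier[OF id(2,3)] ideal.Icarr[OF id(1) i] by auto
    then show ?case
      using sum L by (simp add: r_distr additive_subgroup.a_closed ideal.axioms(1))
  qed
qed

section \<open>Ideals of points and the principal ideals of lines\<close>

locale elliptic_curve =
  fixes a b :: "'a::field"
  assumes nonsingular: "ec_nonsingular a b" and two_nonzero: "(2::'a) \<noteq> 0"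
begin

abbreviation "R \<equiv> ec_ring a b"
abbreviation "F \<equiv> ec_cubic a b"

sublocale R: domain R by (rule ec_ring_domain)

text \<open>For an affine point of the curve this is the kernel of evaluation there. Giving
  \<open>Infinity\<close> the unit ideal sends the neutral element to the trivial class.\<close>

fun point_ideal :: "'a ec_point \<Rightarrow> ('a poly \<times> 'a poly) set" where
  "point_ideal Infinity = UNIV"
| "point_ideal (Point x y) = {f. poly (fst f) x + poly (snd f) x * y = 0}"

lemma on_curve_iff: "Point x y \<in> ec_points a b \<longleftrightarrow> poly F x = y\<^sup>2"
  by (auto simp: ec_points_def ec_cubic_def algebra_simps power2_eq_square power3_eq_cube)

lemma point_ideal_ideal:
  assumes "P \<in> ec_points a b"
  shows "ideal (point_ideal P) R"
proof (cases P)
  case Infinity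
  then show ?thesis using R.oneideal by simp
next
  case (Point x y)
  then have F: "poly F x = y\<^sup>2" using assms on_curve_iff by simp
  have inv: "\<ominus>\<^bsub>R\<^esub> f = (- fst f, - snd f)" for f
  proof (rule R.minus_equality)
    show "(- fst f, - snd f) \<oplus>\<^bsub>R\<^esub> f = \<zero>\<^bsub>R\<^esub>" by (cases f) simp
  qed auto
  show ?thesis unfolding Point
  proof (rule idealI)
    show "ring R" by (rule R.ring_axioms)
    show "subgroup (point_ideal (Point x y)) (add_monoid R)"
    proof
      fix f assume "f \<in> point_ideal (Point x y)"
      then show "inv\<^bsub>add_monoid R\<^esub> f \<in> point_ideal (Point x y)"
        unfolding a_inv_def[symmetric] inv by (simp add: add_eq_0_iff)
    next
      fix f g assume "f \<in> point_ideal (Point x y)" "g \<in> point_ideal (Point x y)"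
      moreover have "poly (fst (f \<oplus>\<^bsub>R\<^esub> g)) x + poly (snd (f \<oplus>\<^bsub>R\<^esub> g)) x * y =
          (poly (fst f) x + poly (snd f) x * y) + (poly (fst g) x + poly (snd g) x * y)"
        by (cases f; cases g) (simp add: algebra_simps)
      ultimately show "f \<otimes>\<^bsub>add_monoid R\<^esub> g \<in> point_ideal (Point x y)" by simp
    qed auto
  next
    fix f g assume *: "f \<in> point_ideal (Point x y)"
    have mult: "poly (fst (f \<otimes>\<^bsub>R\<^esub> g)) x + poly (snd (f \<otimes>\<^bsub>R\<^esub> g)) x * y =
        (poly (fst f) x + poly (snd f) x * y) * (poly (fst g) x + poly (snd g) x * y)" for f g
      by (cases f; cases g) (simp add: F algebra_simps power2_eq_square)
    show "g \<otimes>\<^bsub>R\<^esub> f \<in> point_ideal (Point x y)" "f \<otimes>\<^bsub>R\<^esub> g \<in> point_ideal (Point x y)"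
      using * by (simp_all add: mult)
  qed
qed

text \<open>Modulo \<open>y - m\<close> the function \<open>A + B y\<close> becomes
  \<open>A + m B\<close>, a polynomial in one variable with root \<open>x\<close>. Hence every
  function vanishing at the point is a combination of \<open>X - x\<close> and \<open>y - m\<close>,
  for any \<open>m\<close> through the point.\<close>

lemma point_ideal_decompose:
  assumes "f \<in> point_ideal (Point x y)" "poly m x = y"
  obtains C B where "f = ([:- x, 1:] * C - m * B, B)"
proof -
  have "poly (fst f + m * snd f) x = 0"
    using assms by (simp add: mult.commute)
  then obtain C where "fst f + m * snd f = [:- x, 1:] * C"
    by (metis dvdE poly_eq_0_iff_dvd)
  then have "f = ([:- x, 1:] * C - m * snd f, snd f)"
    by (cases f) (simp add: algebra_simps)
  then show thesis using that by blast
qed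

text \<open>The explicit cofactors produce the constant \<open>4 a^3 + 27 b^2\<close>, the
  discriminant of the cubic up to sign, which is invertible.\<close>

lemma cubic_bezout: "\<exists>u v. u * F + v * pderiv F = 1"
proof -
  define D where "D = 4 * a ^ 3 + 27 * b\<^sup>2"
  have "D \<noteq> 0" using nonsingular by (simp add: D_def ec_nonsingular_def)
  have "[:27 * b, - 18 * a:] * F + [:4 * a\<^sup>2, - 9 * b, 6 * a:] * pderiv F = [:D:]"
    by (simp add: ec_cubic_def D_def pderiv_pCons algebra_simps power2_eq_square power3_eq_cube)
  then have "(smult (inverse D) [:27 * b, - 18 * a:]) * F + (smult (inverse D) [:4 * a\<^sup>2, - 9 * b, 6 * a:]) * pderiv F = 1"
    using \<open>D \<noteq> 0\<close>
    by (simp only: mult_smult_left flip: smult_add_right) (simp add: one_pCons)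
  then show ?thesis by blast
qed

lemma in_cgenidealI: "f = h \<otimes>\<^bsub>R\<^esub> g \<Longrightarrow> f \<in> PIdl\<^bsub>R\<^esub> g"
  unfolding cgenideal_def by (intro CollectI exI[of _ h]) simp

lemma ideal_combine:
  assumes "ideal I R"
  shows "f \<in> I \<Longrightarrow> g \<in> I \<Longrightarrow> f \<oplus>\<^bsub>R\<^esub> g \<in> I" "f \<in> I \<Longrightarrow> f \<otimes>\<^bsub>R\<^esub> h \<in> I"
  using additive_subgroup.a_closed[OF ideal.axioms(1)[OF assms]] ideal.I_r_closed[OF assms]
  by simp_all

text \<open>The line \<open>y = m\<close> meets the curve in these three points, counted with
  multiplicity. As points may coincide, the reverse inclusion rests on the coprimality of
  \<open>F\<close> and its derivative.\<close>

lemma point_ideal_line: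
  assumes m: "m = [:c, l:]" and y: "poly m x1 = y1" "poly m x2 = y2" "poly m x3 = y3"
    and F: "F = m\<^sup>2 + [:- x1, 1:] * [:- x2, 1:] * [:- x3, 1:]"
  shows "point_ideal (Point x1 y1) \<cdot>\<^bsub>R\<^esub> (point_ideal (Point x2 y2) \<cdot>\<^bsub>R\<^esub> point_ideal (Point x3 y3))
    = PIdl\<^bsub>R\<^esub> (- m, 1)" (is "?I = PIdl\<^bsub>R\<^esub> ?l")
proof
  define g1 g2 g3 where g: "g1 = [:- x1, 1:]" "g2 = [:- x2, 1:]" "g3 = [:- x3, 1:]"
  note F = F[folded g]
  have id: "ideal (point_ideal (Point x1 y1)) R" "ideal (point_ideal (Point x2 y2)) R"
      "ideal (point_ideal (Point x3 y3)) R"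
    by (intro point_ideal_ideal; simp only: on_curve_iff F poly_add poly_power poly_mult y; simp add: g)+
  show "?I \<subseteq> PIdl\<^bsub>R\<^esub> ?l"
  proof (rule R.ideal_prod_subset3[OF _ id])
    show "ideal (PIdl\<^bsub>R\<^esub> ?l) R" by (simp add: R.cgenideal_ideal)
    fix f1 f2 f3 assume "f1 \<in> point_ideal (Point x1 y1)" "f2 \<in> point_ideal (Point x2 y2)" "f3 \<in> point_ideal (Point x3 y3)"
    then obtain C1 B1 C2 B2 C3 B3 where
      f: "f1 = (g1 * C1 - m * B1, B1)" "f2 = (g2 * C2 - m * B2, B2)" "f3 = (g3 * C3 - m * B3, B3)"
      unfolding g by (metis point_ideal_decompose y)
    \<comment> \<open>The factors are \<open>g1 C1 + B1 (y - m)\<close> and its analogues. In their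
      product \<open>q\<close>, \<open>s\<close> and \<open>t\<close> are the coefficients of the
      first, second and third power of \<open>y - m\<close>; the remaining term
      \<open>C1 C2 C3 g1 g2 g3\<close> is a multiple of \<open>y - m\<close> because
      \<open>g1 g2 g3 = (y - m) (y + m)\<close>.\<close>
    define q where "q = C1 * C2 * g1 * g2 * B3 + C1 * C3 * g1 * g3 * B2 + C2 * C3 * g2 * g3 * B1"
    define s where "s = C1 * g1 * B2 * B3 + C2 * g2 * B1 * B3 + C3 * g3 * B1 * B2"
    define t where "t = B1 * B2 * B3"
    have "f1 \<otimes>\<^bsub>R\<^esub> (f2 \<otimes>\<^bsub>R\<^esub> f3) =
      (C1 * C2 * C3 * m + q - s * m + t * (m\<^sup>2 + F), C1 * C2 * C3 + s - 2 * t * m) \<otimes>\<^bsub>R\<^esub> ?l"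
      unfolding f by (simp add: q_def s_def t_def F algebra_simps power2_eq_square)
    then show "f1 \<otimes>\<^bsub>R\<^esub> (f2 \<otimes>\<^bsub>R\<^esub> f3) \<in> PIdl\<^bsub>R\<^esub> ?l" by (rule in_cgenidealI)
  qed
  have idI: "ideal ?I R" using id by (intro R.ideal_prod_is_ideal)
  have prodI: "f1 \<otimes>\<^bsub>R\<^esub> (f2 \<otimes>\<^bsub>R\<^esub> f3) \<in> ?I" if "f1 \<in> {(g1, 0), ?l}" "f2 \<in> {(g2, 0), ?l}" "f3 \<in> {(g3, 0), ?l}"
    for f1 f2 f3
    using that y by (intro ideal_prod.prod) (auto simp: g)
  define l' where "l' = [:l:]"
  obtain u v where uv: "u * F + v * pderiv F = 1" using cubic_bezout by blast
  have F': "pderiv F = 2 * m * l' + (g1 * g2 + g1 * g3 + g2 * g3)"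
  proof -
    have "pderiv g1 = 1" "pderiv g2 = 1" "pderiv g3 = 1" "pderiv m = l'"
      by (simp_all add: g m l'_def pderiv_pCons)
    then show ?thesis
      unfolding F power2_eq_square by (simp add: pderiv_mult pderiv_add algebra_simps)
  qed
  define r where "r = u * m + 2 * v * l'"
  define s where "s = u * (g1 * g2 * g3) + v * (g1 * g2 + g1 * g3 + g2 * g3)"
  \<comment> \<open>With \<open>g = g1 g2 g3\<close> we have \<open>1 = (r m + s)^2\<close>, where \<open>s\<close> lies in the ideal of \<open>g\<close> and \<open>g'\<close> and where
    \<open>4 m^2\<close> is the square of the difference of the conjugates \<open>y + m\<close> and \<open>y - m\<close>.\<close>
  have rs: "r * m + s = 1"
    using uv[unfolded F'] unfolding r_def s_def by (simp add: F algebra_simps power2_eq_square)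
  define k :: "'a poly" where "k = [:1 / 4:]"
  have "(4::'a) = 2 * 2" by simp
  then have "(4::'a) \<noteq> 0" using two_nonzero by (metis mult_eq_0_iff)
  then have k: "4 * k = 1" by (simp add: k_def numeral_poly one_pCons)
  \<comment> \<open>All three are built from products of elements of the three ideals. After
    division by \<open>y - m\<close> they become \<open>y + m\<close>, \<open>(y - m)^2\<close> and
    \<open>g1 g2 + g1 g3 + g2 g3\<close>.\<close>
  define E1 E2 E3 where
    "E1 = (g1, 0) \<otimes>\<^bsub>R\<^esub> ((g2, 0) \<otimes>\<^bsub>R\<^esub> (g3, 0))" and
    "E2 = ?l \<otimes>\<^bsub>R\<^esub> (?l \<otimes>\<^bsub>R\<^esub> ?l)" and
    "E3 = ((g1, 0) \<otimes>\<^bsub>R\<^esub> ((g2, 0) \<otimes>\<^bsub>R\<^esub> ?l) \<oplus>\<^bsub>R\<^esub> (g1, 0) \<otimes>\<^bsub>R\<^esub> (?l \<otimes>\<^bsub>R\<^esub> (g3, 0)))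
      \<oplus>\<^bsub>R\<^esub> ?l \<otimes>\<^bsub>R\<^esub> ((g2, 0) \<otimes>\<^bsub>R\<^esub> (g3, 0))"
  define w where "w = 2 * r * m + s"
  have E: "E1 \<in> ?I" "E2 \<in> ?I" "E3 \<in> ?I"
    unfolding E1_def E2_def E3_def by (intro prodI ideal_combine(1)[OF idI] insertI1 insertI2 singletonI)+
  \<comment> \<open>Divided by \<open>y - m\<close>, the right side is
    \<open>r^2 k ((y - m)^2 - (y + m) (y - 3 m)) + w s\<close>. The bracket is \<open>4 m^2\<close>,
    so this equals \<open>r^2 m^2 + s (2 r m + s) = (r m + s)^2 = 1\<close>.\<close>
  have "?l = (E1 \<otimes>\<^bsub>R\<^esub> (r\<^sup>2 * k * 3 * m - w * u * m, - (r\<^sup>2 * k) + w * u) \<oplus>\<^bsub>R\<^esub> E2 \<otimes>\<^bsub>R\<^esub> (r\<^sup>2 * k, 0))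
     \<oplus>\<^bsub>R\<^esub> E3 \<otimes>\<^bsub>R\<^esub> (w * v, 0)"
  proof -
    have "r\<^sup>2 * m\<^sup>2 + s * w = (r * m + s)\<^sup>2"
      by (simp add: w_def algebra_simps power2_eq_square)
    then have one: "r\<^sup>2 * m\<^sup>2 + s * w = 1" by (simp add: rs)
    define g where "g = g1 * g2 * g3"
    define g' where "g' = g1 * g2 + g1 * g3 + g2 * g3"
    have E1: "E1 = (g, 0)" by (simp add: E1_def g_def mult.assoc)
    have E2: "E2 = (- (m * m * m) - 3 * m * F, 3 * m\<^sup>2 + F)"
      by (simp add: E2_def power2_eq_square power3_eq_cube algebra_simps)
    have E3: "E3 = (- (m * g'), g')"
      by (simp add: E3_def g'_def algebra_simps)
    have "1 = 4 * k * (r\<^sup>2 * m\<^sup>2) + w * (u * g + v * g')"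
      using one k by (simp add: s_def g_def g'_def mult.commute)
    also have "\<dots> = g * (- (r\<^sup>2 * k) + w * u) + (3 * m\<^sup>2 + F) * (r\<^sup>2 * k) + g' * (w * v)"
      unfolding F g_def[symmetric] by (simp add: algebra_simps)
    finally have snd: "1 = \<dots>" .
    have "- m = (- m) * (g * (- (r\<^sup>2 * k) + w * u) + (3 * m\<^sup>2 + F) * (r\<^sup>2 * k) + g' * (w * v))"
      unfolding snd[symmetric] by simp
    also have "\<dots> = g * (r\<^sup>2 * k * 3 * m - w * u * m) + (- (m * m * m) - 3 * m * F) * (r\<^sup>2 * k) + (- (m * g')) * (w * v)"
      unfolding F g_def[symmetric] by (simp add: algebra_simps power2_eq_square power3_eq_cube)
    finally have fst: "- m = \<dots>" .
    show ?thesis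
      unfolding E1 E2 E3 ec_ring_simps mult_zero_left mult_zero_right add_0_left add_0_right
      by (rule arg_cong2[where f = Pair, OF fst snd])
  qed
  also have "\<dots> \<in> ?I" by (intro ideal_combine[OF idI] E)
  finally show "PIdl\<^bsub>R\<^esub> ?l \<subseteq> ?I" by (intro R.cgenideal_minimal[OF idI])
qed

text \<open>This is the vertical line through the point. With \<open>F = c^2 + g G\<close> the
  product contains \<open>g^2\<close>, \<open>F - c^2 = g G\<close> and \<open>2 c g\<close>, so it
  suffices that \<open>g\<close>, \<open>G\<close> and \<open>2 c\<close> generate the unit ideal.
  For \<open>y \<noteq> 0\<close> the constant \<open>2 c\<close> is a unit; for
  \<open>y = 0\<close> the Bezout identity for \<open>F\<close> and its derivative applies.\<close>

lemma point_ideal_minus: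
  assumes "Point x y \<in> ec_points a b"
  shows "point_ideal (Point x y) \<cdot>\<^bsub>R\<^esub> point_ideal (Point x (- y)) = PIdl\<^bsub>R\<^esub> ([:- x, 1:], 0)"
    (is "?I = PIdl\<^bsub>R\<^esub> ?l")
proof
  define g where g: "g = [:- x, 1:]"
  define c where c: "c = [:y:]"
  have Fx: "poly F x = y\<^sup>2" using assms on_curve_iff by simp
  then have "poly (F - c\<^sup>2) x = 0" by (simp add: c power2_eq_square)
  then obtain G where F: "F = c\<^sup>2 + g * G" unfolding g by (metis dvdE poly_eq_0_iff_dvd diff_eq_eq add.commute)
  have id: "ideal (point_ideal (Point x y)) R" "ideal (point_ideal (Point x (- y))) R"
    using Fx by (intro point_ideal_ideal; simp add: on_curve_iff)+
  show "?I \<subseteq> PIdl\<^bsub>R\<^esub> ?l"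
  proof (rule R.ideal_prod_subset)
    show "ideal (PIdl\<^bsub>R\<^esub> ?l) R" by (simp add: R.cgenideal_ideal)
    fix f1 f2 assume "f1 \<in> point_ideal (Point x y)" "f2 \<in> point_ideal (Point x (- y))"
    moreover have "poly c x = y" "poly (- c) x = - y" by (simp_all add: c)
    ultimately obtain C1 B1 C2 B2 where
      f: "f1 = (g * C1 - c * B1, B1)" "f2 = (g * C2 - (- c) * B2, B2)"
      unfolding g by (metis point_ideal_decompose)
    have "f1 \<otimes>\<^bsub>R\<^esub> f2 = (g * C1 * C2 + C1 * c * B2 - C2 * c * B1 + B1 * B2 * G, C1 * B2 + C2 * B1) \<otimes>\<^bsub>R\<^esub> ?l"
      unfolding f g[symmetric] by (simp add: F algebra_simps power2_eq_square)
    then show "f1 \<otimes>\<^bsub>R\<^esub> f2 \<in> PIdl\<^bsub>R\<^esub> ?l" by (rule in_cgenidealI)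
  qed
  have idI: "ideal ?I R" using id by (intro R.ideal_prod_is_ideal)
  have prodI: "(f1 \<otimes>\<^bsub>R\<^esub> f2) \<otimes>\<^bsub>R\<^esub> h \<in> ?I" if "f1 \<in> {(g, 0), (- c, 1)}" "f2 \<in> {(g, 0), (c, 1)}" for f1 f2 h
    using that by (intro ideal_combine(2)[OF idI] ideal_prod.prod) (auto simp: g c)
  have "\<exists>u v w. u * g + v * G + w * (2 * c) = 1"
  proof (cases "y = 0")
    case True
    then have "c = 0" by (simp add: c)
    obtain u v where uv: "u * F + v * pderiv F = 1" using cubic_bezout by blast
    have "pderiv F = G + g * pderiv G"
      unfolding F \<open>c = 0\<close> by (simp add: pderiv_mult, simp add: g pderiv_pCons)
    with uv have "(u * G + v * pderiv G) * g + v * G + 0 * (2 * c) = 1"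
      unfolding F \<open>c = 0\<close> by (simp add: algebra_simps)
    then show ?thesis by blast
  next
    case False
    then have "0 * g + 0 * G + [:1 / (2 * y):] * (2 * c) = 1"
      using two_nonzero by (simp add: c numeral_poly one_pCons)
    then show ?thesis by blast
  qed
  then obtain u v w where uvw: "u * g + v * G + w * (2 * c) = 1" by blast
  have "?l = (((g, 0) \<otimes>\<^bsub>R\<^esub> (g, 0)) \<otimes>\<^bsub>R\<^esub> (u, 0) \<oplus>\<^bsub>R\<^esub> ((- c, 1) \<otimes>\<^bsub>R\<^esub> (c, 1)) \<otimes>\<^bsub>R\<^esub> (v, 0)) \<oplus>\<^bsub>R\<^esub>
    (((g, 0) \<otimes>\<^bsub>R\<^esub> (c, 1)) \<otimes>\<^bsub>R\<^esub> (w, 0) \<oplus>\<^bsub>R\<^esub> ((- c, 1) \<otimes>\<^bsub>R\<^esub> (g, 0)) \<otimes>\<^bsub>R\<^esub> (- w, 0))"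
  proof -
    have "g = g * (u * g + v * G + w * (2 * c))" by (simp add: uvw)
    also have "\<dots> = g * g * u + (F - c\<^sup>2) * v + 2 * (g * c * w)" unfolding F by (simp add: algebra_simps)
    finally show ?thesis unfolding g[symmetric] by (simp add: algebra_simps power2_eq_square)
  qed
  also have "\<dots> \<in> ?I"
    by (intro ideal_combine(1)[OF idI] prodI insertI1 insertI2 singletonI)
  finally show "PIdl\<^bsub>R\<^esub> ?l \<subseteq> ?I" by (intro R.cgenideal_minimal[OF idI])
qed

end

section \<open>The chord and tangent law and its associativity\<close>

fun ec_neg :: "'a::field ec_point \<Rightarrow> 'a ec_point" where
  "ec_neg Infinity = Infinity"
| "ec_neg (Point x y) = Point x (- y)"

context elliptic_curve begin

lemma ec_neg_closed: "P \<in> ec_points a b \<Longrightarrow> ec_neg P \<in> ec_points a b"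
  by (cases P) (auto simp: ec_points_def)

lemma ec_add_neg: "ec_add a P (ec_neg P) = Infinity" "ec_add a (ec_neg P) P = Infinity"
  by (cases P; simp)+

lemma ec_add_neg_eq_InfinityD: "ec_add a P (ec_neg Q) = Infinity \<Longrightarrow> P = Q"
  by (cases P; cases Q) (auto simp: Let_def split: if_splits)

text \<open>The sum is the reflection of the third intersection with the line. The choice of
  \<open>x3\<close> makes the quadratic coefficients agree, so the two sides of the last equation
  differ by a linear polynomial \<open>e0 + e1 X\<close>. It vanishes at \<open>x1\<close> and
  \<open>x2\<close>; if these coincide, the slope of the tangent gives
  \<open>e1 = 0\<close>.\<close>

lemma ec_add_line:
  assumes P: "Point x1 y1 \<in> ec_points a b" and Q: "Point x2 y2 \<in> ec_points a b"
    and ne: "\<not> (x1 = x2 \<and> y1 = - y2)"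
  obtains c l x3 y3 where "ec_add a (Point x1 y1) (Point x2 y2) = Point x3 y3"
    "poly [:c, l:] x1 = y1" "poly [:c, l:] x2 = y2" "poly [:c, l:] x3 = - y3"
    "F = [:c, l:]\<^sup>2 + [:- x1, 1:] * [:- x2, 1:] * [:- x3, 1:]"
proof -
  define l where "l = (if x1 = x2 then (3 * x1 ^ 2 + a) / (2 * y1) else (y2 - y1) / (x2 - x1))"
  define c where "c = y1 - l * x1"
  define x3 where "x3 = l\<^sup>2 - x1 - x2"
  define y3 where "y3 = l * (x1 - x3) - y1"
  have "ec_add a (Point x1 y1) (Point x2 y2) = Point x3 y3"
    using ne by (auto simp: Let_def l_def x3_def y3_def)
  moreover have "poly [:c, l:] x1 = y1" "poly [:c, l:] x3 = - y3"
    by (simp_all add: c_def y3_def algebra_simps)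
  moreover have F1: "y1\<^sup>2 = x1 ^ 3 + a * x1 + b" and F2: "y2\<^sup>2 = x2 ^ 3 + a * x2 + b"
    using P Q by (auto simp: ec_points_def)
  have y12: "y1 = y2" "y1 \<noteq> 0" if "x1 = x2"
  proof -
    have "y1\<^sup>2 = y2\<^sup>2" using F1 F2 that by simp
    then show "y1 = y2" "y1 \<noteq> 0" using ne that by (auto simp: power2_eq_iff)
  qed
  have l: "l * (x2 - x1) = y2 - y1"
    using y12 by (auto simp: l_def)
  then have "poly [:c, l:] x2 = y2"
    by (simp add: c_def algebra_simps)
  moreover have "F = [:c, l:]\<^sup>2 + [:- x1, 1:] * [:- x2, 1:] * [:- x3, 1:]"
  proof -
    define e1 where "e1 = a - 2 * c * l - (x1 * x2 + x1 * x3 + x2 * x3)"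
    define e0 where "e0 = b - c\<^sup>2 + x1 * x2 * x3"
    have 1: "e1 * x1 + e0 = 0"
      using F1 by (simp add: e1_def e0_def c_def x3_def algebra_simps power2_eq_square power3_eq_cube)
    have y2: "y2 = c + l * x2" using l by (simp add: c_def algebra_simps)
    have 2: "e1 * x2 + e0 = 0"
      using F2 by (simp add: y2 e1_def e0_def x3_def algebra_simps power2_eq_square power3_eq_cube)
    have "e1 = 0"
    proof (cases "x1 = x2")
      case True
      then have "l * (2 * y1) = 3 * x1\<^sup>2 + a" using y12 two_nonzero by (simp add: l_def)
      then show ?thesis
        unfolding e1_def c_def x3_def True[symmetric]
        by (simp add: algebra_simps power2_eq_square)
    next
      case False
      have "e1 * (x1 - x2) = (e1 * x1 + e0) - (e1 * x2 + e0)" by (simp add: algebra_simps)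
      then have "e1 * (x1 - x2) = 0" unfolding 1 2 by simp
      then show ?thesis using False by simp
    qed
    then have "e0 = 0" using 1 by simp
    have "F - ([:c, l:]\<^sup>2 + [:- x1, 1:] * [:- x2, 1:] * [:- x3, 1:]) = [:e0, e1:]"
      by (simp add: e0_def e1_def ec_cubic_def x3_def algebra_simps power2_eq_square)
    then show ?thesis using \<open>e0 = 0\<close> \<open>e1 = 0\<close> by simp
  qed
  ultimately show thesis using that by blast
qed

lemma ec_add_closed:
  assumes "P \<in> ec_points a b" "Q \<in> ec_points a b"
  shows "ec_add a P Q \<in> ec_points a b"
proof (cases "P = Infinity \<or> Q = Infinity \<or> P = ec_neg Q")
  case True
  then show ?thesis using assms by (cases P; cases Q) (auto simp: ec_points_def)
next
  case False
  then obtain x1 y1 x2 y2 where PQ: "P = Point x1 y1" "Q = Point x2 y2" "\<not> (x1 = x2 \<and> y1 = - y2)"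
    by (cases P; cases Q) auto
  obtain c l x3 y3 where *: "ec_add a (Point x1 y1) (Point x2 y2) = Point x3 y3"
    "poly [:c, l:] x3 = - y3" "F = [:c, l:]\<^sup>2 + [:- x1, 1:] * [:- x2, 1:] * [:- x3, 1:]"
    using ec_add_line assms PQ by metis
  have "poly F x3 = (poly [:c, l:] x3)\<^sup>2"
    unfolding *(3) poly_add poly_power poly_mult by simp
  then show ?thesis using * by (simp add: PQ on_curve_iff)
qed

lemma ideal_class_eqI:
  assumes "(PIdl\<^bsub>R\<^esub> f) \<cdot>\<^bsub>R\<^esub> I = (PIdl\<^bsub>R\<^esub> g) \<cdot>\<^bsub>R\<^esub> J" "f \<noteq> (0, 0)" "g \<noteq> (0, 0)"
  shows "R.ideal_class_eq I J"
  unfolding R.ideal_class_eq_def by (rule bexI[of _ f], rule bexI[of _ g], fact) (use assms(2,3) in simp_all)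

lemma ideal_class_trivial: "f \<noteq> (0, 0) \<Longrightarrow> R.ideal_class_eq UNIV (PIdl\<^bsub>R\<^esub> f)"
proof -
  assume f: "f \<noteq> (0, 0)"
  have "(PIdl\<^bsub>R\<^esub> f) \<cdot>\<^bsub>R\<^esub> UNIV = (PIdl\<^bsub>R\<^esub> \<one>\<^bsub>R\<^esub>) \<cdot>\<^bsub>R\<^esub> (PIdl\<^bsub>R\<^esub> f)"
    using R.ideal_prod_one[OF R.cgenideal_ideal, of f] R.cgenideal_prod[of "\<one>\<^bsub>R\<^esub>" f] R.l_one[of f]
    by (simp only: ec_ring_simps(1) UNIV_I simp_thms)
  then show ?thesis by (rule ideal_class_eqI) (use f in simp_all)
qed

text \<open>The map from points to ideal classes is multiplicative. For an affine sum
  \<open>S\<close>, multiply the line relation for \<open>P\<close>, \<open>Q\<close> and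
  \<open>- S\<close> by the ideal of \<open>S\<close> and replace the ideals of \<open>S\<close> and
  \<open>- S\<close> by that of a vertical line.\<close>

lemma point_ideal_add:
  assumes "P \<in> ec_points a b" "Q \<in> ec_points a b"
  shows "R.ideal_class_eq (point_ideal (ec_add a P Q)) (point_ideal P \<cdot>\<^bsub>R\<^esub> point_ideal Q)"
proof -
  note id = point_ideal_ideal[OF assms(1)] point_ideal_ideal[OF assms(2)]
  show ?thesis
  proof (cases "P = Infinity \<or> Q = Infinity")
    case True
    then have "point_ideal (ec_add a P Q) = point_ideal P \<cdot>\<^bsub>R\<^esub> point_ideal Q"
    proof
      assume "P = Infinity"
      then have "point_ideal P \<cdot>\<^bsub>R\<^esub> point_ideal Q = point_ideal Q \<cdot>\<^bsub>R\<^esub> carrier R"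
        using R.ideal_prod_commute[OF id] by simp
      then show ?thesis using R.ideal_prod_one[OF id(2)] \<open>P = Infinity\<close> by simp
    next
      assume "Q = Infinity"
      then show ?thesis using R.ideal_prod_one[OF id(1)] by (cases P) simp_all
    qed
    then show ?thesis
      using R.ideal_class_eq_refl point_ideal_ideal[OF ec_add_closed[OF assms]] by simp
  next
    case False
    then obtain x1 y1 x2 y2 where PQ: "P = Point x1 y1" "Q = Point x2 y2"
      by (cases P; cases Q) auto
    show ?thesis
    proof (cases "x1 = x2 \<and> y1 = - y2")
      case True
      then have "point_ideal P \<cdot>\<^bsub>R\<^esub> point_ideal Q = PIdl\<^bsub>R\<^esub> ([:- x1, 1:], 0)"
        using point_ideal_minus[of x1 y1] assms PQ by auto
      then show ?thesis using ideal_class_trivial[of "([:- x1, 1:], 0)"] True PQ by simp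
    next
      case ne: False
      obtain c l x3 y3 where S: "ec_add a (Point x1 y1) (Point x2 y2) = Point x3 y3"
        and *: "poly [:c, l:] x1 = y1" "poly [:c, l:] x2 = y2" "poly [:c, l:] x3 = - y3"
        "F = [:c, l:]\<^sup>2 + [:- x1, 1:] * [:- x2, 1:] * [:- x3, 1:]"
        using ec_add_line[OF assms[unfolded PQ] ne] .
      have pts: "Point x3 y3 \<in> ec_points a b" "Point x3 (- y3) \<in> ec_points a b"
        using ec_add_closed[OF assms] S PQ by (auto simp: ec_points_def)
      note idS = pts[THEN point_ideal_ideal]
      have L: "ideal (PIdl\<^bsub>R\<^esub> f) R" for f by (simp add: R.cgenideal_ideal)
      have "(PIdl\<^bsub>R\<^esub> (- [:c, l:], 1)) \<cdot>\<^bsub>R\<^esub> point_ideal (Point x3 y3) =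
        (point_ideal P \<cdot>\<^bsub>R\<^esub> (point_ideal Q \<cdot>\<^bsub>R\<^esub> point_ideal (Point x3 (- y3)))) \<cdot>\<^bsub>R\<^esub> point_ideal (Point x3 y3)"
        unfolding PQ by (subst point_ideal_line[OF refl *]) (rule refl)
      also have "\<dots> = (point_ideal (Point x3 y3) \<cdot>\<^bsub>R\<^esub> point_ideal (Point x3 (- y3))) \<cdot>\<^bsub>R\<^esub> (point_ideal P \<cdot>\<^bsub>R\<^esub> point_ideal Q)"
        using id idS by (simp only: R.ideal_prod_ac R.ideal_prod_is_ideal)
      also have "\<dots> = (PIdl\<^bsub>R\<^esub> ([:- x3, 1:], 0)) \<cdot>\<^bsub>R\<^esub> (point_ideal P \<cdot>\<^bsub>R\<^esub> point_ideal Q)"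
        unfolding point_ideal_minus[OF pts(1)] ..
      finally show ?thesis
        unfolding PQ S by (rule ideal_class_eqI) simp_all
    qed
  qed
qed

text \<open>A generator \<open>g\<close> would divide the functions for the vertical and the
  horizontal line through the point, whose norms have degrees 2 and 3. This forces \<open>g\<close>
  to be a nonzero constant, which does not vanish at the point.\<close>

lemma point_ideal_principal:
  assumes "P \<in> ec_points a b" "R.ideal_class_eq (point_ideal P) UNIV"
  shows "P = Infinity"
proof (rule ccontr)
  assume "P \<noteq> Infinity"
  then obtain x y where P: "P = Point x y" by (cases P) auto
  obtain g where g: "point_ideal P = PIdl\<^bsub>R\<^esub> g"
    using R.ideal_class_eq_carrier[of "point_ideal P"] assms point_ideal_ideal by auto
  have self: "g \<in> point_ideal P" unfolding g by (rule R.cgenideal_self) simp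
  then have gP: "poly (fst g) x + poly (snd g) x * y = 0" by (simp add: P)
  have "([:- x, 1:], 0) \<in> point_ideal P" "([:- y:], 1) \<in> point_ideal P" by (simp_all add: P)
  then obtain u v where u: "([:- x, 1:], 0) = u \<otimes>\<^bsub>R\<^esub> g" and v: "([:- y:], 1) = v \<otimes>\<^bsub>R\<^esub> g"
    unfolding g cgenideal_def by blast
  have z: "(0, 0) \<otimes>\<^bsub>R\<^esub> f = (0, 0)" "f \<otimes>\<^bsub>R\<^esub> (0, 0) = (0, 0)" for f by (cases f; simp)+
  have nz: "u \<noteq> (0, 0)" "v \<noteq> (0, 0)" "g \<noteq> (0, 0)" using u v by (auto simp: z)
  have dN: "degree (ec_norm a b (f \<otimes>\<^bsub>R\<^esub> g)) = degree (ec_norm a b f) + degree (ec_norm a b g)"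
    if "f \<noteq> (0, 0)" for f
    using that nz by (simp add: ec_norm_mult degree_mult_eq ec_norm_nonzero_degree(1))
  have "degree (ec_norm a b u) + degree (ec_norm a b g) = 2"
    unfolding dN[OF nz(1), symmetric] u[symmetric] by (simp add: ec_norm_def power2_eq_square)
  moreover have "degree (ec_norm a b v) + degree (ec_norm a b g) = 3"
  proof -
    have "degree (- F + [:y\<^sup>2:]) = 3" by (subst degree_add_eq_left) auto
    then show ?thesis
      unfolding dN[OF nz(2), symmetric] v[symmetric] by (simp add: ec_norm_def power2_eq_square)
  qed
  \<comment> \<open>A norm never has degree \<open>1\<close>, which rules out \<open>1\<close> and, by the second sum, \<open>2\<close>.\<close>
  ultimately have d: "degree (ec_norm a b g) = 0"
    using nz[THEN ec_norm_nonzero_degree(2), of a b] by linarith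
  then have s: "snd g = 0" using ec_norm_nonzero_degree(3) nz by blast
  then have "fst g \<noteq> 0" using nz by (cases g) auto
  moreover have "degree (fst g) = 0"
    using d s calculation by (simp add: ec_norm_def power2_eq_square degree_mult_eq)
  ultimately show False using gP s by (auto elim!: degree_eq_zeroE)
qed

text \<open>Both sides have the class of the product of the three point ideals. Hence the difference
  \<open>?W\<close> of the two sides has the trivial class, so it is \<open>Infinity\<close> and the
  sides agree.\<close>

lemma ec_add_assoc:
  assumes "P \<in> ec_points a b" "Q \<in> ec_points a b" "S \<in> ec_points a b"
  shows "ec_add a (ec_add a P Q) S = ec_add a P (ec_add a Q S)" (is "?U = ?V")
proof -
  note [intro] = assms ec_add_closed ec_neg_closed point_ideal_ideal R.ideal_prod_is_ideal
  note trans = R.ideal_class_eq_trans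
  have "R.ideal_class_eq (point_ideal ?U) (point_ideal (ec_add a P Q) \<cdot>\<^bsub>R\<^esub> point_ideal S)"
    by (rule point_ideal_add; blast)
  moreover have "R.ideal_class_eq (point_ideal (ec_add a P Q) \<cdot>\<^bsub>R\<^esub> point_ideal S)
      ((point_ideal P \<cdot>\<^bsub>R\<^esub> point_ideal Q) \<cdot>\<^bsub>R\<^esub> point_ideal S)"
    by (rule R.ideal_class_eq_mult[OF point_ideal_add]; blast)
  ultimately have U: "R.ideal_class_eq (point_ideal ?U) ((point_ideal P \<cdot>\<^bsub>R\<^esub> point_ideal Q) \<cdot>\<^bsub>R\<^esub> point_ideal S)"
    by (rule trans; blast)
  have "R.ideal_class_eq (point_ideal ?V) (point_ideal P \<cdot>\<^bsub>R\<^esub> point_ideal (ec_add a Q S))"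
    by (rule point_ideal_add; blast)
  moreover have "point_ideal P \<cdot>\<^bsub>R\<^esub> point_ideal (ec_add a Q S) = point_ideal (ec_add a Q S) \<cdot>\<^bsub>R\<^esub> point_ideal P"
    by (rule R.ideal_prod_commute; blast)
  moreover have "R.ideal_class_eq (point_ideal (ec_add a Q S) \<cdot>\<^bsub>R\<^esub> point_ideal P)
      ((point_ideal Q \<cdot>\<^bsub>R\<^esub> point_ideal S) \<cdot>\<^bsub>R\<^esub> point_ideal P)"
    by (rule R.ideal_class_eq_mult[OF point_ideal_add]; blast)
  moreover have "(point_ideal Q \<cdot>\<^bsub>R\<^esub> point_ideal S) \<cdot>\<^bsub>R\<^esub> point_ideal P =
      (point_ideal P \<cdot>\<^bsub>R\<^esub> point_ideal Q) \<cdot>\<^bsub>R\<^esub> point_ideal S"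
    using assms[THEN point_ideal_ideal] by (simp only: R.ideal_prod_ac R.ideal_prod_is_ideal)
  ultimately have V: "R.ideal_class_eq (point_ideal ?V) ((point_ideal P \<cdot>\<^bsub>R\<^esub> point_ideal Q) \<cdot>\<^bsub>R\<^esub> point_ideal S)"
    by (metis trans assms ec_add_closed point_ideal_ideal R.ideal_prod_is_ideal)
  have UV: "R.ideal_class_eq (point_ideal ?U) (point_ideal ?V)"
    by (rule trans[OF U R.ideal_class_eq_sym[OF V]]; blast)
  let ?W = "ec_add a ?U (ec_neg ?V)"
  have "R.ideal_class_eq (point_ideal ?W) (point_ideal ?U \<cdot>\<^bsub>R\<^esub> point_ideal (ec_neg ?V))"
    by (rule point_ideal_add; blast)
  moreover have "R.ideal_class_eq (point_ideal ?U \<cdot>\<^bsub>R\<^esub> point_ideal (ec_neg ?V)) (point_ideal ?V \<cdot>\<^bsub>R\<^esub> point_ideal (ec_neg ?V))"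
    by (rule R.ideal_class_eq_mult[OF UV]; blast)
  ultimately have W: "R.ideal_class_eq (point_ideal ?W) (point_ideal ?V \<cdot>\<^bsub>R\<^esub> point_ideal (ec_neg ?V))"
    by (rule trans; blast)
  have V0: "R.ideal_class_eq (point_ideal (ec_add a ?V (ec_neg ?V))) (point_ideal ?V \<cdot>\<^bsub>R\<^esub> point_ideal (ec_neg ?V))"
    by (rule point_ideal_add; blast)
  have "R.ideal_class_eq (point_ideal ?W) (point_ideal (ec_add a ?V (ec_neg ?V)))"
    by (rule trans[OF W R.ideal_class_eq_sym[OF V0]]; blast)
  then have "?W = Infinity"
    by (intro point_ideal_principal ec_add_closed ec_neg_closed assms) (simp_all add: ec_add_neg)
  then show ?thesis by (rule ec_add_neg_eq_InfinityD)
qed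

theorem ec_group_group: "group (ec_group a b)"
proof (rule groupI)
  fix P assume "P \<in> carrier (ec_group a b)"
  then show "\<exists>Q \<in> carrier (ec_group a b). Q \<otimes>\<^bsub>ec_group a b\<^esub> P = \<one>\<^bsub>ec_group a b\<^esub>"
    using ec_neg_closed ec_add_neg by (auto simp: ec_group_def)
qed (auto simp: ec_group_def ec_add_closed ec_add_assoc, simp add: ec_points_def)

end

section \<open>Counting points over finite fields\<close>

text \<open>A repeated factor would give a root of the derivative as well, so the multiset of roots
  is a set. This serves both to count a finite subfield and to recognize the products over
  supersingular parameters.\<close>

lemma alg_closed_simple_roots:
  fixes p :: "'a::alg_closed_field poly"
  assumes "p \<noteq> 0" and simple: "\<And>x. poly p x = 0 \<Longrightarrow> poly (pderiv p) x \<noteq> 0"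
  shows "p = smult (lead_coeff p) (\<Prod>x | poly p x = 0. [:- x, 1:])"
    and "card {x. poly p x = 0} = degree p"
proof -
  obtain A where A: "size A = degree p" "p = smult (lead_coeff p) (\<Prod>x\<in>#A. [:- x, 1:])"
    using alg_closed_imp_factorization[OF assms(1)] by blast
  have lc: "lead_coeff p \<noteq> 0" using assms by simp
  have count: "count A x \<le> 1" for x
  proof (rule ccontr)
    assume "\<not> count A x \<le> 1"
    then have "2 \<le> count A x" by simp
    then have "replicate_mset 2 x \<subseteq># A" by (simp add: count_le_replicate_mset_subset_eq)
    then obtain B where "A = replicate_mset 2 x + B" by (metis subset_mset.le_iff_add)
    then have p: "p = [:- x, 1:] * ([:- x, 1:] * smult (lead_coeff p) (\<Prod>x\<in>#B. [:- x, 1:]))"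
      using A(2) by (simp add: numeral_2_eq_2)
    have "poly p x = 0" by (subst p) simp
    moreover have "poly (pderiv p) x = 0" by (subst p, simp only: pderiv_mult) (simp add: pderiv_pCons)
    ultimately show False using simple by blast
  qed
  have set: "set_mset A = {x. poly p x = 0}"
    by (subst A(2)) (auto simp: poly_prod_mset prod_mset_zero_iff lc assms)
  have "count A x = count (mset_set (set_mset A)) x" for x
  proof (cases "x \<in># A")
    case True
    then have "count A x > 0" by simp
    with count[of x] have "count A x = 1" by linarith
    then show ?thesis using True by simp
  next
    case False
    then show ?thesis by (simp add: count_eq_zero_iff)
  qed
  then have eq: "A = mset_set {x. poly p x = 0}" unfolding set[symmetric] by (rule multiset_eqI)
  show "p = smult (lead_coeff p) (\<Prod>x | poly p x = 0. [:- x, 1:])"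
    using A(2) unfolding eq by (simp add: prod_unfold_prod_mset)
  show "card {x. poly p x = 0} = degree p"
    using A(1) unfolding eq by simp
qed

text \<open>For a positive power \<open>q\<close> of an odd prime characteristic and an
  algebraically closed field, this is the subfield with \<open>q\<close> elements. Describing it as
  the fixed points of Frobenius keeps all finite subfields in one type.\<close>

definition fixed_field :: "nat \<Rightarrow> 'a::field set" where
  "fixed_field q = {x. x ^ q = x}"

locale char_power =
  fixes q :: nat and ty :: "'a::alg_closed_field itself"
  assumes prime_char: "prime CHAR('a)" and odd_char: "odd CHAR('a)"
    and q: "\<exists>n > 0. q = CHAR('a) ^ n"
begin

abbreviation "k \<equiv> (fixed_field q :: 'a set)"

lemma q_ge_3: "q \<ge> 3" and odd_q: "odd q" and of_nat_q: "(of_nat q :: 'a) = 0"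
proof -
  obtain n where n: "n > 0" "q = CHAR('a) ^ n" using q by blast
  have "CHAR('a) \<ge> 3" using prime_char odd_char prime_ge_2_nat[OF prime_char] by (cases "CHAR('a) = 2") auto
  moreover have "CHAR('a) ^ 1 \<le> CHAR('a) ^ n" using n calculation by (intro power_increasing) auto
  ultimately show "q \<ge> 3" using n by simp
  show "odd q" using n odd_char by simp
  show "(of_nat q :: 'a) = 0" using n by simp
qed

lemma two_nonzero: "(2::'a) \<noteq> 0"
proof
  assume "(2::'a) = 0"
  then have "of_nat 2 = (0::'a)" by simp
  then have "CHAR('a) dvd 2" using of_nat_eq_0_iff_char_dvd by blast
  then show False using odd_char prime_char by (metis dvd_antisym dvd_refl primes_dvd_imp_eq two_is_prime_nat)
qed

lemma power_q_add: "(x + y :: 'a) ^ q = x ^ q + y ^ q"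
  using q freshmans_dream'[OF prime_char] by blast

lemma fixed_field_closed:
  "0 \<in> k" "1 \<in> k"
  "x \<in> k \<Longrightarrow> y \<in> k \<Longrightarrow> x + y \<in> k" "x \<in> k \<Longrightarrow> - x \<in> k" "x \<in> k \<Longrightarrow> y \<in> k \<Longrightarrow> x - y \<in> k"
  "x \<in> k \<Longrightarrow> y \<in> k \<Longrightarrow> x * y \<in> k" "x \<in> k \<Longrightarrow> y \<in> k \<Longrightarrow> x / y \<in> k" "x \<in> k \<Longrightarrow> x ^ n \<in> k"
proof -
  show add: "x \<in> k \<Longrightarrow> y \<in> k \<Longrightarrow> x + y \<in> k" for x y by (simp add: fixed_field_def power_q_add)
  show minus: "x \<in> k \<Longrightarrow> - x \<in> k" for x using odd_q by (simp add: fixed_field_def power_minus_odd)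
  show "x \<in> k \<Longrightarrow> y \<in> k \<Longrightarrow> x - y \<in> k" using add[of x "- y"] minus by simp
  show "x \<in> k \<Longrightarrow> x ^ n \<in> k" by (simp add: fixed_field_def) (metis power_commuting_commutes power_commutes power_mult mult.commute)
qed (use q_ge_3 in \<open>auto simp: fixed_field_def power_mult_distrib power_divide\<close>)

lemma fixed_field_numeral: "numeral n \<in> k"
  by (induction n) (simp_all only: numeral.simps fixed_field_closed)

lemma fixed_field_finite: "finite k" and card_fixed_field: "card k = q"
proof -
  let ?p = "Polynomial.monom 1 q - [:0, 1:] :: 'a poly"
  have k: "k = {x. poly ?p x = 0}" by (auto simp: fixed_field_def poly_monom)
  have deg: "degree ?p = q"
    using q_ge_3 by (subst diff_conv_add_uminus, subst degree_add_eq_left) (auto simp: degree_monom_eq)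
  have "?p \<noteq> 0" using deg q_ge_3 by auto
  then show "finite k" unfolding k by (rule poly_roots_finite)
  have "pderiv ?p = - 1"
    by (simp add: pderiv_diff pderiv_monom of_nat_q pderiv_pCons one_pCons)
  then show "card k = q"
    unfolding k using alg_closed_simple_roots(2)[OF \<open>?p \<noteq> 0\<close>] deg by simp
qed

lemma fixed_field_power: "x \<in> k \<Longrightarrow> x \<noteq> 0 \<Longrightarrow> x ^ (q - 1) = 1"
proof -
  assume "x \<in> k" "x \<noteq> 0"
  then have "x ^ (q - 1) * x = 1 * x" using q_ge_3 by (simp add: fixed_field_def flip: power_Suc2)
  then show ?thesis using \<open>x \<noteq> 0\<close> by simp
qed

text \<open>For \<open>0 < j < q - 1\<close> some \<open>g\<close> has
  \<open>g^j \<noteq> 1\<close>, and multiplication by \<open>g\<close> permutes the field, so the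
  sum is zero. For \<open>j = 0\<close> the sum is \<open>q = 0\<close>, with
  \<open>0^0 = 1\<close>. Exponents above \<open>q - 1\<close> reduce by \<open>q - 1\<close>; the
  bound keeps them below the next multiple of \<open>q - 1\<close>.\<close>

lemma sum_powers_fixed_field:
  assumes "j < 2 * (q - 1)"
  shows "(\<Sum>x\<in>k. x ^ j) = (if j = q - 1 then - 1 else 0)"
proof -
  have small: "(\<Sum>x\<in>k. x ^ j) = 0" if j: "0 < j" "j < q - 1" for j
  proof -
    let ?p = "Polynomial.monom 1 j - 1 :: 'a poly"
    have deg: "degree ?p = j"
      using j by (subst diff_conv_add_uminus, subst degree_add_eq_left) (auto simp: degree_monom_eq)
    then have "?p \<noteq> 0" using j by auto
    then have "card {x. poly ?p x = 0} \<le> j" using card_poly_roots_bound deg by metis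
    moreover have "card (k - {0}) = q - 1"
      using card_fixed_field fixed_field_finite fixed_field_closed(1) by simp
    ultimately have "\<not> k - {0} \<subseteq> {x. poly ?p x = 0}"
      using j card_mono[of "{x. poly ?p x = 0}" "k - {0}"] poly_roots_finite[OF \<open>?p \<noteq> 0\<close>] by linarith
    then obtain g where g: "g \<in> k" "g \<noteq> 0" "g ^ j \<noteq> 1" by (auto simp: poly_monom)
    have "bij_betw (\<lambda>x. g * x) k k"
      using g by (intro bij_betw_byWitness[where f' = "\<lambda>x. x / g"]) (auto intro: fixed_field_closed)
    then have "(\<Sum>x\<in>k. x ^ j) = (\<Sum>x\<in>k. (g * x) ^ j)"
      by (rule sum.reindex_bij_betw[symmetric])
    also have "\<dots> = g ^ j * (\<Sum>x\<in>k. x ^ j)"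
      by (simp add: power_mult_distrib sum_distrib_left)
    finally have "(1 - g ^ j) * (\<Sum>x\<in>k. x ^ j) = 0" by (simp add: algebra_simps)
    then show ?thesis using g by simp
  qed
  consider "j = 0" | "0 < j" "j < q - 1" | "j = q - 1" | "j > q - 1" by linarith
  then show ?thesis
  proof cases
    case 1
    then show ?thesis using q_ge_3 by (simp add: card_fixed_field of_nat_q)
  next
    case 2
    then show ?thesis using small by simp
  next
    case 3
    have "(\<Sum>x\<in>k. x ^ j) = (\<Sum>x\<in>k - {0}. x ^ j)"
      using fixed_field_finite fixed_field_closed(1) q_ge_3 3 by (subst sum.remove[of _ 0]) auto
    also have "\<dots> = (\<Sum>x\<in>k - {0}. 1)"
      using fixed_field_power 3 by (intro sum.cong) auto
    also have "\<dots> = of_nat (q - 1)"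
      using card_fixed_field fixed_field_finite fixed_field_closed(1) by simp
    also have "\<dots> = - 1" using q_ge_3 of_nat_q by (simp add: of_nat_diff)
    finally show ?thesis using 3 by simp
  next
    case 4
    have "x ^ j = x ^ (j - (q - 1))" if "x \<in> k" for x
    proof (cases "x = 0")
      case False
      have "x ^ j = x ^ (j - (q - 1)) * x ^ (q - 1)" using 4 by (simp flip: power_add)
      then show ?thesis using fixed_field_power[OF that False] by simp
    qed (use 4 in \<open>simp add: power_0_left\<close>)
    then have "(\<Sum>x\<in>k. x ^ j) = (\<Sum>x\<in>k. x ^ (j - (q - 1)))" by (intro sum.cong) auto
    also have "\<dots> = 0" using 4 assms by (intro small) auto
    finally show ?thesis using 4 by simp
  qed
qed

lemma sum_poly_fixed_field:
  assumes "degree g < 2 * (q - 1)"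
  shows "(\<Sum>x\<in>k. poly g x) = - coeff g (q - 1)"
proof -
  have "(\<Sum>x\<in>k. poly g x) = (\<Sum>j<2 * (q - 1). coeff g j * (\<Sum>x\<in>k. x ^ j))"
  proof -
    have "poly g x = (\<Sum>j<2 * (q - 1). coeff g j * x ^ j)" for x
      unfolding poly_altdef using assms
      by (intro sum.mono_neutral_left) (auto simp: coeff_eq_0 not_le)
    then have "(\<Sum>x\<in>k. poly g x) = (\<Sum>x\<in>k. \<Sum>j<2 * (q - 1). coeff g j * x ^ j)" by simp
    also have "\<dots> = (\<Sum>j<2 * (q - 1). coeff g j * (\<Sum>x\<in>k. x ^ j))"
      by (subst sum.swap) (simp add: sum_distrib_left)
    finally show ?thesis .
  qed
  also have "\<dots> = (\<Sum>j<2 * (q - 1). if j = q - 1 then - coeff g j else 0)"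
    by (intro sum.cong) (auto simp: sum_powers_fixed_field)
  also have "\<dots> = - coeff g (q - 1)" using q_ge_3 by (simp add: sum.delta)
  finally show ?thesis .
qed

text \<open>Euler's criterion in the field with \<open>q\<close> elements: a square root
  \<open>y\<close> of \<open>c\<close> in the closure satisfies
  \<open>y^q = c^((q - 1) / 2) y\<close>, so it lies in the field exactly if that factor is
  1.\<close>

lemma card_square_roots:
  assumes "c \<in> k"
  shows "of_nat (card {y \<in> k. y\<^sup>2 = c}) = 1 + c ^ ((q - 1) div 2)"
proof (cases "c = 0")
  case True
  then have "{y \<in> k. y\<^sup>2 = c} = {0}" using fixed_field_closed(1) by auto
  then show ?thesis using True q_ge_3 by simp
next
  case False
  obtain y where y: "y\<^sup>2 = c" using nth_root_exists[of 2 c] by auto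
  then have "y \<noteq> 0" using False by auto
  have half: "2 * ((q - 1) div 2) = q - 1" using odd_q by simp
  have yq: "y ^ q = c ^ ((q - 1) div 2) * y"
  proof -
    have "c ^ ((q - 1) div 2) * y = y ^ Suc (q - 1)"
      unfolding y[symmetric] power_mult[symmetric] half by (simp add: mult.commute)
    then show ?thesis using q_ge_3 by simp
  qed
  have roots: "{z. z\<^sup>2 = c} = {y, - y}" unfolding y[symmetric] by (auto simp: power2_eq_iff)
  have ne: "y \<noteq> - y"
  proof
    assume "y = - y"
    then have "2 * y = 0" by (metis add.right_inverse mult_2)
    then show False using two_nonzero \<open>y \<noteq> 0\<close> by simp
  qed
  have "(c ^ ((q - 1) div 2))\<^sup>2 = 1"
    using fixed_field_power[OF assms False] half by (metis mult.commute power_mult)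
  then consider "c ^ ((q - 1) div 2) = 1" | "c ^ ((q - 1) div 2) = - 1" by (auto simp: power2_eq_1_iff)
  then show ?thesis
  proof cases
    case 1
    then have "y \<in> k" using yq by (simp add: fixed_field_def)
    then have "{z \<in> k. z\<^sup>2 = c} = {y, - y}" using roots fixed_field_closed(4) by auto
    then show ?thesis using 1 ne by simp
  next
    case 2
    then have "y \<notin> k" using yq ne by (simp add: fixed_field_def)
    then have "{z \<in> k. z\<^sup>2 = c} = {}" using roots fixed_field_closed(4) by force
    then show ?thesis unfolding 2 by (simp only: card.empty) simp
  qed
qed

definition points_over :: "'a \<Rightarrow> 'a \<Rightarrow> 'a ec_point set" where
  "points_over a b = insert Infinity {Point x y | x y. x \<in> k \<and> y \<in> k \<and> y\<^sup>2 = x ^ 3 + a * x + b}"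

lemma points_over_finite: "finite (points_over a b)"
proof -
  have "points_over a b \<subseteq> insert Infinity ((\<lambda>(x, y). Point x y) ` (k \<times> k))"
    by (auto simp: points_over_def)
  then show ?thesis using fixed_field_finite by (meson finite_SigmaI finite_imageI finite_insert finite_subset)
qed

text \<open>Euler's criterion turns the count into the sum of the values of
  \<open>f^((q - 1) / 2)\<close>. Its degree \<open>3 (q - 1) / 2\<close> is below
  \<open>2 (q - 1)\<close>, so only the coefficient at \<open>q - 1\<close> contributes. The summand
  1 is the point at infinity.\<close>

lemma card_points_over:
  assumes "a \<in> k" "b \<in> k"
  shows "of_nat (card (points_over a b)) = 1 - coeff ([:b, a, 0, 1:] ^ ((q - 1) div 2)) (q - 1)"
proof -
  let ?f = "[:b, a, 0, 1:]"
  have f: "x ^ 3 + a * x + b = poly ?f x" for x by (simp add: algebra_simps power3_eq_cube)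
  let ?S = "SIGMA x:k. {y \<in> k. y\<^sup>2 = poly ?f x}"
  have fin: "finite ?S" using fixed_field_finite by auto
  have "points_over a b = insert Infinity ((\<lambda>(x, y). Point x y) ` ?S)"
    unfolding points_over_def f by auto
  then have "card (points_over a b) = Suc (card ((\<lambda>(x, y). Point x y) ` ?S))"
    using fin by (auto simp: card_insert_if)
  also have "card ((\<lambda>(x, y). Point x y) ` ?S) = card ?S" by (rule card_image) (auto simp: inj_on_def)
  also have "card ?S = (\<Sum>x\<in>k. card {y \<in> k. y\<^sup>2 = poly ?f x})"
    using fixed_field_finite by (subst card_SigmaI) auto
  finally have "(of_nat (card (points_over a b)) :: 'a) = 1 + (\<Sum>x\<in>k. of_nat (card {y \<in> k. y\<^sup>2 = poly ?f x}))"
    by simp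
  also have "(\<Sum>x\<in>k. (of_nat (card {y \<in> k. y\<^sup>2 = poly ?f x}) :: 'a)) = (\<Sum>x\<in>k. 1 + poly (?f ^ ((q - 1) div 2)) x)"
    using assms by (intro sum.cong refl, subst card_square_roots)
      (simp_all only: poly_power f[symmetric] fixed_field_closed)
  also have "\<dots> = (\<Sum>x\<in>k. poly (?f ^ ((q - 1) div 2)) x)"
    by (simp add: sum.distrib card_fixed_field of_nat_q)
  also have "\<dots> = - coeff (?f ^ ((q - 1) div 2)) (q - 1)"
  proof (rule sum_poly_fixed_field)
    have "degree (?f ^ ((q - 1) div 2)) = 3 * ((q - 1) div 2)" by (subst degree_power_eq) auto
    then show "degree (?f ^ ((q - 1) div 2)) < 2 * (q - 1)" using odd_q q_ge_3 by auto
  qed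
  finally show ?thesis by simp
qed

end

section \<open>Supersingularity and the Hasse invariant\<close>

text \<open>Thus every element lies in a finite subfield. Injectivity of Frobenius turns a
  repetition in the orbit into a return to \<open>x\<close> itself.\<close>

lemma prime_field_closure_periodic:
  fixes x :: "'p::prime_card mod_ring alg_closure"
  shows "\<exists>n>0. x ^ (CHAR('p mod_ring alg_closure) ^ n) = x"
proof -
  let ?p = "CARD('p)"
  have char: "CHAR('p mod_ring alg_closure) = ?p" by simp
  have pr: "prime CHAR('p mod_ring alg_closure)" using prime_card[where 'a = 'p] by simp
  have coeff: "c ^ ?p = c" for c :: "'p mod_ring"
    using finite_field_power_card_eq_same[of c] by simp
  obtain g :: "'p mod_ring poly" where g: "g \<noteq> 0" "poly (map_poly to_ac g) x = 0"
    using alg_closure_algebraic[of x] by blast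
  let ?g = "map_poly to_ac g"
  have g0: "?g \<noteq> 0" using g by (simp add: map_poly_eq_0_iff)
  have frob: "poly ?g (y ^ ?p) = (poly ?g y) ^ ?p" for y
  proof -
    have "(poly ?g y) ^ ?p = (\<Sum>i\<le>degree ?g. (coeff ?g i * y ^ i) ^ ?p)"
      unfolding poly_altdef using freshmans_dream_sum[OF pr char[symmetric]] by blast
    also have "\<dots> = (\<Sum>i\<le>degree ?g. coeff ?g i * (y ^ ?p) ^ i)"
    proof (intro sum.cong refl)
      fix i
      have "coeff ?g i ^ ?p = coeff ?g i"
        using coeff[of "coeff g i"] by (simp add: coeff_map_poly flip: to_ac_power)
      then show "(coeff ?g i * y ^ i) ^ ?p = coeff ?g i * (y ^ ?p) ^ i"
        by (simp add: power_mult_distrib mult.commute flip: power_mult)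
    qed
    finally show ?thesis by (simp add: poly_altdef)
  qed
  \<comment> \<open>The Frobenius orbit of \<open>x\<close> consists of roots of \<open>g\<close>, hence it is finite.\<close>
  have root: "poly ?g (x ^ (?p ^ n)) = 0" for n
  proof (induction n)
    case (Suc n)
    then show ?case using frob[of "x ^ (?p ^ n)"] prime_card[where 'a = 'p]
      by (simp add: mult.commute prime_gt_0_nat flip: power_mult)
  qed (use g in simp)
  have "\<not> inj (\<lambda>n. x ^ (?p ^ n))"
  proof
    assume "inj (\<lambda>n. x ^ (?p ^ n))"
    moreover have "range (\<lambda>n. x ^ (?p ^ n)) \<subseteq> {y. poly ?g y = 0}" using root by auto
    ultimately show False
      using poly_roots_finite[OF g0] by (meson finite_imageD finite_subset infinite_UNIV_nat)
  qed
  then obtain i j where ij: "i < j" "x ^ (?p ^ i) = x ^ (?p ^ j)"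
    unfolding inj_def by (metis linorder_neqE_nat)
  have inj: "u = v" if "u ^ (?p ^ i) = v ^ (?p ^ i)" for u v :: "'p mod_ring alg_closure"
  proof -
    have "(u - v + v) ^ (?p ^ i) = (u - v) ^ (?p ^ i) + v ^ (?p ^ i)"
      using freshmans_dream'[OF pr, of "?p ^ i" i] char by metis
    then have "(u - v) ^ (?p ^ i) = 0" using that by simp
    then show ?thesis by simp
  qed
  have "(x ^ (?p ^ (j - i))) ^ (?p ^ i) = x ^ (?p ^ i)"
    using ij by (simp flip: power_mult power_add)
  then have "x ^ (?p ^ (j - i)) = x" by (rule inj)
  then show ?thesis using ij char by (intro exI[of _ "j - i"]) simp
qed

lemma coeff_power_char:
  fixes g :: "'a::field poly"
  assumes "prime CHAR('a)"
  shows "coeff (g ^ CHAR('a)) i = (if CHAR('a) dvd i then coeff g (i div CHAR('a)) ^ CHAR('a) else 0)"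
proof -
  let ?p = "CHAR('a)"
  have p: "?p > 0" using assms prime_gt_0_nat by blast
  have "g ^ ?p = (\<Sum>j\<le>degree g. Polynomial.monom (coeff g j) j) ^ ?p"
    by (simp add: poly_as_sum_of_monoms)
  also have "\<dots> = (\<Sum>j\<le>degree g. Polynomial.monom (coeff g j) j ^ ?p)"
    using assms by (intro freshmans_dream_sum) auto
  also have "\<dots> = (\<Sum>j\<le>degree g. Polynomial.monom (coeff g j ^ ?p) (j * ?p))"
    by (simp add: monom_power mult.commute)
  finally have eq: "coeff (g ^ ?p) i = (\<Sum>j\<le>degree g. if j * ?p = i then coeff g j ^ ?p else 0)"
    by (simp add: coeff_sum)
  show ?thesis
  proof (cases "?p dvd i")
    case True
    then obtain t where t: "i = t * ?p" by (metis dvd_def mult.commute)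
    have "coeff (g ^ ?p) i = (\<Sum>j\<le>degree g. if j = t then coeff g j ^ ?p else 0)"
      unfolding eq using p t by (intro sum.cong) auto
    also have "\<dots> = coeff g t ^ ?p"
      using p by (auto simp: coeff_eq_0)
    finally show ?thesis using t p by simp
  next
    case False
    then show ?thesis unfolding eq by (auto intro!: sum.neutral)
  qed
qed

text \<open>Only exponents divisible by the characteristic \<open>p\<close> occur in
  \<open>g^p\<close>. A contribution from \<open>t p\<close> with \<open>t \<le> q - 2\<close> would
  need a coefficient of \<open>h\<close> at an index of at least \<open>2 p - 1\<close>, beyond its
  degree. Only \<open>t = q - 1\<close> is left.\<close>

lemma coeff_power_char_mult:
  fixes g h :: "'a::field poly"
  assumes "prime CHAR('a)" "q > 0" "degree h < 2 * CHAR('a) - 1"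
  shows "coeff (g ^ CHAR('a) * h) (q * CHAR('a) - 1) = coeff g (q - 1) ^ CHAR('a) * coeff h (CHAR('a) - 1)"
proof -
  let ?p = "CHAR('a)"
  have p: "?p > 0" using assms prime_gt_0_nat by blast
  have qp: "q * ?p - 1 = (q - 1) * ?p + (?p - 1)" using assms p by (cases q) auto
  have zero: "coeff (g ^ ?p) i * coeff h (q * ?p - 1 - i) = 0"
    if i: "i \<le> q * ?p - 1" "i \<noteq> (q - 1) * ?p" for i
  proof (cases "?p dvd i")
    case True
    then obtain t where t: "i = t * ?p" by (metis dvd_def mult.commute)
    have "t * ?p < q * ?p" using i t p assms(2) by (metis Suc_pred' le_imp_less_Suc nat_0_less_mult_iff)
    then have "t < q" by simp
    moreover have "t \<noteq> q - 1" using i t by auto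
    ultimately have "t + 2 \<le> q" by linarith
    then have "(t + 2) * ?p \<le> q * ?p" by (rule mult_le_mono1)
    then have "q * ?p - 1 - i \<ge> 2 * ?p - 1" using t by (simp add: algebra_simps)
    then show ?thesis using assms(3) by (simp add: coeff_eq_0)
  qed (use coeff_power_char[OF assms(1)] in simp)
  have "coeff (g ^ ?p * h) (q * ?p - 1) = (\<Sum>i\<le>q * ?p - 1. coeff (g ^ ?p) i * coeff h (q * ?p - 1 - i))"
    by (rule coeff_mult)
  also have "\<dots> = (\<Sum>i\<in>{(q - 1) * ?p}. coeff (g ^ ?p) i * coeff h (q * ?p - 1 - i))"
  proof (rule sum.mono_neutral_right)
    show "{(q - 1) * ?p} \<subseteq> {..q * ?p - 1}" using qp by simp
    show "\<forall>i\<in>{..q * ?p - 1} - {(q - 1) * ?p}. coeff (g ^ ?p) i * coeff h (q * ?p - 1 - i) = 0"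
      using zero by blast
  qed simp
  also have "\<dots> = coeff g (q - 1) ^ ?p * coeff h (?p - 1)"
    using coeff_power_char[OF assms(1), of g "(q - 1) * ?p"] p qp by simp
  finally show ?thesis .
qed

text \<open>For a cubic \<open>f\<close> this is the Hasse invariant of the curve
  \<open>y^2 = f(x)\<close>.\<close>

definition hasse_coeff :: "'a::field poly \<Rightarrow> 'a" where
  "hasse_coeff f = coeff (f ^ ((CHAR('a) - 1) div 2)) (CHAR('a) - 1)"

text \<open>Since \<open>(p^(n+1) - 1) / 2 = p (p^n - 1) / 2 + (p - 1) / 2\<close>, each step
  replaces the coefficient by its \<open>p\<close>-th power times the Hasse invariant.\<close>

lemma coeff_power_hasse:
  fixes f :: "'a::field poly"
  assumes "prime CHAR('a)" "odd CHAR('a)" "degree f \<le> 3"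
  shows "coeff (f ^ ((CHAR('a) ^ n - 1) div 2)) (CHAR('a) ^ n - 1) = hasse_coeff f ^ (\<Sum>i<n. CHAR('a) ^ i)"
proof (induction n)
  case (Suc n)
  let ?p = "CHAR('a)"
  have p: "?p > 1" using assms prime_gt_1_nat by blast
  obtain m where m: "?p ^ n = 2 * m + 1" using assms(2) by (metis even_power oddE odd_pos)
  obtain r where r: "?p = 2 * r + 1" using assms(2) by (elim oddE)
  have e: "(?p ^ Suc n - 1) div 2 = ((?p ^ n - 1) div 2) * ?p + (?p - 1) div 2"
  proof -
    have "?p ^ Suc n - 1 = 2 * (m * ?p + r)" unfolding power_Suc m using r by (simp add: algebra_simps)
    then show ?thesis using m r by simp
  qed
  have deg: "degree (f ^ ((?p - 1) div 2)) < 2 * ?p - 1"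
  proof -
    have "degree (f ^ ((?p - 1) div 2)) \<le> degree f * ((?p - 1) div 2)" by (rule degree_power_le)
    also have "\<dots> \<le> 3 * ((?p - 1) div 2)" using assms(3) by (rule mult_le_mono1)
    also have "\<dots> < 2 * ?p - 1" using p by linarith
    finally show ?thesis .
  qed
  have "coeff (f ^ ((?p ^ Suc n - 1) div 2)) (?p ^ Suc n - 1) =
      coeff ((f ^ ((?p ^ n - 1) div 2)) ^ ?p * f ^ ((?p - 1) div 2)) (?p ^ n * ?p - 1)"
    unfolding e by (simp only: power_add power_mult power_Suc2)
  also have "\<dots> = (hasse_coeff f ^ (\<Sum>i<n. ?p ^ i)) ^ ?p * hasse_coeff f"
    using coeff_power_char_mult[OF assms(1) _ deg, where q = "?p ^ n" and g = "f ^ ((?p ^ n - 1) div 2)"] p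
    unfolding Suc.IH hasse_coeff_def[symmetric] by simp
  also have "\<dots> = hasse_coeff f ^ (\<Sum>i<Suc n. ?p ^ i)"
  proof -
    have "(\<Sum>i<Suc n. ?p ^ i) = (\<Sum>i<n. ?p ^ i) * ?p + 1"
      by (simp only: sum.lessThan_Suc_shift sum_distrib_right) (simp add: mult.commute)
    then show ?thesis by (simp add: power_mult power_add)
  qed
  finally show ?case .
qed (simp add: hasse_coeff_def)

lemma sum_lessThan_add: "(\<Sum>i<m + n. f i) = (\<Sum>i<m. f i) + (\<Sum>i<n. f (m + i))"
  for f :: "nat \<Rightarrow> 'a::comm_monoid_add"
  by (induction n) (simp_all add: add.assoc)

lemma power_char_periodic_mult:
  fixes x :: "'a::monoid_mult"
  assumes "x ^ (p ^ n) = x"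
  shows "x ^ (p ^ (n * m)) = x"
proof (induction m)
  case (Suc m)
  have "x ^ (p ^ (n * Suc m)) = (x ^ (p ^ n)) ^ (p ^ (n * m))"
    by (simp flip: power_mult power_add)
  then show ?case using assms Suc by simp
qed simp

text \<open>If \<open>p\<close> is the characteristic, the geometric exponent computes the norm from
  the field with \<open>p^n\<close> elements; an extension of degree \<open>m\<close> raises this
  norm to the power \<open>m\<close>.\<close>

lemma power_geometric_sum_periodic:
  fixes x :: "'a::field"
  assumes "x ^ (p ^ n) = x"
  shows "x ^ (\<Sum>i<n * m. p ^ i) = x ^ ((\<Sum>i<n. p ^ i) * m)"
proof (induction m)
  case (Suc m)
  have per: "x ^ (p ^ (n * m)) = x" using assms by (rule power_char_periodic_mult)
  have "(\<Sum>i<n * Suc m. p ^ i) = (\<Sum>i<n * m. p ^ i) + p ^ (n * m) * (\<Sum>i<n. p ^ i)"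
  proof -
    have "(\<Sum>i<n * m + n. p ^ i) = (\<Sum>i<n * m. p ^ i) + (\<Sum>i<n. p ^ (n * m + i))"
      by (rule sum_lessThan_add)
    then show ?thesis by (simp add: power_add sum_distrib_right ac_simps)
  qed
  then have "x ^ (\<Sum>i<n * Suc m. p ^ i) = x ^ (\<Sum>i<n * m. p ^ i) * (x ^ (p ^ (n * m))) ^ (\<Sum>i<n. p ^ i)"
    by (simp add: power_add power_mult)
  then show ?case using Suc per by (simp add: power_add)
qed simp

locale curve_over = char_power q ty for q and ty :: "'a::alg_closed_field itself" +
  fixes a b :: 'a
  assumes nonsingular': "ec_nonsingular a b" and ab: "a \<in> k" "b \<in> k"
begin

sublocale elliptic_curve a b
  by standard (rule nonsingular' two_nonzero)+

text \<open>The addition formulas are rational expressions in the coordinates and \<open>a\<close>,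
  with integer coefficients, so they preserve the subfield.\<close>

lemma points_over_subgroup: "subgroup (points_over a b) (ec_group a b)"
proof -
  interpret G: group "ec_group a b" by (rule ec_group_group)
  have carrier: "carrier (ec_group a b) = ec_points a b" by (simp add: ec_group_def)
  have sub: "points_over a b \<subseteq> ec_points a b" by (auto simp: points_over_def ec_points_def)
  have over: "P \<in> points_over a b \<longleftrightarrow>
    P \<in> ec_points a b \<and> (case P of Infinity \<Rightarrow> True | Point x y \<Rightarrow> x \<in> k \<and> y \<in> k)" for P
    by (cases P) (auto simp: points_over_def ec_points_def)
  show ?thesis
  proof (rule G.subgroupI)
    show "points_over a b \<subseteq> carrier (ec_group a b)" using sub carrier by simp
    show "points_over a b \<noteq> {}" by (auto simp: points_over_def)
  next
    fix P assume P: "P \<in> points_over a b"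
    have "inv\<^bsub>ec_group a b\<^esub> P = ec_neg P"
      using P sub ec_neg_closed[of P] by (intro G.inv_equality) (auto simp: ec_group_def ec_add_neg)
    then show "inv\<^bsub>ec_group a b\<^esub> P \<in> points_over a b"
      using P ec_neg_closed[of P] by (cases P) (auto simp: over fixed_field_closed)
  next
    fix P Q assume PQ: "P \<in> points_over a b" "Q \<in> points_over a b"
    then have "ec_add a P Q \<in> ec_points a b" using sub ec_add_closed by blast
    moreover have "case ec_add a P Q of Infinity \<Rightarrow> True | Point x y \<Rightarrow> x \<in> k \<and> y \<in> k"
      using PQ ab by (cases P; cases Q)
        (auto simp: over Let_def intro!: fixed_field_closed fixed_field_numeral)
    ultimately show "P \<otimes>\<^bsub>ec_group a b\<^esub> Q \<in> points_over a b"
      by (simp add: over ec_group_def)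
  qed
qed

text \<open>The group of points has order congruent to 1 modulo the characteristic, so by Lagrange
  the order of \<open>P\<close> divides two coprime numbers.\<close>

lemma no_torsion_over:
  assumes "coeff ([:b, a, 0, 1:] ^ ((q - 1) div 2)) (q - 1) = 0"
    and "P \<in> points_over a b" "P [^]\<^bsub>ec_group a b\<^esub> CHAR('a) = \<one>\<^bsub>ec_group a b\<^esub>"
  shows "P = \<one>\<^bsub>ec_group a b\<^esub>"
proof -
  interpret G: group "ec_group a b" by (rule ec_group_group)
  let ?H = "(ec_group a b)\<lparr>carrier := points_over a b\<rparr>"
  interpret H: group ?H using points_over_subgroup by (rule subgroup.subgroup_is_group) (rule G.is_group)
  have P: "P \<in> carrier ?H" using assms by simp
  have "P [^]\<^bsub>?H\<^esub> CHAR('a) = \<one>\<^bsub>?H\<^esub>" using assms(3) G.nat_pow_consistent[of P "CHAR('a)"] by simp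
  then have 1: "H.ord P dvd CHAR('a)" using H.pow_eq_id[OF P] by simp
  have "P [^]\<^bsub>?H\<^esub> Coset.order ?H = \<one>\<^bsub>?H\<^esub>" by (rule H.pow_order_eq_1[OF P])
  then have 2: "H.ord P dvd card (points_over a b)"
    using H.pow_eq_id[OF P] by (simp add: Coset.order_def)
  have "(of_nat (card (points_over a b)) :: 'a) \<noteq> 0"
    using card_points_over[OF ab] assms(1) by simp
  then have "\<not> CHAR('a) dvd card (points_over a b)" by (simp add: of_nat_eq_0_iff_char_dvd)
  then have "H.ord P = 1" using 1 2 prime_char by (auto simp: prime_nat_iff)
  then show ?thesis using H.ord_eq_1[OF P] by simp
qed

text \<open>Now the characteristic divides the order of the group. Sylow's theorem with exponent 1
  amounts to Cauchy's theorem: it yields a subgroup of order \<open>CHAR('a)\<close>.\<close>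

lemma torsion_over:
  assumes "coeff ([:b, a, 0, 1:] ^ ((q - 1) div 2)) (q - 1) = 1"
  shows "\<exists>P \<in> points_over a b. P [^]\<^bsub>ec_group a b\<^esub> CHAR('a) = \<one>\<^bsub>ec_group a b\<^esub> \<and> P \<noteq> \<one>\<^bsub>ec_group a b\<^esub>"
proof -
  interpret G: group "ec_group a b" by (rule ec_group_group)
  let ?H = "(ec_group a b)\<lparr>carrier := points_over a b\<rparr>"
  interpret H: group ?H using points_over_subgroup by (rule subgroup.subgroup_is_group) (rule G.is_group)
  have "(of_nat (card (points_over a b)) :: 'a) = 0"
    using card_points_over[OF ab] assms(1) by simp
  then obtain m where m: "Coset.order ?H = CHAR('a) ^ 1 * m"
    by (auto simp: of_nat_eq_0_iff_char_dvd Coset.order_def elim: dvdE)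
  then obtain K where K: "subgroup K ?H" "card K = CHAR('a)"
    using Sylow.sylow_thm[OF prime_char H.is_group m] points_over_finite by auto
  let ?K = "?H\<lparr>carrier := K\<rparr>"
  interpret K: group ?K using K(1) by (rule subgroup.subgroup_is_group) (rule H.is_group)
  have "\<one>\<^bsub>?H\<^esub> \<in> K" by (rule subgroup.one_closed[OF K(1)])
  moreover have "card K > 1" using K prime_char prime_gt_1_nat by auto
  ultimately obtain P where P: "P \<in> K" "P \<noteq> \<one>\<^bsub>?H\<^esub>"
    by (metis card_1_singleton_iff is_singletonI' is_singleton_altdef less_irrefl empty_iff)
  have "P [^]\<^bsub>?K\<^esub> Coset.order ?K = \<one>\<^bsub>?K\<^esub>" using P by (intro K.pow_order_eq_1) simp
  then have "P [^]\<^bsub>ec_group a b\<^esub> CHAR('a) = \<one>\<^bsub>ec_group a b\<^esub>"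
    using K(2) H.nat_pow_consistent[of P "CHAR('a)" K] G.nat_pow_consistent[of P "CHAR('a)" "points_over a b"]
    by (simp add: Coset.order_def)
  moreover have "P \<in> points_over a b" using subgroup.subset[OF K(1)] P by auto
  ultimately show ?thesis using P by auto
qed

end

text \<open>If the invariant \<open>A\<close> vanishes, any given point has coordinates in a finite
  field over which torsion is excluded. If not, a large enough finite field makes the coefficient
  equal to 1 and produces torsion.\<close>

theorem supersingular_iff_hasse_coeff:
  fixes a b :: "'a::alg_closed_field"
  assumes pr: "prime CHAR('a)" "odd CHAR('a)" and alg: "\<And>x::'a. \<exists>n>0. x ^ (CHAR('a) ^ n) = x"
    and ns: "ec_nonsingular a b"
  shows "ec_supersingular a b \<longleftrightarrow> hasse_coeff [:b, a, 0, 1:] = 0"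
proof -
  let ?p = "CHAR('a)" and ?f = "[:b, a, 0, 1:]"
  define A where "A = hasse_coeff ?f"
  have common: "\<exists>n>0. \<forall>x\<in>S. x ^ (?p ^ n) = x" if "finite S" for S :: "'a set"
    using that
  proof (induction S)
    case (insert y S)
    then obtain n m where n: "n > 0" "\<forall>x\<in>S. x ^ (?p ^ n) = x" and m: "m > 0" "y ^ (?p ^ m) = y"
      using alg by metis
    have "\<forall>x\<in>S. x ^ (?p ^ (n * m)) = x" using n(2) power_char_periodic_mult by blast
    moreover have "y ^ (?p ^ (n * m)) = y"
      using power_char_periodic_mult[OF m(2), of n] by (simp add: mult.commute)
    ultimately show ?case using n m by (intro exI[of _ "n * m"]) auto
  qed auto
  have curve: "curve_over (?p ^ n) a b" if "n > 0" "a ^ (?p ^ n) = a" "b ^ (?p ^ n) = b" for n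
    using that pr ns by unfold_locales (auto simp: fixed_field_def)
  have coeff: "coeff (?f ^ ((?p ^ n - 1) div 2)) (?p ^ n - 1) = A ^ (\<Sum>i<n. ?p ^ i)" for n
    unfolding A_def using pr by (intro coeff_power_hasse) auto
  show ?thesis unfolding A_def[symmetric]
  proof
    assume A: "A = 0"
    show "ec_supersingular a b"
      unfolding ec_supersingular_def
    proof (intro ballI impI)
      fix P assume P: "P \<in> carrier (ec_group a b)" "P [^]\<^bsub>ec_group a b\<^esub> ?p = \<one>\<^bsub>ec_group a b\<^esub>"
      show "P = \<one>\<^bsub>ec_group a b\<^esub>"
      proof (cases P)
        case Infinity
        then show ?thesis by (simp add: ec_group_def)
      next
        case (Point x y)
        obtain n where n: "n > 0" "\<forall>z\<in>{a, b, x, y}. z ^ (?p ^ n) = z" using common[of "{a, b, x, y}"] by auto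
        then interpret curve_over "?p ^ n" "TYPE('a)" a b by (intro curve) auto
        have over: "P \<in> points_over a b"
          using P n by (auto simp: Point points_over_def fixed_field_def ec_group_def ec_points_def)
        have "(\<Sum>i<n. ?p ^ i) > 0" using n prime_gt_0_nat[OF pr(1)] by (intro sum_pos) auto
        then have "coeff (?f ^ ((?p ^ n - 1) div 2)) (?p ^ n - 1) = 0"
          unfolding coeff A by (rule zero_power)
        then show ?thesis using over P(2) by (rule no_torsion_over)
      qed
    qed
  next
    assume ss: "ec_supersingular a b"
    show "A = 0"
    proof (rule ccontr)
      assume A: "A \<noteq> 0"
      obtain n where n: "n > 0" "\<forall>z\<in>{a, b, A}. z ^ (?p ^ n) = z" using common[of "{a, b, A}"] by auto
      \<comment> \<open>This is the order of the multiplicative group of a finite field containing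
        \<open>a\<close>, \<open>b\<close> and \<open>A\<close>. Over its extension of degree
        \<open>m\<close> the coefficient becomes an \<open>m\<close>-th power of a power of
        \<open>A\<close>, that is 1.\<close>
      define m where "m = ?p ^ n - 1"
      have pn: "?p ^ n > 1" using n(1) prime_gt_1_nat[OF pr(1)] by (intro one_less_power)
      have "Suc m = ?p ^ n" using pn by (simp add: m_def)
      then have "A ^ Suc m = A" using n by (simp del: power_Suc)
      then have Am: "A ^ m = 1" using A by simp
      have "A ^ (\<Sum>i<n * m. ?p ^ i) = A ^ ((\<Sum>i<n. ?p ^ i) * m)"
        using n by (intro power_geometric_sum_periodic) auto
      also have "\<dots> = (A ^ m) ^ (\<Sum>i<n. ?p ^ i)" by (simp add: mult.commute power_mult)
      finally have 1: "A ^ (\<Sum>i<n * m. ?p ^ i) = 1" using Am by simp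
      have nm: "n * m > 0" "a ^ (?p ^ (n * m)) = a" "b ^ (?p ^ (n * m)) = b"
        using n pn power_char_periodic_mult by (auto simp: m_def)
      interpret curve_over "?p ^ (n * m)" "TYPE('a)" a b using nm by (rule curve)
      have "points_over a b \<subseteq> carrier (ec_group a b)" using points_over_subgroup by (rule subgroup.subset)
      moreover obtain P where "P \<in> points_over a b" "P [^]\<^bsub>ec_group a b\<^esub> ?p = \<one>\<^bsub>ec_group a b\<^esub>"
          "P \<noteq> \<one>\<^bsub>ec_group a b\<^esub>"
        using torsion_over[unfolded coeff, OF 1] by blast
      ultimately show False using ss unfolding ec_supersingular_def by blast
    qed
  qed
qed

section \<open>The hypergeometric equation in positive characteristic\<close>

text \<open>The hypergeometric equation of \<open>2F1(u, v; 1; z)\<close> with \<open>u + v = 1\<close> and \<open>u v = s\<close>.\<close>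

definition hypergeom_ode :: "'a::field \<Rightarrow> 'a poly \<Rightarrow> 'a poly" where
  "hypergeom_ode s G = [:0, 1, - 1:] * pderiv (pderiv G) + [:1, - 2:] * pderiv G - smult s G"

lemma of_nat_nonzero_below_char:
  assumes "0 < n" "n < CHAR('a)"
  shows "(of_nat n :: 'a::semiring_1) \<noteq> 0"
  using assms by (auto simp: of_nat_eq_0_iff_char_dvd dest: dvd_imp_le)

text \<open>The hypergeometric operator with the origin moved to \<open>z\<close>. For
  \<open>z = 0\<close> this is the two-term recurrence of the series; for other \<open>z\<close> it
  governs the Taylor coefficients at \<open>z\<close>.\<close>

lemma coeff_ode_shifted:
  fixes H :: "'a::field poly"
  shows "coeff ([:z * (1 - z), 1 - 2 * z, - 1:] * pderiv (pderiv H) + [:1 - 2 * z, - 2:] * pderiv H - smult s H) k =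
    z * (1 - z) * of_nat (k + 1) * of_nat (k + 2) * coeff H (k + 2) +
    (1 - 2 * z) * (of_nat (k + 1))\<^sup>2 * coeff H (k + 1) - ((of_nat k)\<^sup>2 + of_nat k + s) * coeff H k"
proof (cases k)
  case 0
  then show ?thesis
    by (simp add: coeff_pderiv mult_pCons_left algebra_simps numeral_2_eq_2)
next
  case (Suc j)
  show ?thesis
  proof (cases j)
    case 0
    then show ?thesis unfolding Suc
      by (simp add: coeff_pderiv mult_pCons_left algebra_simps numeral_2_eq_2 power2_eq_square)
  next
    case (Suc i)
    then show ?thesis unfolding \<open>k = Suc j\<close>
      by (simp add: coeff_pderiv mult_pCons_left algebra_simps numeral_2_eq_2 power2_eq_square)
  qed
qed

lemma hypergeom_ode_coeff:
  "coeff (hypergeom_ode s G) k = (of_nat (k + 1))\<^sup>2 * coeff G (k + 1) - ((of_nat k)\<^sup>2 + of_nat k + s) * coeff G k"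
  using coeff_ode_shifted[of 0 G s k] by (simp add: hypergeom_ode_def)

text \<open>Under \<open>z \<mapsto> 1 - z\<close> the factor \<open>z (1 - z)\<close> is unchanged,
  while \<open>1 - 2 z\<close> and each derivative change sign.\<close>

lemma hypergeom_ode_reflect:
  fixes G :: "'a::field poly"
  shows
  "hypergeom_ode s (G \<circ>\<^sub>p [:1, - 1:]) = hypergeom_ode s G \<circ>\<^sub>p [:1, - 1:]"
proof -
  let ?q = "[:1, - 1:] :: 'a poly"
  have 1: "pderiv (H \<circ>\<^sub>p ?q) = - (pderiv H \<circ>\<^sub>p ?q)" for H
    by (simp add: pderiv_pcompose pderiv_pCons)
  have 2: "[:0, 1, - 1:] \<circ>\<^sub>p ?q = [:0, 1, - 1:]" "[:1, - 2:] \<circ>\<^sub>p ?q = - [:1, - 2:]"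
    by (simp_all add: pcompose_pCons)
  show ?thesis
    unfolding hypergeom_ode_def pcompose_diff pcompose_add pcompose_mult pcompose_smult 2 1 pderiv_minus
    by (simp only: mult_minus_left mult_minus_right minus_minus)
qed

lemma hypergeom_ode_shift:
  "[:z * (1 - z), 1 - 2 * z, - 1:] * pderiv (pderiv (G \<circ>\<^sub>p [:z, 1:])) + [:1 - 2 * z, - 2:] * pderiv (G \<circ>\<^sub>p [:z, 1:])
     - smult s (G \<circ>\<^sub>p [:z, 1:]) = hypergeom_ode s G \<circ>\<^sub>p [:z, 1:]"
proof -
  let ?q = "[:z, 1:]"
  have 1: "pderiv (H \<circ>\<^sub>p ?q) = pderiv H \<circ>\<^sub>p ?q" for H
    by (simp add: pderiv_pcompose pderiv_pCons)
  have 2: "[:0, 1, - 1:] \<circ>\<^sub>p ?q = [:z * (1 - z), 1 - 2 * z, - 1:]" "[:1, - 2:] \<circ>\<^sub>p ?q = [:1 - 2 * z, - 2:]"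
    by (simp_all add: pcompose_pCons algebra_simps)
  show ?thesis
    unfolding hypergeom_ode_def pcompose_diff pcompose_add pcompose_mult pcompose_smult 2 1 ..
qed

text \<open>The recurrence determines all coefficients from the constant one, as long as the factor
  \<open>(k + 1)^2\<close> is invertible; this holds below the characteristic.\<close>

lemma hypergeom_ode_unique:
  fixes G H :: "'a::field poly"
  assumes "hypergeom_ode s G = 0" "hypergeom_ode s H = 0" "degree G < CHAR('a)" "degree H < CHAR('a)"
    "coeff G 0 = c * coeff H 0"
  shows "G = smult c H"
proof (rule poly_eqI)
  fix k
  have "k < CHAR('a) \<Longrightarrow> coeff G k = c * coeff H k"
  proof (induction k)
    case (Suc k)
    have nz: "(of_nat (Suc k) :: 'a) \<noteq> 0" by (rule of_nat_nonzero_below_char) (use Suc in auto)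
    have "(of_nat (Suc k))\<^sup>2 * coeff G (Suc k) = ((of_nat k)\<^sup>2 + of_nat k + s) * coeff G k"
      and "(of_nat (Suc k))\<^sup>2 * coeff H (Suc k) = ((of_nat k)\<^sup>2 + of_nat k + s) * coeff H k"
      using hypergeom_ode_coeff[of s G k] hypergeom_ode_coeff[of s H k] assms(1,2) by simp_all
    then have "(of_nat (Suc k))\<^sup>2 * coeff G (Suc k) = (of_nat (Suc k))\<^sup>2 * (c * coeff H (Suc k))"
      using Suc by (simp del: of_nat_Suc add: mult.left_commute)
    then show ?case using nz by (simp del: of_nat_Suc)
  qed (use assms in simp)
  moreover have "coeff G k = c * coeff H k" if "\<not> k < CHAR('a)" using that assms by (simp add: coeff_eq_0)
  ultimately show "coeff G k = coeff (smult c H) k" by auto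
qed

lemma hypergeom_ode_simple_roots:
  fixes G :: "'a::field poly"
  assumes ode: "hypergeom_ode s G = 0" and "degree G < CHAR('a)" "G \<noteq> 0" "z \<noteq> 0" "z \<noteq> 1"
    and "poly G z = 0"
  shows "poly (pderiv G) z \<noteq> 0"
proof
  assume d: "poly (pderiv G) z = 0"
  \<comment> \<open>The recurrence for the Taylor coefficients at \<open>z\<close> has leading factor \<open>z (1 - z) (k + 1) (k + 2)\<close>.\<close>
  define H where "H = G \<circ>\<^sub>p [:z, 1:]"
  have deg: "degree H < CHAR('a)" using assms(2) by (simp add: H_def degree_pcompose)
  have "coeff H k = 0 \<and> coeff H (Suc k) = 0" if "Suc k < CHAR('a)" for k
    using that
  proof (induction k)
    case 0
    have "coeff H 0 = poly G z" by (simp add: H_def coeff_pcompose_0)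
    moreover have "coeff H 1 = poly (pderiv H) 0" by (simp add: poly_0_coeff_0 coeff_pderiv)
    moreover have "poly (pderiv H) 0 = 0" using d by (simp add: H_def pderiv_pcompose poly_pcompose pderiv_pCons)
    ultimately show ?case using assms by simp
  next
    case (Suc k)
    have "z * (1 - z) * of_nat (k + 1) * of_nat (k + 2) * coeff H (k + 2) = 0"
      using coeff_ode_shifted[of z H s k, unfolded H_def hypergeom_ode_shift ode, folded H_def] Suc by simp
    moreover have "(of_nat (k + 1) :: 'a) \<noteq> 0" "(of_nat (k + 2) :: 'a) \<noteq> 0"
      by (rule of_nat_nonzero_below_char; use Suc in simp)+
    ultimately show ?case using assms Suc by (simp del: of_nat_Suc of_nat_add)
  qed
  note vanish = this
  have "coeff H k = 0" for k
  proof -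
    consider "k \<ge> CHAR('a)" | "Suc k < CHAR('a)" | "Suc k = CHAR('a)" by linarith
    then show ?thesis
    proof cases
      \<comment> \<open>The last index \<open>CHAR('a) - 1\<close> is reached only as the second
        component of the pair for its predecessor.\<close>
      case 3
      then obtain j where "k = Suc j" using CHAR_not_1[where 'a = 'a] by (cases k) auto
      then show ?thesis using vanish[of j] 3 by simp
    qed (use vanish deg in \<open>auto simp: coeff_eq_0\<close>)
  qed
  then have "H = 0" by (simp add: poly_eq_iff)
  then show False using assms(3) by (simp add: H_def pcompose_eq_0_iff)
qed

text \<open>By \<open>top\<close> the recurrence breaks off after the index \<open>M\<close>, so the
  truncated series solves the equation exactly; \<open>tM\<close> fixes its degree.\<close>

locale truncated_hypergeom =
  fixes t :: "nat \<Rightarrow> 'a::alg_closed_field" and s :: 'a and M :: nat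
  assumes rec: "\<And>k. k < M \<Longrightarrow> (of_nat (k + 1))\<^sup>2 * t (k + 1) = ((of_nat k)\<^sup>2 + of_nat k + s) * t k"
    and top: "(of_nat M)\<^sup>2 + of_nat M + s = 0" and t0: "t 0 = 1" and tM: "t M \<noteq> 0" and M: "M < CHAR('a)"
begin

definition hyp :: "'a poly" where "hyp = (\<Sum>k\<le>M. Polynomial.monom (t k) k)"

lemma coeff_hyp: "coeff hyp k = (if k \<le> M then t k else 0)"
  by (simp add: hyp_def coeff_sum)

lemma degree_hyp: "degree hyp = M"
  using tM by (intro antisym degree_le le_degree) (auto simp: coeff_hyp)

lemma hyp_0: "poly hyp 0 = 1"
  by (simp add: poly_0_coeff_0 coeff_hyp t0)

lemma hyp_nonzero: "hyp \<noteq> 0"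
  using hyp_0 by auto

lemma hyp_ode: "hypergeom_ode s hyp = 0"
proof (rule poly_eqI)
  fix k
  consider "k < M" | "k = M" | "k > M" by linarith
  then show "coeff (hypergeom_ode s hyp) k = coeff 0 k"
    by cases (use rec[of k] top in \<open>simp_all add: hypergeom_ode_coeff coeff_hyp\<close>)
qed

text \<open>The reflected polynomial solves the same equation, so it is a multiple of
  \<open>hyp\<close>, and comparing values at 0 gives the factor. At \<open>z = 1\<close> the
  relation says that \<open>poly hyp 1\<close> has square 1.\<close>

lemma hyp_reflect: "poly hyp (1 - z) = poly hyp 1 * poly hyp z" and hyp_1: "poly hyp 1 \<noteq> 0"
proof -
  have "hyp \<circ>\<^sub>p [:1, - 1:] = smult (poly hyp 1) hyp"
    using hyp_0 M by (intro hypergeom_ode_unique[where s = s])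
      (auto simp: hypergeom_ode_reflect hyp_ode degree_pcompose degree_hyp coeff_pcompose_0 poly_0_coeff_0)
  then have eq: "poly (hyp \<circ>\<^sub>p [:1, - 1:]) z = poly hyp 1 * poly hyp z" for z by simp
  then show "poly hyp (1 - z) = poly hyp 1 * poly hyp z" by (simp add: poly_pcompose)
  show "poly hyp 1 \<noteq> 0" using eq[of 1] hyp_0 by (auto simp: poly_pcompose)
qed

lemma hyp_simple_roots:
  assumes "poly hyp z = 0"
  shows "z \<noteq> 0" "z \<noteq> 1" "poly (pderiv hyp) z \<noteq> 0"
proof -
  show *: "z \<noteq> 0" "z \<noteq> 1" using assms hyp_0 hyp_1 by auto
  show "poly (pderiv hyp) z \<noteq> 0"
    by (rule hypergeom_ode_simple_roots[OF hyp_ode]) (use * assms M hyp_nonzero degree_hyp in auto)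
qed

text \<open>The homogenization of \<open>hyp\<close> in degree \<open>M\<close>, which also makes
  sense for \<open>u = 0\<close>.\<close>

definition hform :: "'a \<Rightarrow> 'a \<Rightarrow> 'a" where
  "hform u v = (\<Sum>k\<le>M. t k * u ^ (M - k) * v ^ k)"

lemma hform_eq: "u \<noteq> 0 \<Longrightarrow> hform u v = u ^ M * poly hyp (v / u)"
  unfolding hform_def hyp_def
  by (simp add: poly_sum poly_monom sum_distrib_left) (intro sum.cong refl, simp add: power_divide power_diff field_simps)

text \<open>For \<open>y \<noteq> 0\<close> this is the reflection between \<open>1 - c / y\<close>
  and \<open>c / y\<close>. At \<open>y = 0\<close> only the top term survives, and it is nonzero on
  both sides.\<close>

lemma hform_reflect:
  assumes "c \<noteq> 0"
  shows "hform y (y - c) = 0 \<longleftrightarrow> hform y c = 0"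
proof (cases "y = 0")
  case True
  have *: "hform 0 v = t M * v ^ M" for v
  proof -
    have "hform 0 v = (\<Sum>k\<in>{M}. t k * 0 ^ (M - k) * v ^ k)"
      unfolding hform_def by (intro sum.mono_neutral_right) auto
    then show ?thesis by simp
  qed
  show ?thesis using assms tM by (simp add: True *)
next
  case False
  have "(y - c) / y = 1 - c / y" using False by (simp add: diff_divide_distrib)
  then show ?thesis using False hyp_reflect[of "c / y"] hyp_1 by (simp add: hform_eq)
qed

text \<open>The reversed polynomial \<open>y^M hyp(c / y)\<close>, the shape in which the expansions
  of the theorem will appear.\<close>

definition rev_poly :: "'a \<Rightarrow> 'a poly" where
  "rev_poly c = (\<Sum>k\<le>M. Polynomial.monom (t k * c ^ k) (M - k))"

lemma poly_rev_poly: "poly (rev_poly c) y = hform y c"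
  by (simp add: rev_poly_def hform_def poly_sum poly_monom algebra_simps)

text \<open>The product and chain rules for \<open>y^M hyp(c / y)\<close>, multiplied by
  \<open>y\<close> so that termwise \<open>y\<close> times the derivative of \<open>y^n\<close> is
  \<open>n y^n\<close>.\<close>

lemma poly_pderiv_rev_poly:
  assumes "y \<noteq> 0"
  shows "y * poly (pderiv (rev_poly c)) y = of_nat M * hform y c - y ^ M * (c / y) * poly (pderiv hyp) (c / y)"
proof -
  have p: "x * poly (pderiv (Polynomial.monom d n)) x = of_nat n * d * x ^ n" for x d :: 'a and n
    by (cases n) (simp_all add: pderiv_monom poly_monom algebra_simps)
  have 1: "y * poly (pderiv (rev_poly c)) y = (\<Sum>k\<le>M. of_nat (M - k) * (t k * c ^ k) * y ^ (M - k))"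
    unfolding rev_poly_def by (simp add: pderiv_sum poly_sum sum_distrib_left p)
  have 2: "c / y * poly (pderiv hyp) (c / y) = (\<Sum>k\<le>M. of_nat k * t k * (c / y) ^ k)"
    unfolding hyp_def by (simp only: pderiv_sum poly_sum sum_distrib_left p)
  have 3: "y ^ M * (c / y) * poly (pderiv hyp) (c / y) = (\<Sum>k\<le>M. of_nat k * (t k * c ^ k) * y ^ (M - k))"
    unfolding mult.assoc 2 sum_distrib_left using assms
    by (intro sum.cong refl) (simp add: power_divide power_diff field_simps)
  show ?thesis
    unfolding 1 3 hform_def sum_distrib_left sum_subtractf[symmetric]
    by (intro sum.cong refl) (simp add: of_nat_diff algebra_simps)
qed

lemma rev_poly_simple_roots:
  assumes "c \<noteq> 0" "poly (rev_poly c) y = 0"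
  shows "y \<noteq> 0" "y \<noteq> c" "poly (pderiv (rev_poly c)) y \<noteq> 0"
proof -
  have "poly (rev_poly c) 0 \<noteq> 0"
  proof -
    have "hform 0 c = (\<Sum>k\<in>{M}. t k * 0 ^ (M - k) * c ^ k)"
      unfolding hform_def by (intro sum.mono_neutral_right) auto
    then show ?thesis using tM assms by (simp add: poly_rev_poly)
  qed
  then show y: "y \<noteq> 0" using assms by auto
  have z: "poly hyp (c / y) = 0" using assms y by (simp add: poly_rev_poly hform_eq)
  then show "y \<noteq> c" using hyp_simple_roots(2) y by force
  have "y * poly (pderiv (rev_poly c)) y = - (y ^ M * (c / y) * poly (pderiv hyp) (c / y))"
    using poly_pderiv_rev_poly[OF y, of c] assms by (simp add: poly_rev_poly)
  moreover have "\<dots> \<noteq> 0" using y assms(1) hyp_simple_roots(3)[OF z] by simp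
  ultimately show "poly (pderiv (rev_poly c)) y \<noteq> 0" by auto
qed

lemma rev_poly_monic: "degree (rev_poly c) = M" "lead_coeff (rev_poly c) = 1"
proof -
  have c: "coeff (rev_poly c) j = (if j \<le> M then t (M - j) * c ^ (M - j) else 0)" for j
  proof -
    have "coeff (rev_poly c) j = (\<Sum>k\<le>M. if k = M - j \<and> j \<le> M then t k * c ^ k else 0)"
      unfolding rev_poly_def by (simp add: coeff_sum) (intro sum.cong refl, auto)
    then show ?thesis by auto
  qed
  show d: "degree (rev_poly c) = M"
    by (intro antisym degree_le le_degree) (auto simp: c t0)
  show "lead_coeff (rev_poly c) = 1" unfolding d by (simp add: c t0)
qed

text \<open>\<open>e\<close> allows for an extra root at 0, coming from an elementary factor of the
  Hasse invariant. It is simple because \<open>rev_poly c\<close> does not vanish at 0. The other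
  roots are simple and different from \<open>c\<close>, and the reflection identifies them with the
  zeros of \<open>hform y (y - c)\<close>.\<close>

lemma rev_poly_factorization:
  assumes "c \<noteq> 0" "e \<le> 1"
    and S: "\<And>y. y \<in> S \<longleftrightarrow> y \<noteq> c \<and> (e = 1 \<and> y = 0 \<or> hform y (y - c) = 0)"
  shows "(\<Prod>y\<in>S. [:- y, 1:]) = Polynomial.monom 1 e * rev_poly c"
proof -
  define T where "T = Polynomial.monom 1 e * rev_poly c"
  have lc: "lead_coeff T = 1" unfolding T_def lead_coeff_mult rev_poly_monic(2) by (simp add: degree_monom_eq)
  then have "T \<noteq> 0" by auto
  have roots: "S = {y. poly T y = 0}"
    using S rev_poly_simple_roots(2)[OF assms(1)] assms(1,2)
    by (auto simp: T_def poly_monom hform_reflect[OF assms(1)] poly_rev_poly)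
  have "poly (pderiv T) y \<noteq> 0" if "poly T y = 0" for y
  proof (cases "e = 0")
    case True
    then show ?thesis using that rev_poly_simple_roots(3)[OF assms(1)] by (simp add: T_def)
  next
    case False
    then have e: "e = 1" using assms(2) by simp
    have T': "poly (pderiv T) y = poly (rev_poly c) y + y * poly (pderiv (rev_poly c)) y"
      by (simp add: T_def e pderiv_mult pderiv_monom poly_monom algebra_simps monom_Suc pderiv_pCons)
    show ?thesis
    proof (cases "y = 0")
      case True
      then show ?thesis using rev_poly_simple_roots(1)[OF assms(1), of 0] by (auto simp: T'[unfolded True])
    next
      case False
      then have "poly (rev_poly c) y = 0" using that by (simp add: T_def poly_monom)
      then show ?thesis using rev_poly_simple_roots(3)[OF assms(1)] False by (simp add: T')
    qed
  qed
  then have "T = smult (lead_coeff T) (\<Prod>x | poly T x = 0. [:- x, 1:])"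
    using \<open>T \<noteq> 0\<close> by (rule_tac alg_closed_simple_roots(1))
  then show ?thesis unfolding roots lc T_def[symmetric] by simp
qed

end

section \<open>The Hasse invariant as a function of the \<open>j\<close>-invariant\<close>

lemma pcompose_power: "(f ^ n) \<circ>\<^sub>p g = (f \<circ>\<^sub>p g) ^ n"
  for f g :: "'a::comm_ring_1 poly"
  by (induction n) (simp_all add: pcompose_1 pcompose_mult)

lemma pcompose_as_sum: "f \<circ>\<^sub>p g = (\<Sum>k\<le>degree f. smult (coeff f k) (g ^ k))"
  for f g :: "'a::comm_ring_1 poly"
proof -
  have "f \<circ>\<^sub>p g = (\<Sum>k\<le>degree f. Polynomial.monom (coeff f k) k) \<circ>\<^sub>p g"
    by (simp add: poly_as_sum_of_monoms)
  then show ?thesis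
    by (simp add: pcompose_sum monom_altdef pcompose_smult pcompose_power pcompose_pCons)
qed

text \<open>The prime divides the factorial of \<open>n\<close> but neither factorial in the
  denominator.\<close>

lemma prime_dvd_choose:
  assumes "prime (p::nat)" "p \<le> n" "k < p" "n - k < p" "k \<le> n"
  shows "p dvd n choose k"
proof -
  have "p dvd fact k * fact (n - k) * (n choose k)"
    using assms by (simp add: binomial_fact_lemma prime_dvd_fact_iff)
  then show ?thesis
    using assms by (auto simp: prime_dvd_mult_iff prime_dvd_fact_iff)
qed

text \<open>The substitution carries a coefficient at \<open>k\<close> to \<open>p - 1\<close> with
  the factor \<open>k choose (p - 1)\<close>. For \<open>p \<le> k < 2 p - 1\<close> this is
  divisible by \<open>p\<close>, and the degree bound excludes larger \<open>k\<close>.\<close>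

lemma hasse_coeff_translate:
  fixes f :: "'a::field poly"
  assumes pr: "prime CHAR('a)" and "degree f \<le> 3"
  shows "hasse_coeff (f \<circ>\<^sub>p [:c, 1:]) = hasse_coeff f"
proof -
  let ?p = "CHAR('a)"
  define g where "g = f ^ ((?p - 1) div 2)"
  have p: "?p > 1" using pr prime_gt_1_nat by blast
  have "degree g \<le> degree f * ((?p - 1) div 2)" unfolding g_def by (rule degree_power_le)
  also have "\<dots> \<le> 3 * ((?p - 1) div 2)" using assms(2) by (rule mult_le_mono1)
  finally have deg: "degree g < 2 * ?p - 1" using p by linarith
  have "hasse_coeff (f \<circ>\<^sub>p [:c, 1:]) = coeff (g \<circ>\<^sub>p [:c, 1:]) (?p - 1)"
    by (simp add: hasse_coeff_def g_def pcompose_power)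
  also have "\<dots> = (\<Sum>k\<le>degree g. coeff g k * coeff ([:c, 1:] ^ k) (?p - 1))"
    by (simp add: pcompose_as_sum coeff_sum)
  also have "\<dots> = (\<Sum>k\<le>degree g. if k = ?p - 1 then coeff g k else 0)"
  proof (intro sum.cong refl)
    fix k assume k: "k \<in> {..degree g}"
    consider "k < ?p - 1" | "k = ?p - 1" | "k \<ge> ?p" by linarith
    then show "coeff g k * coeff ([:c, 1:] ^ k) (?p - 1) = (if k = ?p - 1 then coeff g k else 0)"
    proof cases
      case 1
      have "degree ([:c, 1:] ^ k) < ?p - 1" using 1 by (simp add: degree_linear_power)
      then show ?thesis using 1 by (simp add: coeff_eq_0)
    next
      case 2
      then show ?thesis by (simp add: coeff_linear_power)
    next
      case 3
      then have "?p dvd k choose (?p - 1)" using pr p k deg by (intro prime_dvd_choose) auto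
      then have "(of_nat (k choose (?p - 1)) :: 'a) = 0" by (simp add: of_nat_eq_0_iff_char_dvd)
      then have "coeff ([:c, 1:] ^ k) (?p - 1) = 0" using 3 by (subst coeff_linear_poly_power) auto
      then show ?thesis using 3 p by simp
    qed
  qed
  also have "\<dots> = hasse_coeff f"
    by (auto simp: hasse_coeff_def g_def coeff_eq_0)
  finally show ?thesis .
qed

text \<open>Substituting \<open>u^2 X\<close> turns the twisted cubic into \<open>u^6\<close> times
  the original one.\<close>

lemma hasse_coeff_scale:
  fixes a b u :: "'a::field"
  assumes "u \<noteq> 0"
  shows "hasse_coeff [:u ^ 6 * b, u ^ 4 * a, 0, 1:] = 0 \<longleftrightarrow> hasse_coeff [:b, a, 0, 1:] = 0"
proof -
  let ?r = "(CHAR('a) - 1) div 2" and ?f = "[:u ^ 6 * b, u ^ 4 * a, 0, 1:]"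
  have "?f \<circ>\<^sub>p [:0, u\<^sup>2:] = smult (u ^ 6) [:b, a, 0, 1:]"
    by (simp add: pcompose_pCons power2_eq_square eval_nat_numeral algebra_simps)
  then have "(?f ^ ?r) \<circ>\<^sub>p [:0, u\<^sup>2:] = smult ((u ^ 6) ^ ?r) ([:b, a, 0, 1:] ^ ?r)"
    by (simp only: pcompose_power smult_power)
  then have "(u\<^sup>2) ^ (CHAR('a) - 1) * hasse_coeff ?f = (u ^ 6) ^ ?r * hasse_coeff [:b, a, 0, 1:]"
    unfolding hasse_coeff_def coeff_pcompose_linear[symmetric] by simp
  then show ?thesis using assms by (metis mult_eq_0_iff power_eq_0_iff)
qed

section \<open>Curves with prescribed j-invariant and the two explicit families\<close>

locale prime_closure =
  fixes ty :: "'a::alg_closed_field itself"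
  assumes prime_char: "prime CHAR('a)" and char_ge_5: "CHAR('a) \<ge> 5"
    and periodic: "\<And>x::'a. \<exists>n>0. x ^ (CHAR('a) ^ n) = x"
begin

lemma odd_char: "odd CHAR('a)"
  using prime_char char_ge_5 prime_odd_nat by fastforce

definition r :: nat where "r = (CHAR('a) - 1) div 2"

lemma char_eq: "CHAR('a) = 2 * r + 1"
  using odd_char by (auto simp: r_def elim!: oddE)

lemma two_three_nonzero: "(2::'a) \<noteq> 0" "(3::'a) \<noteq> 0"
proof -
  show "(2::'a) \<noteq> 0"
    using of_nat_nonzero_below_char[of 2, where 'a = 'a] char_ge_5 by simp
  show "(3::'a) \<noteq> 0"
    using of_nat_nonzero_below_char[of 3, where 'a = 'a] char_ge_5 by simp
qed

lemma numerals_nonzero: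
  "(4::'a) \<noteq> 0" "(16::'a) \<noteq> 0" "(27::'a) \<noteq> 0" "(64::'a) \<noteq> 0" "(256::'a) \<noteq> 0" "(1728::'a) \<noteq> 0" "(9::'a) \<noteq> 0" "(186624::'a) \<noteq> 0"
proof -
  have p: "(2::'a) ^ n * 3 ^ m \<noteq> 0" for n m using two_three_nonzero by simp
  show "(4::'a) \<noteq> 0" using p[of 2 0] by simp
  show "(16::'a) \<noteq> 0" using p[of 4 0] by simp
  show "(27::'a) \<noteq> 0" using p[of 0 3] by simp
  show "(64::'a) \<noteq> 0" using p[of 6 0] by simp
  show "(256::'a) \<noteq> 0" using p[of 8 0] by simp
  show "(1728::'a) \<noteq> 0" using p[of 6 3] by simp
  show "(9::'a) \<noteq> 0" using p[of 0 2] by simp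
  show "(186624::'a) \<noteq> 0" using p[of 8 6] by simp
qed

text \<open>Equal j-invariants give \<open>a^3 b'^2 = a'^3 b^2\<close>. If \<open>a\<close> or
  \<open>b\<close> is zero, so is its counterpart, and a sixth or fourth root of the remaining ratio
  is the required \<open>u\<close>.\<close>

lemma ec_j_eq_imp_twist:
  fixes a b a' b' :: 'a
  assumes ns: "ec_nonsingular a b" "ec_nonsingular a' b'" and j: "ec_j a b = ec_j a' b'"
  shows "\<exists>u. u \<noteq> 0 \<and> a' = u ^ 4 * a \<and> b' = u ^ 6 * b"
proof -
  define D D' where "D = 4 * a ^ 3 + 27 * b\<^sup>2" and "D' = 4 * a' ^ 3 + 27 * b'\<^sup>2"
  have D: "D \<noteq> 0" "D' \<noteq> 0" using ns by (simp_all add: D_def D'_def ec_nonsingular_def)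
  have "1728 * (4 * a ^ 3) * D' = 1728 * (4 * a' ^ 3) * D"
    using j D unfolding ec_j_def D_def[symmetric] D'_def[symmetric] by (simp add: frac_eq_eq)
  then have "(1728 * 4) * (a ^ 3 * D') = (1728 * 4) * (a' ^ 3 * D)" by (simp only: mult.assoc)
  then have "a ^ 3 * D' = a' ^ 3 * D"
    using numerals_nonzero by (metis mult_cancel_left mult_eq_0_iff)
  then have "27 * (a ^ 3 * b'\<^sup>2) = 27 * (a' ^ 3 * b\<^sup>2)"
    unfolding D_def D'_def by (simp add: algebra_simps)
  then have e: "a ^ 3 * b'\<^sup>2 = a' ^ 3 * b\<^sup>2" using numerals_nonzero by simp
  show ?thesis
  proof (cases "a = 0 \<or> b = 0")
    case True
    then show ?thesis
    proof
      assume a: "a = 0"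
      then have b: "b \<noteq> 0" using ns by (auto simp: ec_nonsingular_def)
      then have a': "a' = 0" using e a by simp
      then have b': "b' \<noteq> 0" using ns by (auto simp: ec_nonsingular_def)
      obtain u where u: "u ^ 6 = b' / b" using nth_root_exists[of 6 "b' / b"] by auto
      then have "u \<noteq> 0" using b b' by auto
      then show ?thesis using u a a' b by (intro exI[of _ u]) simp
    next
      assume b: "b = 0"
      then have a: "a \<noteq> 0" using ns by (auto simp: ec_nonsingular_def)
      then have b': "b' = 0" using e b by simp
      then have a': "a' \<noteq> 0" using ns by (auto simp: ec_nonsingular_def)
      obtain u where u: "u ^ 4 = a' / a" using nth_root_exists[of 4 "a' / a"] by auto
      then have "u \<noteq> 0" using a a' by auto
      then show ?thesis using u a b' b by (intro exI[of _ u]) simp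
    qed
  next
    case False
    then have ab: "a \<noteq> 0" "b \<noteq> 0" by auto
    have "a' = 0 \<longleftrightarrow> b' = 0" using e ab by auto
    then have ab': "a' \<noteq> 0" "b' \<noteq> 0" using ns by (auto simp: ec_nonsingular_def)
    \<comment> \<open>The quotient of \<open>b' / b = u^6\<close> by \<open>a' / a = u^4\<close>,
      hence the square of the \<open>u\<close> sought.\<close>
    define v where "v = b' * a / (b * a')"
    have v2: "v\<^sup>2 = a' / a"
      using ab ab' e by (simp add: v_def field_simps power2_eq_square power3_eq_cube)
    have "v * v\<^sup>2 = b' / b" unfolding v2 using ab ab' by (simp add: v_def)
    then have v3: "v ^ 3 = b' / b" by (simp add: power3_eq_cube power2_eq_square mult.assoc)
    obtain u where u: "u\<^sup>2 = v" using nth_root_exists[of 2 v] by auto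
    have "v \<noteq> 0" using ab ab' by (simp add: v_def)
    then have "u \<noteq> 0" using u by auto
    moreover have "u ^ 4 = a' / a" "u ^ 6 = b' / b"
      using v2 v3 unfolding u[symmetric] power_mult[symmetric] by simp_all
    ultimately show ?thesis using ab by (intro exI[of _ u]) simp
  qed
qed

text \<open>Curves with the same j-invariant are twists of each other, so the existential quantifier
  in \<open>supersingular_j\<close> may be tested on one model.\<close>

lemma supersingular_j_iff_hasse_coeff:
  fixes a b :: 'a
  assumes "ec_nonsingular a b"
  shows "supersingular_j (ec_j a b) \<longleftrightarrow> hasse_coeff [:b, a, 0, 1:] = 0"
proof -
  note ss = supersingular_iff_hasse_coeff[OF prime_char odd_char periodic]
  show ?thesis
  proof
    assume "supersingular_j (ec_j a b)"
    then obtain a' b' where *: "ec_nonsingular a' b'" "ec_supersingular a' b'" "ec_j a' b' = ec_j a b"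
      by (auto simp: supersingular_j_def)
    obtain u where "u \<noteq> 0" "a' = u ^ 4 * a" "b' = u ^ 6 * b"
      using ec_j_eq_imp_twist[OF assms *(1)] *(3) by metis
    then show "hasse_coeff [:b, a, 0, 1:] = 0" using ss[OF *(1)] *(2) hasse_coeff_scale by metis
  next
    assume "hasse_coeff [:b, a, 0, 1:] = 0"
    then show "supersingular_j (ec_j a b)"
      unfolding supersingular_j_def using ss[OF assms] assms by blast
  qed
qed

text \<open>
  The curve \<open>y^2 = x (x^2 - 2 w x + (Y - 64))\<close> is 2-isogenous to \<open>y^2 = x (x^2 + w x + 16)\<close>.
\<close>

lemma supersingular_family2:
  fixes w y :: 'a
  assumes "w\<^sup>2 = y" "y \<noteq> 64"
  shows "supersingular_j ((y + 192) ^ 3 / (y - 64)\<^sup>2) \<longleftrightarrow> hasse_coeff [:0, y - 64, - 2 * w, 1:] = 0"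
proof -
  \<comment> \<open>The translation by \<open>2 v = 2 w / 3\<close> removes the quadratic term;
    \<open>a\<close> and \<open>b\<close> are the coefficients that result.\<close>
  define v where "v = w / 3"
  define a where "a = - (3 * v\<^sup>2 + 64)"
  define b where "b = 2 * v * (v\<^sup>2 - 64)"
  note nz = two_three_nonzero numerals_nonzero
  have w: "w = 3 * v" using nz by (simp add: v_def)
  have y: "y = 9 * v\<^sup>2" using assms(1) by (simp add: w power_mult_distrib)
  have D: "4 * a ^ 3 + 27 * b\<^sup>2 = - 256 * (y - 64)\<^sup>2"
    unfolding a_def b_def y by (simp add: algebra_simps power2_eq_square power3_eq_cube)
  then have ns: "ec_nonsingular a b" using nz assms by (simp add: ec_nonsingular_def)
  have "1728 * (4 * a ^ 3) = - 256 * (y + 192) ^ 3"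
    unfolding a_def y by (simp add: algebra_simps power2_eq_square power3_eq_cube)
  then have j: "ec_j a b = (y + 192) ^ 3 / (y - 64)\<^sup>2"
    unfolding ec_j_def D using nz by simp
  have "[:0, y - 64, - 2 * w, 1:] \<circ>\<^sub>p [:2 * v, 1:] = [:b, a, 0, 1:]"
    unfolding a_def b_def w y by (simp add: pcompose_pCons algebra_simps power2_eq_square)
  then have "hasse_coeff [:0, y - 64, - 2 * w, 1:] = hasse_coeff [:b, a, 0, 1:]"
    using hasse_coeff_translate[OF prime_char, of "[:0, y - 64, - 2 * w, 1:]" "2 * v"] by simp
  then show ?thesis using supersingular_j_iff_hasse_coeff[OF ns] j by simp
qed

text \<open>The cubic is \<open>x^3 + (3 w x + 4 (y - 27))^2\<close>. The line given by the bracket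
  meets the curve triply at \<open>x = 0\<close>, in a point of order three. Translation by
  \<open>- 3 w^2\<close> removes the quadratic term \<open>9 w^2\<close>.\<close>

lemma supersingular_family3:
  fixes w y :: 'a
  assumes "w ^ 3 = y" "y \<noteq> 27"
  shows "supersingular_j (y * (y + 216) ^ 3 / (y - 27) ^ 3) \<longleftrightarrow>
    hasse_coeff [:(4 * (y - 27))\<^sup>2, 2 * (3 * w) * (4 * (y - 27)), (3 * w)\<^sup>2, 1:] = 0"
proof -
  define a where "a = - 3 * w * (y + 216)"
  define b where "b = - 2 * y\<^sup>2 + 1080 * y + 11664"
  note nz = two_three_nonzero numerals_nonzero
  have a3: "a ^ 3 = - 27 * (y * (y + 216) ^ 3)"
    unfolding a_def assms(1)[symmetric] by (simp add: power_mult_distrib)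
  have D: "4 * a ^ 3 + 27 * b\<^sup>2 = - 186624 * (y - 27) ^ 3"
    unfolding a3 b_def by (simp add: algebra_simps power2_eq_square power3_eq_cube)
  then have ns: "ec_nonsingular a b" using nz assms by (simp add: ec_nonsingular_def)
  have "1728 * (4 * a ^ 3) = - 186624 * (y * (y + 216) ^ 3)" unfolding a3 by simp
  then have j: "ec_j a b = y * (y + 216) ^ 3 / (y - 27) ^ 3"
    unfolding ec_j_def D using nz by simp
  let ?f = "[:(4 * (y - 27))\<^sup>2, 2 * (3 * w) * (4 * (y - 27)), (3 * w)\<^sup>2, 1:]"
  have "?f \<circ>\<^sub>p [:- 3 * w\<^sup>2, 1:] = [:b, a, 0, 1:]"
    unfolding a_def b_def assms(1)[symmetric]
    by (simp add: pcompose_pCons algebra_simps power2_eq_square power3_eq_cube)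
  then have "hasse_coeff ?f = hasse_coeff [:b, a, 0, 1:]"
    using hasse_coeff_translate[OF prime_char, of ?f "- 3 * w\<^sup>2"] by simp
  then show ?thesis using supersingular_j_iff_hasse_coeff[OF ns] j by simp
qed

end

section \<open>The Hasse invariants of the two families\<close>

lemma coeff_square_power:
  fixes b :: "'a::field"
  shows "coeff ([:b, 0, 1:] ^ k) k = (if even k then of_nat (k choose (k div 2)) * b ^ (k div 2) else 0)"
proof -
  have "[:b, 0, 1:] = [:b, 1:] \<circ>\<^sub>p Polynomial.monom 1 2"
    by (simp add: pcompose_pCons monom_altdef power2_eq_square)
  then have eq: "[:b, 0, 1:] ^ k = ([:b, 1:] ^ k) \<circ>\<^sub>p Polynomial.monom 1 2"
    by (simp only: pcompose_power)
  show ?thesis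
  proof (cases "even k")
    case True
    then obtain i where "k = 2 * i" by (elim evenE)
    then show ?thesis
      unfolding eq using coeff_pcompose_monom[of 0 2 "[:b, 1:] ^ k" i] by (simp add: coeff_linear_poly_power)
  next
    case False
    then obtain i where "k = 2 * i + 1" by (elim oddE)
    then show ?thesis
      unfolding eq using coeff_pcompose_monom[of 1 2 "[:b, 1:] ^ k" i] by simp
  qed
qed

text \<open>Take the linear term from \<open>r - j\<close> factors; the other \<open>j\<close>
  factors \<open>X^2 + \<beta>\<close> must contribute \<open>X^j\<close>, so \<open>j = 2 k\<close>
  is even.\<close>

lemma coeff_trinomial_power:
  fixes \<alpha> \<beta> :: "'a::field"
  shows "coeff ([:\<beta>, \<alpha>, 1:] ^ r) r =
    (\<Sum>k\<le>r div 2. of_nat (r choose (2 * k)) * of_nat (2 * k choose k) * \<beta> ^ k * \<alpha> ^ (r - 2 * k))"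
proof -
  have "[:\<beta>, \<alpha>, 1:] = [:\<beta>, 0, 1:] + Polynomial.monom \<alpha> 1" by (simp add: monom_altdef)
  then have "[:\<beta>, \<alpha>, 1:] ^ r = (\<Sum>k\<le>r. of_nat (r choose k) * [:\<beta>, 0, 1:] ^ k * Polynomial.monom (\<alpha> ^ (r - k)) (r - k))"
    by (simp only: binomial_ring monom_power mult_1)
  then have "coeff ([:\<beta>, \<alpha>, 1:] ^ r) r =
      (\<Sum>k\<le>r. coeff (Polynomial.monom (\<alpha> ^ (r - k)) (r - k) * smult (of_nat (r choose k)) ([:\<beta>, 0, 1:] ^ k)) r)"
    by (simp add: coeff_sum of_nat_poly mult.commute)
  also have "\<dots> = (\<Sum>k\<le>r. if even k then of_nat (r choose k) * of_nat (k choose (k div 2)) * \<beta> ^ (k div 2) * \<alpha> ^ (r - k) else 0)"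
    by (intro sum.cong refl) (auto simp: coeff_monom_mult coeff_square_power)
  also have "\<dots> = (\<Sum>k\<in>(*) 2 ` {..r div 2}. of_nat (r choose k) * of_nat (k choose (k div 2)) * \<beta> ^ (k div 2) * \<alpha> ^ (r - k))"
    by (intro sum.mono_neutral_cong_right) (auto elim!: evenE)
  also have "\<dots> = (\<Sum>k\<le>r div 2. of_nat (r choose (2 * k)) * of_nat (2 * k choose k) * \<beta> ^ k * \<alpha> ^ (r - 2 * k))"
    by (subst sum.reindex) (auto simp: inj_on_def)
  finally show ?thesis .
qed

text \<open>Take \<open>X^3\<close> from \<open>i\<close> factors; the remaining
  \<open>(\<alpha> X + \<beta>)^(2 (r - i))\<close> must contribute
  \<open>X^(2 r - 3 i)\<close>.\<close>

lemma coeff_cubic_plus_square_power: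
  fixes \<alpha> \<beta> :: "'a::field"
  shows "coeff ([:\<beta>\<^sup>2, 2 * \<alpha> * \<beta>, \<alpha>\<^sup>2, 1:] ^ r) (2 * r) =
    (\<Sum>i\<le>2 * r div 3. of_nat (r choose i) * of_nat (2 * r - 2 * i choose i) * \<beta> ^ i * \<alpha> ^ (2 * r - 3 * i))"
proof -
  have "[:\<beta>\<^sup>2, 2 * \<alpha> * \<beta>, \<alpha>\<^sup>2, 1:] = Polynomial.monom 1 3 + [:\<beta>, \<alpha>:]\<^sup>2"
    by (simp add: monom_altdef power2_eq_square power3_eq_cube algebra_simps)
  then have "[:\<beta>\<^sup>2, 2 * \<alpha> * \<beta>, \<alpha>\<^sup>2, 1:] ^ r =
      (\<Sum>i\<le>r. of_nat (r choose i) * Polynomial.monom 1 (3 * i) * [:\<beta>, \<alpha>:] ^ (2 * (r - i)))"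
    by (simp only: binomial_ring monom_power power_one power_mult)
  then have "coeff ([:\<beta>\<^sup>2, 2 * \<alpha> * \<beta>, \<alpha>\<^sup>2, 1:] ^ r) (2 * r) =
      (\<Sum>i\<le>r. coeff (Polynomial.monom (of_nat (r choose i)) (3 * i) * [:\<beta>, \<alpha>:] ^ (2 * (r - i))) (2 * r))"
    by (simp add: coeff_sum of_nat_poly smult_monom)
  also have "\<dots> = (\<Sum>i\<le>2 * r div 3. of_nat (r choose i) * of_nat (2 * r - 2 * i choose i) * \<beta> ^ i * \<alpha> ^ (2 * r - 3 * i))"
  proof (intro sum.mono_neutral_cong_right ballI)
    fix i assume "i \<in> {..2 * r div 3}"
    then have i: "3 * i \<le> 2 * r" by auto
    then have d: "2 * r - 2 * i - (2 * r - 3 * i) = i" by auto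
    have "(2 * r - 2 * i choose (2 * r - 3 * i)) = (2 * r - 2 * i choose i)"
      using binomial_symmetric[of "2 * r - 3 * i" "2 * r - 2 * i"] i d by simp
    moreover have "coeff ([:\<beta>, \<alpha>:] ^ (2 * r - 2 * i)) (2 * r - 3 * i) =
        of_nat (2 * r - 2 * i choose (2 * r - 3 * i)) * \<alpha> ^ (2 * r - 3 * i) * \<beta> ^ i"
      using i d by (subst coeff_linear_poly_power) auto
    ultimately show "coeff (Polynomial.monom (of_nat (r choose i)) (3 * i) * [:\<beta>, \<alpha>:] ^ (2 * (r - i))) (2 * r) =
        of_nat (r choose i) * of_nat (2 * r - 2 * i choose i) * \<beta> ^ i * \<alpha> ^ (2 * r - 3 * i)"
      using i by (simp add: coeff_monom_mult diff_mult_distrib2)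
  qed (auto simp: coeff_monom_mult)
  finally show ?thesis .
qed

section \<open>Recurrences for binomial coefficients\<close>

lemma central_binomial_Suc: "Suc m * (2 * Suc m choose Suc m) = 2 * (2 * m + 1) * (2 * m choose m)"
proof -
  have "fact (Suc m) * fact (Suc m) * (2 * Suc m choose Suc m) = (fact (2 * Suc m) :: nat)"
    using binomial_fact_lemma[of "Suc m" "2 * Suc m"] by simp
  also have "\<dots> = (2 * m + 2) * (2 * m + 1) * fact (2 * m)"
    by (simp add: algebra_simps)
  also have "(fact (2 * m) :: nat) = fact m * fact m * (2 * m choose m)"
    using binomial_fact_lemma[of m "2 * m"] by simp
  finally have "(fact m * fact m * Suc m) * (Suc m * (2 * Suc m choose Suc m)) =
      (fact m * fact m * Suc m) * (2 * (2 * m + 1) * (2 * m choose m))"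
    by (simp add: algebra_simps)
  then show ?thesis by (simp only: mult_cancel1) simp
qed

lemma Suc_times_choose_Suc: "Suc i * (n choose Suc i) = (n - i) * (n choose i)"
  by (metis binomial_absorb_comp mult.commute binomial_absorption times_binomial_minus1_eq diff_Suc_1)

lemma choose_mult_fact: "(n choose i) * fact i = (\<Prod>j<i. n - j)"
proof (induction i)
  case (Suc i)
  have "(n choose Suc i) * fact (Suc i) = (Suc i * (n choose Suc i)) * fact i"
    by (simp add: algebra_simps)
  also note Suc_times_choose_Suc
  finally show ?case using Suc by (simp add: mult.commute mult.left_commute)
qed simp

text \<open>\<open>coeffs2 n\<close> is \<open>(4n)! / (n!^2 (2n)!)\<close> and
  \<open>coeffs3 n\<close> is \<open>(3n)! / n!^3\<close>. Divided by \<open>64^n\<close> and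
  \<open>27^n\<close> they are the coefficients of the hypergeometric series with parameters
  \<open>1/4, 3/4; 1\<close> and \<open>1/3, 2/3; 1\<close>.\<close>

definition coeffs2 :: "nat \<Rightarrow> nat" where "coeffs2 n = (2 * n choose n) * (4 * n choose (2 * n))"
definition coeffs3 :: "nat \<Rightarrow> nat" where "coeffs3 n = (2 * n choose n) * (3 * n choose n)"

lemma coeffs2_Suc: "(Suc k)\<^sup>2 * coeffs2 (Suc k) = 4 * (4 * k + 1) * (4 * k + 3) * coeffs2 k"
proof -
  have f: "fact k * fact k * fact (2 * k) * coeffs2 k = fact (4 * k)" for k
  proof -
    have "fact (2 * k) * fact (2 * k) * (4 * k choose (2 * k)) = fact (4 * k)"
      using binomial_fact_lemma[of "2 * k" "4 * k"] by simp
    moreover have "fact k * fact k * (2 * k choose k) = fact (2 * k)"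
      using binomial_fact_lemma[of k "2 * k"] by simp
    moreover have "fact k * fact k * fact (2 * k) * coeffs2 k =
        (fact k * fact k * (2 * k choose k)) * fact (2 * k) * (4 * k choose (2 * k))"
      by (simp only: coeffs2_def ac_simps)
    ultimately show ?thesis by simp
  qed
  have 4: "fact (4 * Suc k) = (4 * k + 4) * (4 * k + 3) * (4 * k + 2) * (4 * k + 1) * (fact (4 * k) :: nat)"
  proof -
    have "4 * Suc k = Suc (Suc (Suc (Suc (4 * k))))" "4 * k + 4 = Suc (Suc (Suc (Suc (4 * k))))"
      "4 * k + 3 = Suc (Suc (Suc (4 * k)))" "4 * k + 2 = Suc (Suc (4 * k))" "4 * k + 1 = Suc (4 * k)" by simp_all
    then show ?thesis by (simp only: fact_Suc of_nat_id mult.assoc)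
  qed
  have 2: "fact (2 * Suc k) = (2 * k + 2) * (2 * k + 1) * (fact (2 * k) :: nat)"
  proof -
    have "2 * Suc k = Suc (Suc (2 * k))" "2 * k + 2 = Suc (Suc (2 * k))" "2 * k + 1 = Suc (2 * k)" by simp_all
    then show ?thesis by (simp only: fact_Suc of_nat_id mult.assoc)
  qed
  define c where "c = fact k * fact k * fact (2 * k) * (2 * k + 2) * (2 * k + 1)"
  have "c * ((Suc k)\<^sup>2 * coeffs2 (Suc k)) = fact (Suc k) * fact (Suc k) * fact (2 * Suc k) * coeffs2 (Suc k)"
    unfolding c_def 2 fact_Suc of_nat_id power2_eq_square by (simp only: mult.assoc mult.commute mult.left_commute)
  also have "\<dots> = (4 * k + 4) * (4 * k + 3) * (4 * k + 2) * (4 * k + 1) * (fact k * fact k * fact (2 * k) * coeffs2 k)"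
    unfolding f 4 ..
  also have "\<dots> = c * (4 * (4 * k + 1) * (4 * k + 3) * coeffs2 k)"
  proof -
    have e: "(4 * k + 4) * (4 * k + 2) = 4 * ((2 * k + 2) * (2 * k + 1))" by (simp add: algebra_simps)
    have "(4 * k + 4) * (4 * k + 3) * (4 * k + 2) * (4 * k + 1) * (fact k * fact k * fact (2 * k) * coeffs2 k) =
        ((4 * k + 4) * (4 * k + 2)) * ((4 * k + 3) * (4 * k + 1) * (fact k * fact k * fact (2 * k) * coeffs2 k))"
      by (simp only: mult.assoc mult.commute mult.left_commute)
    then show ?thesis unfolding e c_def by (simp only: mult.assoc mult.commute mult.left_commute)
  qed
  finally show ?thesis by (simp only: mult_cancel1) (simp add: c_def)
qed

lemma coeffs3_Suc: "(Suc k)\<^sup>2 * coeffs3 (Suc k) = 3 * (3 * k + 1) * (3 * k + 2) * coeffs3 k"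
proof -
  have f: "fact k * fact k * fact k * coeffs3 k = fact (3 * k)" for k
  proof -
    have "fact k * fact (2 * k) * (3 * k choose k) = fact (3 * k)"
      using binomial_fact_lemma[of k "3 * k"] by simp
    moreover have "fact k * fact k * (2 * k choose k) = fact (2 * k)"
      using binomial_fact_lemma[of k "2 * k"] by simp
    moreover have "fact k * fact k * fact k * coeffs3 k =
        fact k * (fact k * fact k * (2 * k choose k)) * (3 * k choose k)"
      by (simp only: coeffs3_def ac_simps)
    ultimately show ?thesis by simp
  qed
  have 3: "fact (3 * Suc k) = (3 * k + 3) * (3 * k + 2) * (3 * k + 1) * (fact (3 * k) :: nat)"
  proof -
    have "3 * Suc k = Suc (Suc (Suc (3 * k)))" "3 * k + 3 = Suc (Suc (Suc (3 * k)))"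
      "3 * k + 2 = Suc (Suc (3 * k))" "3 * k + 1 = Suc (3 * k)" by simp_all
    then show ?thesis by (simp only: fact_Suc of_nat_id mult.assoc)
  qed
  define c where "c = fact k * fact k * fact k * Suc k"
  have "c * ((Suc k)\<^sup>2 * coeffs3 (Suc k)) = fact (Suc k) * fact (Suc k) * fact (Suc k) * coeffs3 (Suc k)"
    unfolding c_def fact_Suc of_nat_id power2_eq_square by (simp only: mult.assoc mult.commute mult.left_commute)
  also have "\<dots> = (3 * k + 3) * (3 * k + 2) * (3 * k + 1) * (fact k * fact k * fact k * coeffs3 k)"
    unfolding f 3 ..
  also have "\<dots> = c * (3 * (3 * k + 1) * (3 * k + 2) * coeffs3 k)"
  proof -
    have e: "3 * k + 3 = 3 * Suc k" by simp
    show ?thesis unfolding e c_def by (simp only: mult.assoc mult.commute mult.left_commute)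
  qed
  finally show ?thesis by (simp only: mult_cancel1) (simp add: c_def)
qed

section \<open>Reduction modulo the characteristic\<close>

context prime_closure begin

lemma of_nat_r: "2 * (of_nat r :: 'a) = - 1"
proof -
  have "(of_nat (2 * r + 1) :: 'a) = 0" unfolding char_eq[symmetric] by simp
  then show ?thesis by (simp add: eq_neg_iff_add_eq_0 add.commute)
qed

text \<open>Modulo \<open>p\<close> the number \<open>r = (p - 1) / 2\<close> is \<open>- 1 / 2\<close>.\<close>

lemma choose_half:
  assumes "m < CHAR('a)"
  shows "of_nat (r choose m) * (- 4) ^ m = (of_nat (2 * m choose m) :: 'a)"
  using assms
proof (induction m)
  case (Suc m)
  let ?n = "of_nat :: nat \<Rightarrow> 'a"
  have nz: "?n (Suc m) \<noteq> 0" by (rule of_nat_nonzero_below_char) (use Suc in auto)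
  have "Suc m * (r choose Suc m) + m * (r choose m) = r * (r choose m)"
    unfolding Suc_times_choose_Suc by (cases "m \<le> r") (simp_all flip: distrib_right)
  then have "?n (Suc m * (r choose Suc m) + m * (r choose m)) = ?n (r * (r choose m))" by simp
  then have "?n (Suc m) * ?n (r choose Suc m) = (?n r - ?n m) * ?n (r choose m)"
    by (simp only: of_nat_add of_nat_mult left_diff_distrib) (simp add: algebra_simps)
  then have "?n (Suc m) * (?n (r choose Suc m) * (- 4) ^ Suc m) = ((?n r - ?n m) * (- 4)) * (?n (r choose m) * (- 4) ^ m)"
    by (simp only: power_Suc mult.assoc[symmetric]) (simp only: mult.assoc mult.commute mult.left_commute)
  also have "\<dots> = (2 * (2 * ?n m + 1)) * ?n (2 * m choose m)"
  proof -
    have "(?n r - ?n m) * (- 4) = - 2 * (2 * ?n r) + 4 * ?n m" by (simp add: algebra_simps)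
    also have "\<dots> = 2 * (2 * ?n m + 1)" unfolding of_nat_r by simp
    finally show ?thesis using Suc by simp
  qed
  also have "\<dots> = ?n (2 * (2 * m + 1) * (2 * m choose m))"
    by (simp only: of_nat_mult of_nat_add of_nat_1 of_nat_numeral)
  also have "\<dots> = ?n (Suc m) * ?n (2 * Suc m choose Suc m)"
    unfolding central_binomial_Suc[symmetric] of_nat_mult ..
  finally show ?case using nz by (simp only: mult_cancel_left simp_thms)
qed simp

text \<open>As \<open>2 r = - 1\<close> in the field, the upper entry becomes
  \<open>- 1 - 2 i\<close>, and negating the factors of the falling product gives those for
  \<open>3 i choose i\<close>.\<close>

lemma choose_reflect:
  assumes "3 * i \<le> 2 * r"
  shows "(of_nat (2 * r - 2 * i choose i) :: 'a) = (- 1) ^ i * of_nat (3 * i choose i)"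
proof -
  let ?n = "of_nat :: nat \<Rightarrow> 'a"
  have "i < CHAR('a)" using assms char_eq by linarith
  then have nz: "?n (fact i) \<noteq> 0"
    using prime_char by (auto simp: of_nat_eq_0_iff_char_dvd prime_dvd_fact_iff)
  have "?n (2 * r - 2 * i choose i) * ?n (fact i) = (\<Prod>j<i. ?n (2 * r - 2 * i - j))"
    using arg_cong[OF choose_mult_fact[of "2 * r - 2 * i" i], of ?n] by simp
  also have "\<dots> = (\<Prod>j<i. - 1 * ?n (2 * i + Suc j))"
  proof (intro prod.cong refl)
    fix j assume "j \<in> {..<i}"
    then have "2 * r + 1 = (2 * r - 2 * i - j) + (2 * i + Suc j)" using assms by auto
    then have "?n ((2 * r - 2 * i - j) + (2 * i + Suc j)) = 0" using char_eq by (metis of_nat_CHAR)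
    then show "?n (2 * r - 2 * i - j) = - 1 * ?n (2 * i + Suc j)"
      by (simp only: of_nat_add eq_neg_iff_add_eq_0 mult_minus1)
  qed
  also have "\<dots> = (- 1) ^ i * (\<Prod>j<i. ?n (2 * i + Suc j))"
    unfolding prod.distrib by simp
  also have "(\<Prod>j<i. ?n (2 * i + Suc j)) = (\<Prod>j<i. ?n (3 * i - j))"
  proof -
    have "(\<Prod>j<i. ?n (2 * i + Suc j)) = (\<Prod>j<i. ?n (2 * i + Suc (i - Suc j)))"
      by (rule prod.nat_diff_reindex[symmetric])
    also have "\<dots> = (\<Prod>j<i. ?n (3 * i - j))" by (intro prod.cong refl arg_cong[where f = ?n]) auto
    finally show ?thesis .
  qed
  also have "\<dots> = ?n (3 * i choose i) * ?n (fact i)"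
    using arg_cong[OF choose_mult_fact[of "3 * i" i], of ?n] by simp
  finally show ?thesis using nz by (simp only: mult.assoc[symmetric] mult_cancel_right simp_thms)
qed

definition t2 :: "nat \<Rightarrow> 'a" where "t2 k = of_nat (coeffs2 k) / 64 ^ k"
definition t3 :: "nat \<Rightarrow> 'a" where "t3 k = of_nat (coeffs3 k) / 27 ^ k"

lemma of_nat_choose_nonzero: "k \<le> n \<Longrightarrow> n < CHAR('a) \<Longrightarrow> (of_nat (n choose k) :: 'a) \<noteq> 0"
proof
  assume k: "k \<le> n" "n < CHAR('a)" and "(of_nat (n choose k) :: 'a) = 0"
  then have "CHAR('a) dvd n choose k" by (simp add: of_nat_eq_0_iff_char_dvd)
  then have "CHAR('a) dvd fact k * fact (n - k) * (n choose k)" by simp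
  then have "CHAR('a) dvd fact n" using k by (simp add: binomial_fact_lemma)
  then show False using k prime_char by (simp add: prime_dvd_fact_iff)
qed

text \<open>Here \<open>3 / 16 = 1/4 * 3/4\<close>. The characteristic is \<open>4 M + 1\<close> or
  \<open>4 M + 3\<close>, so \<open>M\<close> becomes \<open>- 1/4\<close> or \<open>- 3/4\<close>
  and the series breaks off. The last coefficient is nonzero because \<open>4 M\<close> is below the
  characteristic.\<close>

sublocale h2: truncated_hypergeom t2 "3 / 16" "r div 2"
proof
  let ?n = "of_nat :: nat \<Rightarrow> 'a"
  note nz = numerals_nonzero
  fix k
  have "?n (Suc k) ^ 2 * ?n (coeffs2 (Suc k)) = ?n (4 * (4 * k + 1) * (4 * k + 3) * coeffs2 k)"
    unfolding coeffs2_Suc[symmetric] by (simp only: of_nat_mult of_nat_power)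
  also have "\<dots> = 4 * (4 * ?n k + 1) * (4 * ?n k + 3) * ?n (coeffs2 k)"
    by (simp only: of_nat_mult of_nat_add of_nat_1 of_nat_numeral)
  also have "\<dots> = 64 * (((?n k)\<^sup>2 + ?n k + 3 / 16) * ?n (coeffs2 k))"
  proof -
    have "64 * ((?n k)\<^sup>2 + ?n k + 3 / 16) = 64 * (?n k)\<^sup>2 + 64 * ?n k + 12"
    proof -
      have "64 * (3 / 16) = (12::'a)" using nz by (simp add: nonzero_divide_eq_eq)
      then show ?thesis by (simp only: distrib_left)
    qed
    also have "\<dots> = 4 * (4 * ?n k + 1) * (4 * ?n k + 3)" by (simp add: algebra_simps power2_eq_square)
    finally show ?thesis by (simp only: mult.assoc[symmetric])
  qed
  finally have "?n (Suc k) ^ 2 * ?n (coeffs2 (Suc k)) / 64 ^ Suc k = 64 * (((?n k)\<^sup>2 + ?n k + 3 / 16) * ?n (coeffs2 k)) / 64 ^ Suc k"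
    by simp
  then show "(?n (k + 1))\<^sup>2 * t2 (k + 1) = ((?n k)\<^sup>2 + ?n k + 3 / 16) * t2 k"
    unfolding t2_def Suc_eq_plus1[symmetric] using nz by (simp del: of_nat_Suc)
next
  let ?n = "of_nat :: nat \<Rightarrow> 'a" and ?M = "r div 2"
  note nz = numerals_nonzero
  have "CHAR('a) = 4 * ?M + 1 \<or> CHAR('a) = 4 * ?M + 3" using char_eq by presburger
  then have "?n (4 * ?M + 1) = 0 \<or> ?n (4 * ?M + 3) = 0" by (metis of_nat_CHAR)
  then have z: "(4 * ?n ?M + 1) * (4 * ?n ?M + 3) = 0" by (auto simp: add.commute)
  have "16 * ((?n ?M)\<^sup>2 + ?n ?M + 3 / 16) = 16 * (?n ?M)\<^sup>2 + 16 * ?n ?M + 3"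
    using nz by (simp add: distrib_left)
  also have "\<dots> = (4 * ?n ?M + 1) * (4 * ?n ?M + 3)" by (simp add: algebra_simps power2_eq_square)
  finally have "16 * ((?n ?M)\<^sup>2 + ?n ?M + 3 / 16) = 0" unfolding z .
  then show "(?n ?M)\<^sup>2 + ?n ?M + 3 / 16 = 0" using nz by (simp only: mult_eq_0_iff simp_thms)
  show "t2 0 = 1" by (simp add: t2_def coeffs2_def)
  show "t2 ?M \<noteq> 0"
    using nz of_nat_choose_nonzero[of ?M "2 * ?M"] of_nat_choose_nonzero[of "2 * ?M" "4 * ?M"] char_eq
    by (auto simp: t2_def coeffs2_def)
  show "?M < CHAR('a)" using char_eq by linarith
qed

lemma char_mod_3: "2 * r mod 3 \<noteq> 2"
proof
  assume "2 * r mod 3 = 2"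
  then have "3 dvd CHAR('a)" using char_eq by presburger
  then show False using prime_char char_ge_5 by (auto simp: prime_nat_iff)
qed

text \<open>Here \<open>2 / 9 = 1/3 * 2/3\<close>, and the characteristic is \<open>3 M + 1\<close>
  or \<open>3 M + 2\<close>.\<close>

sublocale h3: truncated_hypergeom t3 "2 / 9" "2 * r div 3"
proof
  let ?n = "of_nat :: nat \<Rightarrow> 'a"
  note nz = numerals_nonzero
  fix k
  have "?n (Suc k) ^ 2 * ?n (coeffs3 (Suc k)) = ?n (3 * (3 * k + 1) * (3 * k + 2) * coeffs3 k)"
    unfolding coeffs3_Suc[symmetric] by (simp only: of_nat_mult of_nat_power)
  also have "\<dots> = 3 * (3 * ?n k + 1) * (3 * ?n k + 2) * ?n (coeffs3 k)"
    by (simp only: of_nat_mult of_nat_add of_nat_1 of_nat_numeral)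
  also have "\<dots> = 27 * (((?n k)\<^sup>2 + ?n k + 2 / 9) * ?n (coeffs3 k))"
  proof -
    have "27 * ((?n k)\<^sup>2 + ?n k + 2 / 9) = 27 * (?n k)\<^sup>2 + 27 * ?n k + 6"
    proof -
      have "27 * (2 / 9) = (6::'a)" using nz by (simp add: nonzero_divide_eq_eq)
      then show ?thesis by (simp only: distrib_left)
    qed
    also have "\<dots> = 3 * (3 * ?n k + 1) * (3 * ?n k + 2)" by (simp add: algebra_simps power2_eq_square)
    finally show ?thesis by (simp only: mult.assoc[symmetric])
  qed
  finally have "?n (Suc k) ^ 2 * ?n (coeffs3 (Suc k)) / 27 ^ Suc k = 27 * (((?n k)\<^sup>2 + ?n k + 2 / 9) * ?n (coeffs3 k)) / 27 ^ Suc k"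
    by simp
  then show "(?n (k + 1))\<^sup>2 * t3 (k + 1) = ((?n k)\<^sup>2 + ?n k + 2 / 9) * t3 k"
    unfolding t3_def Suc_eq_plus1[symmetric] using nz by (simp del: of_nat_Suc)
next
  let ?n = "of_nat :: nat \<Rightarrow> 'a" and ?M = "2 * r div 3"
  note nz = numerals_nonzero
  have "CHAR('a) = 3 * ?M + 1 \<or> CHAR('a) = 3 * ?M + 2" using char_eq char_mod_3 by presburger
  then have "?n (3 * ?M + 1) = 0 \<or> ?n (3 * ?M + 2) = 0" by (metis of_nat_CHAR)
  then have z: "(3 * ?n ?M + 1) * (3 * ?n ?M + 2) = 0" by (auto simp: add.commute)
  have "9 * ((?n ?M)\<^sup>2 + ?n ?M + 2 / 9) = 9 * (?n ?M)\<^sup>2 + 9 * ?n ?M + 2"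
    using nz by (simp add: distrib_left)
  also have "\<dots> = (3 * ?n ?M + 1) * (3 * ?n ?M + 2)" by (simp add: algebra_simps power2_eq_square)
  finally have "9 * ((?n ?M)\<^sup>2 + ?n ?M + 2 / 9) = 0" unfolding z .
  then show "(?n ?M)\<^sup>2 + ?n ?M + 2 / 9 = 0" using nz by (simp only: mult_eq_0_iff simp_thms)
  show "t3 0 = 1" by (simp add: t3_def coeffs3_def)
  have M: "3 * ?M \<le> 2 * r" by simp
  show "t3 ?M \<noteq> 0"
    using nz of_nat_choose_nonzero[of ?M "2 * ?M"] of_nat_choose_nonzero[of ?M "3 * ?M"] char_eq M
    by (auto simp: t3_def coeffs3_def)
  show "?M < CHAR('a)" using char_eq by linarith
qed

lemma hasse_coeff_r: "hasse_coeff (f :: 'a poly) = coeff (f ^ r) (2 * r)"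
  unfolding hasse_coeff_def using char_eq by simp

text \<open>After removal of the factor \<open>x\<close> the invariant is the middle coefficient of
  a trinomial power. Half-integer binomials turn \<open>r choose (2 * k)\<close> into
  \<open>4 k choose (2 k)\<close> over \<open>16^k\<close>, and \<open>(- 2 w)^2 = 4 y\<close>
  leaves \<open>- 2 w\<close> only to the parity of \<open>r\<close>.\<close>

lemma hasse_family2:
  fixes w y :: 'a
  assumes "w\<^sup>2 = y"
  shows "hasse_coeff [:0, y - 64, - 2 * w, 1:] = (- 2 * w) ^ (r mod 2) * 4 ^ (r div 2) * h2.hform y (y - 64)"
proof -
  note nz = numerals_nonzero
  let ?\<alpha> = "- 2 * w" and ?\<beta> = "y - 64" and ?M = "r div 2"
  have "[:0, ?\<beta>, ?\<alpha>, 1:] ^ r = Polynomial.monom 1 r * [:?\<beta>, ?\<alpha>, 1:] ^ r"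
  proof -
    have "[:0, ?\<beta>, ?\<alpha>, 1:] = [:0, 1:] * [:?\<beta>, ?\<alpha>, 1:]" by simp
    then show ?thesis by (simp only: power_mult_distrib monom_altdef smult_1_left)
  qed
  then have "hasse_coeff [:0, ?\<beta>, ?\<alpha>, 1:] = coeff ([:?\<beta>, ?\<alpha>, 1:] ^ r) r"
    by (simp add: hasse_coeff_r coeff_monom_mult)
  also have "\<dots> = (\<Sum>k\<le>?M. of_nat (r choose (2 * k)) * of_nat (2 * k choose k) * ?\<beta> ^ k * ?\<alpha> ^ (r - 2 * k))"
    by (rule coeff_trinomial_power)
  also have "\<dots> = (\<Sum>k\<le>?M. ?\<alpha> ^ (r mod 2) * 4 ^ ?M * (t2 k * y ^ (?M - k) * ?\<beta> ^ k))"
  proof (intro sum.cong refl)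
    fix k assume "k \<in> {..?M}"
    then have k: "k \<le> ?M" by simp
    then have "2 * k < CHAR('a)" using char_eq by linarith
    then have "of_nat (r choose (2 * k)) * (- 4) ^ (2 * k) = (of_nat (2 * (2 * k) choose (2 * k)) :: 'a)"
      by (rule choose_half)
    moreover have "(- 4 :: 'a) ^ (2 * k) = 16 ^ k" by (simp add: power_mult)
    ultimately have "of_nat (r choose (2 * k)) * 16 ^ k = (of_nat (4 * k choose (2 * k)) :: 'a)" by simp
    then have c: "of_nat (r choose (2 * k)) = (of_nat (4 * k choose (2 * k)) / 16 ^ k :: 'a)"
      using nz by (simp add: eq_divide_eq)
    have "r - 2 * k = r mod 2 + 2 * (?M - k)" using k by presburger
    then have "?\<alpha> ^ (r - 2 * k) = ?\<alpha> ^ (r mod 2) * (?\<alpha>\<^sup>2) ^ (?M - k)" by (simp only: power_add power_mult)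
    also have "?\<alpha>\<^sup>2 = 4 * y" by (simp add: assms[symmetric] power_mult_distrib)
    also have "(4 * y) ^ (?M - k) = 4 ^ ?M / 4 ^ k * y ^ (?M - k)"
      using nz k by (simp add: power_mult_distrib power_diff)
    finally have a: "?\<alpha> ^ (r - 2 * k) = ?\<alpha> ^ (r mod 2) * (4 ^ ?M / 4 ^ k * y ^ (?M - k))" .
    have d: "(64::'a) ^ k = 16 ^ k * 4 ^ k" by (simp flip: power_mult_distrib)
    show "of_nat (r choose (2 * k)) * of_nat (2 * k choose k) * ?\<beta> ^ k * ?\<alpha> ^ (r - 2 * k) =
        ?\<alpha> ^ (r mod 2) * 4 ^ ?M * (t2 k * y ^ (?M - k) * ?\<beta> ^ k)"
      unfolding c a t2_def coeffs2_def of_nat_mult d by simp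
  qed
  also have "\<dots> = ?\<alpha> ^ (r mod 2) * 4 ^ ?M * h2.hform y ?\<beta>"
    unfolding h2.hform_def sum_distrib_left ..
  finally show ?thesis .
qed

text \<open>The powers of 4 from \<open>4 (y - 27)\<close> and the sign from
  \<open>choose_reflect\<close> combine to the \<open>(- 4)^i\<close> of \<open>choose_half\<close>;
  \<open>(3 w)^3 = 27 y\<close> leaves \<open>3 w\<close> to the power
  \<open>2 r mod 3\<close>.\<close>

lemma hasse_family3:
  fixes w y :: 'a
  assumes "w ^ 3 = y"
  shows "hasse_coeff [:(4 * (y - 27))\<^sup>2, 2 * (3 * w) * (4 * (y - 27)), (3 * w)\<^sup>2, 1:] =
    (3 * w) ^ (2 * r mod 3) * 27 ^ (2 * r div 3) * h3.hform y (y - 27)"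
proof -
  note nz = numerals_nonzero
  let ?\<alpha> = "3 * w" and ?\<beta> = "4 * (y - 27)" and ?M = "2 * r div 3"
  have "hasse_coeff [:?\<beta>\<^sup>2, 2 * ?\<alpha> * ?\<beta>, ?\<alpha>\<^sup>2, 1:] =
      (\<Sum>i\<le>?M. of_nat (r choose i) * of_nat (2 * r - 2 * i choose i) * ?\<beta> ^ i * ?\<alpha> ^ (2 * r - 3 * i))"
    unfolding hasse_coeff_r by (rule coeff_cubic_plus_square_power)
  also have "\<dots> = (\<Sum>i\<le>?M. ?\<alpha> ^ (2 * r mod 3) * 27 ^ ?M * (t3 i * y ^ (?M - i) * (y - 27) ^ i))"
  proof (intro sum.cong refl)
    fix i assume "i \<in> {..?M}"
    then have i: "i \<le> ?M" by simp
    then have i3: "3 * i \<le> 2 * r" by linarith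
    then have "i < CHAR('a)" using char_eq by linarith
    then have "of_nat (r choose i) * (- 4) ^ i = (of_nat (2 * i choose i) :: 'a)" by (rule choose_half)
    then have sgn: "of_nat (r choose i) * 4 ^ i * (- 1) ^ i = (of_nat (2 * i choose i) :: 'a)"
      by (simp only: mult.assoc power_mult_distrib[symmetric]) simp
    have c': "of_nat (r choose i) * 4 ^ i * of_nat (2 * r - 2 * i choose i) = (of_nat (coeffs3 i) :: 'a)"
    proof -
      have "of_nat (r choose i) * 4 ^ i * of_nat (2 * r - 2 * i choose i) =
          (of_nat (r choose i) * 4 ^ i * (- 1) ^ i) * (of_nat (3 * i choose i) :: 'a)"
        unfolding choose_reflect[OF i3] by (simp only: mult.assoc)
      also note sgn
      finally show ?thesis by (simp add: coeffs3_def)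
    qed
    have "2 * r - 3 * i = e + 3 * (M - i)" if "3 * M + e = 2 * r" "i \<le> M" for M e :: nat
      using that by linarith
    from this[OF mult_div_mod_eq i] have "2 * r - 3 * i = 2 * r mod 3 + 3 * (?M - i)" .
    then have "?\<alpha> ^ (2 * r - 3 * i) = ?\<alpha> ^ (2 * r mod 3) * (?\<alpha> ^ 3) ^ (?M - i)" by (simp only: power_add power_mult)
    also have "?\<alpha> ^ 3 = 27 * y" by (simp add: assms[symmetric] power_mult_distrib)
    also have "(27 * y) ^ (?M - i) = 27 ^ ?M / 27 ^ i * y ^ (?M - i)"
      using nz i by (simp add: power_mult_distrib power_diff)
    finally have a: "?\<alpha> ^ (2 * r - 3 * i) = ?\<alpha> ^ (2 * r mod 3) * (27 ^ ?M / 27 ^ i * y ^ (?M - i))" .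
    have "of_nat (r choose i) * of_nat (2 * r - 2 * i choose i) * ?\<beta> ^ i =
        (of_nat (r choose i) * 4 ^ i * of_nat (2 * r - 2 * i choose i)) * (y - 27) ^ i"
      unfolding power_mult_distrib by (simp only: mult.assoc mult.commute mult.left_commute)
    then show "of_nat (r choose i) * of_nat (2 * r - 2 * i choose i) * ?\<beta> ^ i * ?\<alpha> ^ (2 * r - 3 * i) =
        ?\<alpha> ^ (2 * r mod 3) * 27 ^ ?M * (t3 i * y ^ (?M - i) * (y - 27) ^ i)"
      unfolding c' a t3_def by simp
  qed
  also have "\<dots> = ?\<alpha> ^ (2 * r mod 3) * 27 ^ ?M * h3.hform y (y - 27)"
    unfolding h3.hform_def sum_distrib_left ..
  finally show ?thesis .
qed

text \<open>Every \<open>y\<close> has a square root \<open>w\<close>, so the family covers all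
  parameters. The extra factor \<open>(- 2 w)^(r mod 2)\<close> vanishes only for odd
  \<open>r\<close> and \<open>y = 0\<close>, which accounts for the power of
  \<open>X\<close>.\<close>

lemma product_family2:
  "(\<Prod>y | y \<noteq> 64 \<and> supersingular_j ((y + 192) ^ 3 / (y - 64)\<^sup>2). [:- y, 1:]) =
    Polynomial.monom 1 (r mod 2) * h2.rev_poly 64"
proof (rule h2.rev_poly_factorization)
  fix y :: 'a
  obtain w where w: "w\<^sup>2 = y" using nth_root_exists[of 2 y] by auto
  have "y \<noteq> 64 \<Longrightarrow> supersingular_j ((y + 192) ^ 3 / (y - 64)\<^sup>2) \<longleftrightarrow> r mod 2 = 1 \<and> y = 0 \<or> h2.hform y (y - 64) = 0"
    unfolding supersingular_family2[OF w] hasse_family2[OF w]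
    using two_three_nonzero numerals_nonzero w by auto
  then show "y \<in> {y. y \<noteq> 64 \<and> supersingular_j ((y + 192) ^ 3 / (y - 64)\<^sup>2)} \<longleftrightarrow>
      y \<noteq> 64 \<and> (r mod 2 = 1 \<and> y = 0 \<or> h2.hform y (y - 64) = 0)" by blast
qed (use numerals_nonzero in auto)

lemma product_family3:
  "(\<Prod>y | y \<noteq> 27 \<and> supersingular_j (y * (y + 216) ^ 3 / (y - 27) ^ 3). [:- y, 1:]) =
    Polynomial.monom 1 (2 * r mod 3) * h3.rev_poly 27"
proof (rule h3.rev_poly_factorization)
  fix y :: 'a
  have m: "2 * r mod 3 = 0 \<or> 2 * r mod 3 = 1" using char_mod_3 by linarith
  obtain w where w: "w ^ 3 = y" using nth_root_exists[of 3 y] by auto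
  have "y \<noteq> 27 \<Longrightarrow> supersingular_j (y * (y + 216) ^ 3 / (y - 27) ^ 3) \<longleftrightarrow> 2 * r mod 3 = 1 \<and> y = 0 \<or> h3.hform y (y - 27) = 0"
    unfolding supersingular_family3[OF w] hasse_family3[OF w]
    using two_three_nonzero numerals_nonzero w m by auto
  then show "y \<in> {y. y \<noteq> 27 \<and> supersingular_j (y * (y + 216) ^ 3 / (y - 27) ^ 3)} \<longleftrightarrow>
      y \<noteq> 27 \<and> (2 * r mod 3 = 1 \<and> y = 0 \<or> h3.hform y (y - 27) = 0)" by blast
qed (use numerals_nonzero char_mod_3 in \<open>auto simp: not_le\<close>)

text \<open>The sums of the theorem run up to \<open>M + e\<close> instead of \<open>M\<close>. If
  the additional coefficient vanishes, this only multiplies by \<open>X^e\<close>.\<close>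

lemma sum_monom_shift:
  assumes "e \<le> 1" "e = 1 \<Longrightarrow> c (Suc M) = (0::'a)"
  shows "(\<Sum>n\<le>M + e. Polynomial.monom (c n) (M + e - n)) =
    Polynomial.monom 1 e * (\<Sum>n\<le>M. Polynomial.monom (c n) (M - n))"
proof (cases "e = 0")
  case False
  then have "e = 1" using assms by simp
  then have "(\<Sum>n\<le>M + e. Polynomial.monom (c n) (M + e - n)) = (\<Sum>n\<le>M. Polynomial.monom (c n) (Suc M - n))"
    using assms by simp
  also have "\<dots> = (\<Sum>n\<le>M. Polynomial.monom 1 1 * Polynomial.monom (c n) (M - n))"
    by (intro sum.cong refl) (simp add: mult_monom Suc_diff_le)
  finally show ?thesis using \<open>e = 1\<close> by (simp add: sum_distrib_left)
qed simp

text \<open>For odd \<open>r\<close> the additional index \<open>n\<close> satisfies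
  \<open>4 n = p + 1\<close>, and \<open>p\<close> divides
  \<open>p + 1 choose (2 n)\<close>.\<close>

lemma expansion2:
  "(\<Sum>n\<le>r div 2 + r mod 2. Polynomial.monom (of_nat (coeffs2 n)) (r div 2 + r mod 2 - n)) =
    Polynomial.monom 1 (r mod 2) * h2.rev_poly 64"
proof -
  have "h2.rev_poly 64 = (\<Sum>n\<le>r div 2. Polynomial.monom (of_nat (coeffs2 n)) (r div 2 - n))"
    using numerals_nonzero by (simp add: h2.rev_poly_def t2_def)
  moreover have "(of_nat (coeffs2 (Suc (r div 2))) :: 'a) = 0" if "r mod 2 = 1"
  proof -
    define n where "n = Suc (r div 2)"
    have "4 * n = CHAR('a) + 1" using that char_eq unfolding n_def by presburger
    then have "CHAR('a) dvd 4 * n choose (2 * n)"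
      using char_ge_5 by (intro prime_dvd_choose[OF prime_char]) linarith+
    then show ?thesis by (simp add: of_nat_eq_0_iff_char_dvd coeffs2_def flip: n_def)
  qed
  ultimately show ?thesis by (subst sum_monom_shift) auto
qed

text \<open>If the remainder is 1, the additional index \<open>n\<close> satisfies
  \<open>3 n = p + 1\<close>, and \<open>p\<close> divides \<open>p + 1 choose n\<close>.\<close>

lemma expansion3:
  "(\<Sum>n\<le>2 * r div 3 + 2 * r mod 3. Polynomial.monom (of_nat (coeffs3 n)) (2 * r div 3 + 2 * r mod 3 - n)) =
    Polynomial.monom 1 (2 * r mod 3) * h3.rev_poly 27"
proof -
  have "h3.rev_poly 27 = (\<Sum>n\<le>2 * r div 3. Polynomial.monom (of_nat (coeffs3 n)) (2 * r div 3 - n))"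
    using numerals_nonzero by (simp add: h3.rev_poly_def t3_def)
  moreover have "(of_nat (coeffs3 (Suc (2 * r div 3))) :: 'a) = 0" if "2 * r mod 3 = 1"
  proof -
    define n where "n = Suc (2 * r div 3)"
    have "3 * n = CHAR('a) + 1" using that char_eq unfolding n_def by presburger
    then have "CHAR('a) dvd 3 * n choose n"
      using char_ge_5 by (intro prime_dvd_choose[OF prime_char]) linarith+
    then show ?thesis by (simp add: of_nat_eq_0_iff_char_dvd coeffs3_def flip: n_def)
  qed
  moreover have "2 * r mod 3 \<le> 1" using char_mod_3 by linarith
  ultimately show ?thesis by (subst sum_monom_shift) auto
qed

section \<open>The Legendre symbols of -1 and -3\<close>

lemma of_int_Legendre: "(of_int (Legendre x (int CHAR('a))) :: 'a) = of_int x ^ r"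
proof -
  have "[Legendre x (int CHAR('a)) = x ^ r] (mod int CHAR('a))"
    unfolding r_def using prime_char char_ge_5 by (intro euler_criterion) auto
  then have "(of_int (Legendre x (int CHAR('a))) :: 'a) = of_int (x ^ r)"
    by (simp only: of_int_eq_iff_cong_CHAR)
  then show ?thesis by simp
qed

text \<open>The symbol is -1, 0 or 1, and these remain distinct in the field, so it can be read off
  from its image there.\<close>

lemma Legendre_eqI:
  assumes "of_int x ^ r = (- 1 :: 'a) ^ e" "e \<le> 1"
  shows "1 / 2 * (1 - real_of_int (Legendre x (int CHAR('a)))) = real e"
proof -
  have "Legendre x (int CHAR('a)) \<in> {- 1, 0, 1}" by (simp add: Legendre_def)
  moreover have "(1::'a) \<noteq> - 1" using two_three_nonzero(1) by (metis one_add_one add.right_inverse)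
  moreover have "(of_int (Legendre x (int CHAR('a))) :: 'a) = (- 1) ^ e" using assms of_int_Legendre by simp
  moreover have "e = 0 \<or> e = 1" using assms by linarith
  ultimately show ?thesis by auto
qed

lemma Legendre_minus_1: "1 / 2 * (1 - real_of_int (Legendre (- 1) (int CHAR('a)))) = real (r mod 2)"
proof (rule Legendre_eqI)
  have "(- 1 :: 'a) ^ (2 * (r div 2) + r mod 2) = (- 1) ^ (r mod 2)" by (simp only: power_add power_mult) simp
  then show "of_int (- 1) ^ r = (- 1 :: 'a) ^ (r mod 2)" by simp
qed simp

lemma Legendre_minus_3: "1 / 2 * (1 - real_of_int (Legendre (- 3) (int CHAR('a)))) = real (2 * r mod 3)"
proof (rule Legendre_eqI)
  have frob: "(x + y) ^ CHAR('a) = x ^ CHAR('a) + y ^ CHAR('a)" for x y :: 'a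
    by (rule freshmans_dream[OF prime_char refl])
  \<comment> \<open>\<open>s = 2 w + 1\<close> for a primitive cube root of unity \<open>w\<close>, so the Frobenius map fixes or negates \<open>s\<close>
    according to \<open>p\<close> modulo \<open>3\<close>.\<close>
  obtain s :: 'a where s: "s\<^sup>2 = - 3" using nth_root_exists[of 2 "- 3 :: 'a"] by auto
  then have "s \<noteq> 0" using two_three_nonzero by auto
  define w where "w = (s - 1) / 2"
  have "2 * w = s - 1" using two_three_nonzero by (simp add: w_def)
  then have sw: "s = w + w + 1" by (simp add: algebra_simps)
  have "4 * (w\<^sup>2 + w + 1) = s\<^sup>2 + 3" unfolding sw by (simp add: algebra_simps power2_eq_square)
  then have "4 * (w\<^sup>2 + w + 1) = 0" unfolding s by simp
  then have w2: "w\<^sup>2 + w + 1 = 0" using numerals_nonzero by (simp only: mult_eq_0_iff simp_thms)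
  have "w ^ 3 - 1 = (w - 1) * (w\<^sup>2 + w + 1)" by (simp add: algebra_simps power2_eq_square power3_eq_cube)
  then have w3: "w ^ 3 = 1" unfolding w2 by simp
  have "w ^ (3 * n + m) = w ^ m" for n m by (simp only: power_add power_mult w3 power_one mult_1)
  moreover have "CHAR('a) = 3 * (2 * r div 3) + (2 * r mod 3 + 1)" using char_eq by presburger
  ultimately have wp: "w ^ CHAR('a) = w ^ (2 * r mod 3 + 1)" by (simp only:)
  have "(- 3) ^ r * s = s ^ CHAR('a)"
    unfolding char_eq power_add power_mult s by simp
  also have "\<dots> = w ^ CHAR('a) + w ^ CHAR('a) + 1" unfolding sw frob by simp
  also have "\<dots> = (- 1) ^ (2 * r mod 3) * s"
  proof -
    consider "2 * r mod 3 = 0" | "2 * r mod 3 = 1" using char_mod_3 by linarith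
    then show ?thesis
    proof cases
      case 2
      have "w\<^sup>2 = (w\<^sup>2 + w + 1) - w - 1" by simp
      then have "w\<^sup>2 = - w - 1" unfolding w2 by simp
      then show ?thesis unfolding wp 2 sw by (simp add: numeral_2_eq_2)
    qed (simp add: wp sw)
  qed
  finally show "of_int (- 3) ^ r = (- 1 :: 'a) ^ (2 * r mod 3)" using \<open>s \<noteq> 0\<close> by simp
  show "2 * r mod 3 \<le> 1" using char_mod_3 by linarith
qed

end

lemma map_poly_to_ac_sum_monom:
  "map_poly to_ac (\<Sum>n = 0..N. Polynomial.monom (of_nat (c n)) (N - n)) =
    (\<Sum>n\<le>N. Polynomial.monom (of_nat (c n)) (N - n))"
proof (rule poly_eqI)
  fix k
  show "coeff (map_poly to_ac (\<Sum>n = 0..N. Polynomial.monom (of_nat (c n)) (N - n))) k =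
      coeff (\<Sum>n\<le>N. Polynomial.monom (of_nat (c n)) (N - n)) k"
    by (simp add: coeff_map_poly coeff_sum to_ac_sum atLeast0AtMost if_distrib[of to_ac] cong: if_cong)
qed

theorem theorem2p5:
  fixes p \<delta> \<epsilon> :: nat
  assumes "p = CARD('p::prime_card)" and "p \<ge> 5"
    and "real \<delta> = 1 / 2 * (1 - real_of_int (Legendre (-3) (int p)))"
    and "real \<epsilon> = 1 / 2 * (1 - real_of_int (Legendre (-1) (int p)))"
  shows "(ss2 :: 'p mod_ring alg_closure poly) =
           map_poly to_ac (\<Sum>n = 0..(p - 1 + 2 * \<epsilon>) div 4.
             Polynomial.monom (of_nat ((2 * n choose n) * (4 * n choose (2 * n))))
                   ((p - 1 + 2 * \<epsilon>) div 4 - n) :: 'p mod_ring poly) \<and>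
         (ss3 :: 'p mod_ring alg_closure poly) =
           map_poly to_ac (\<Sum>n = 0..(p - 1 + 2 * \<delta>) div 3.
             Polynomial.monom (of_nat ((2 * n choose n) * (3 * n choose n)))
                   ((p - 1 + 2 * \<delta>) div 3 - n) :: 'p mod_ring poly)"
proof -
  let ?K = "TYPE('p mod_ring alg_closure)"
  have p: "CHAR('p mod_ring alg_closure) = p" using assms(1) by simp
  interpret prime_closure ?K
    using assms(2) prime_card[where 'a = 'p] prime_field_closure_periodic
    by unfold_locales (simp_all add: p assms(1))
  have p2: "p - 1 = 2 * r" using char_eq p by simp
  have \<epsilon>: "\<epsilon> = r mod 2" using assms(4) Legendre_minus_1 p by simp
  have \<delta>: "\<delta> = 2 * r mod 3" using assms(3) Legendre_minus_3 p by simp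
  \<comment> \<open>Both divisions are exact: for \<open>r = 2 M + e\<close> the first numerator is
    \<open>4 (M + e)\<close>, and for \<open>2 r = 3 M + e\<close> the second is
    \<open>3 (M + e)\<close>.\<close>
  have N2: "(p - 1 + 2 * \<epsilon>) div 4 = r div 2 + r mod 2"
    unfolding p2 \<epsilon> by presburger
  have N3: "(p - 1 + 2 * \<delta>) div 3 = 2 * r div 3 + 2 * r mod 3"
    unfolding p2 \<delta> using char_mod_3 by presburger
  show ?thesis
    unfolding N2 N3 map_poly_to_ac_sum_monom coeffs2_def[symmetric] coeffs3_def[symmetric] expansion2 expansion3
      ss2_def ss3_def S2_def S3_def product_family2 product_family3 by simp
qed

end
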